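(* Every generalised triple derivation from a real or complex C$^*$-algebra $A$ to a Jordan Banach triple $A$-module is continuous.
   Context: A real C$^*$-algebra is a closed $^*$-invariant real subalgebra of a C$^*$-algebra. A real or complex C$^*$-algebra $A$ is regarded as a (real or complex) Jordan triple with the product $\{a,b,c\}=\frac12(ab^*c+cb^*a)$. Let $E$ be a complex (resp. real) Jordan triple. A Jordan triple $E$-module is a complex (resp. real) vector space $X$ with three mappings $\{\cdot,\cdot,\cdot\}_1:X\times E\times E\to X$, $\{\cdot,\cdot,\cdot\}_2:E\times X\times E\to X$, $\{\cdot,\cdot,\cdot\}_3:E\times E\times X\to X$ such that: (JTM1) $\{x,a,b\}_1$ is linear in $a$ and $x$ and conjugate linear in $b$ (resp. trilinear), $\{a,b,x\}_3$ is linear in $b$ and $x$ and conjugate linear in $a$ (resp. trilinear), and $\{a,x,b\}_2$ is conjugate linear in $a,b,x$ (resp. trilinear); (JTM2) $\{x,b,a\}_1=\{a,b,x\}_3$ and $\{a,x,b\}_2=\{b,x,a\}_2$ for all $a,b\in E$, $x\in X$; (JTM3) writing $\{\cdot,\cdot,\cdot\}$ for any of these products and for the product of $E$, $\{a,b,\{c,d,e\}\}=\{\{a,b,c\},d,e\}-\{c,\{b,a,d\},e\}+\{c,d,\{a,b,e\}\}$ holds whenever one of $a,b,c,d,e$ is in $X$ and the rest are in $E$. When $E$ is a Banach space with continuous triple product, $X$ is a Jordan Banach triple $E$-module if moreover $X$ is a Banach space and the three products are jointly continuous. A linear (if $E$ is real), respectively conjugate linear (if $E$ is complex), not necessarily continuous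 mapping $\delta:E\to X$ is a generalised triple derivation if $(a,b,c)\mapsto\delta\{a,b,c\}-\{\delta(a),b,c\}-\{a,\delta(b),c\}-\{a,b,\delta(c)\}$ is jointly continuous from $E\times E\times E$ to $X$. *)

theory Defs
  imports "HOL-Analysis.Analysis"
begin

section \<open>Complex vector spaces, Banach spaces and C*-algebras\<close>

text \<open>
  A complex scalar multiplication is added on top of the real classes, so that every complex
  vector space is also a real one and the norm and topology are the library's.
\<close>

class complex_vector = real_vector +
  fixes scaleC :: "complex \<Rightarrow> 'a \<Rightarrow> 'a"  (infixr "*\<^sub>C" 75)
  assumes scaleC_add_right: "c *\<^sub>C (x + y) = c *\<^sub>C x + c *\<^sub>C y"
    and scaleC_add_left: "(c + d) *\<^sub>C x = c *\<^sub>C x + d *\<^sub>C x"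
    and scaleC_scaleC: "c *\<^sub>C (d *\<^sub>C x) = (c * d) *\<^sub>C x"
    and scaleC_one: "1 *\<^sub>C x = x"
    and scaleR_scaleC: "r *\<^sub>R x = complex_of_real r *\<^sub>C x"

class complex_banach = banach + complex_vector +
  assumes norm_scaleC: "norm (c *\<^sub>C x) = cmod c * norm x"

text \<open>C*-algebras are not assumed to be unital.\<close>

class cstar_algebra = real_normed_algebra + complex_banach +
  fixes star :: "'a \<Rightarrow> 'a"
  assumes scaleC_mult_left: "(c *\<^sub>C x) * y = c *\<^sub>C (x * y)"
    and scaleC_mult_right: "x * (c *\<^sub>C y) = c *\<^sub>C (x * y)"
    and star_add: "star (x + y) = star x + star y"
    and star_scaleC: "star (c *\<^sub>C x) = cnj c *\<^sub>C star x"
    and star_mult: "star (x * y) = star y * star x"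
    and star_star: "star (star x) = x"
    and cstar_identity: "norm (star x * x) = (norm x)\<^sup>2"

definition real_cstar_algebra :: "'b::cstar_algebra set \<Rightarrow> bool" where
  "real_cstar_algebra A \<longleftrightarrow> closed A \<and> subspace A \<and>
     (\<forall>a\<in>A. \<forall>b\<in>A. a * b \<in> A) \<and> (\<forall>a\<in>A. star a \<in> A)"

definition cstar_triple :: "'a::cstar_algebra \<Rightarrow> 'a \<Rightarrow> 'a \<Rightarrow> 'a" where
  "cstar_triple a b c = (1/2) *\<^sub>R (a * star b * c + c * star b * a)"

section \<open>Linear maps on a carrier\<close>

definition real_linear_on :: "'e::real_vector set \<Rightarrow> ('e \<Rightarrow> 'x::real_vector) \<Rightarrow> bool" where
  "real_linear_on E f \<longleftrightarrow> (\<forall>x\<in>E. \<forall>y\<in>E. f (x + y) = f x + f y) \<and>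
     (\<forall>r. \<forall>x\<in>E. f (r *\<^sub>R x) = r *\<^sub>R f x)"

definition complex_linear_on :: "'e::complex_vector set \<Rightarrow> ('e \<Rightarrow> 'x::complex_vector) \<Rightarrow> bool" where
  "complex_linear_on E f \<longleftrightarrow> (\<forall>x\<in>E. \<forall>y\<in>E. f (x + y) = f x + f y) \<and>
     (\<forall>c. \<forall>x\<in>E. f (c *\<^sub>C x) = c *\<^sub>C f x)"

definition conj_linear_on :: "'e::complex_vector set \<Rightarrow> ('e \<Rightarrow> 'x::complex_vector) \<Rightarrow> bool" where
  "conj_linear_on E f \<longleftrightarrow> (\<forall>x\<in>E. \<forall>y\<in>E. f (x + y) = f x + f y) \<and>
     (\<forall>c. \<forall>x\<in>E. f (c *\<^sub>C x) = cnj c *\<^sub>C f x)"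

section \<open>Jordan triples\<close>

text \<open>
  A Jordan triple is a carrier set inside an ambient type; a real C*-algebra is in general only a
  real subspace of its ambient C*-algebra.  Nothing is required of the product outside the carrier.
\<close>

locale jordan_triple_laws =
  fixes E :: "'e::ab_group_add set" and tri :: "'e \<Rightarrow> 'e \<Rightarrow> 'e \<Rightarrow> 'e"
  assumes tri_closed: "\<lbrakk>a \<in> E; b \<in> E; c \<in> E\<rbrakk> \<Longrightarrow> tri a b c \<in> E"
    and tri_commute: "\<lbrakk>a \<in> E; b \<in> E; c \<in> E\<rbrakk> \<Longrightarrow> tri a b c = tri c b a"
    and jordan_identity: "\<lbrakk>a \<in> E; b \<in> E; c \<in> E; d \<in> E; e \<in> E\<rbrakk> \<Longrightarrow>
      tri a b (tri c d e) = tri (tri a b c) d e - tri c (tri b a d) e + tri c d (tri a b e)"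

locale real_jordan_triple = jordan_triple_laws E tri
  for E :: "'e::real_vector set" and tri +
  assumes carrier_subspace: "subspace E"
    and tri_linear1: "\<lbrakk>b \<in> E; c \<in> E\<rbrakk> \<Longrightarrow> real_linear_on E (\<lambda>a. tri a b c)"
    and tri_linear2: "\<lbrakk>a \<in> E; c \<in> E\<rbrakk> \<Longrightarrow> real_linear_on E (\<lambda>b. tri a b c)"
    and tri_linear3: "\<lbrakk>a \<in> E; b \<in> E\<rbrakk> \<Longrightarrow> real_linear_on E (\<lambda>c. tri a b c)"

locale complex_jordan_triple = jordan_triple_laws E tri
  for E :: "'e::complex_vector set" and tri +
  assumes carrier_subspace: "module.subspace scaleC E"
    and tri_linear1: "\<lbrakk>b \<in> E; c \<in> E\<rbrakk> \<Longrightarrow> complex_linear_on E (\<lambda>a. tri a b c)"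
    and tri_linear2: "\<lbrakk>a \<in> E; c \<in> E\<rbrakk> \<Longrightarrow> conj_linear_on E (\<lambda>b. tri a b c)"
    and tri_linear3: "\<lbrakk>a \<in> E; b \<in> E\<rbrakk> \<Longrightarrow> complex_linear_on E (\<lambda>c. tri a b c)"

section \<open>Jordan triple modules\<close>

text \<open>
  The module is a whole type.  The subscript of a product is the position of the module element.
  The five main identities are the Jordan identity
  \<open>{a,b,{c,d,e}} = {{a,b,c},d,e} - {c,{b,a,d},e} + {c,d,{a,b,e}}\<close>
  with the module element \<open>x\<close> in place of \<open>a\<close>, \<open>b\<close>, \<open>c\<close>, \<open>d\<close>, \<open>e\<close> in turn.
\<close>

locale jordan_triple_module_laws =
  fixes E :: "'e::ab_group_add set" and tri :: "'e \<Rightarrow> 'e \<Rightarrow> 'e \<Rightarrow> 'e"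
    and p\<^sub>1 :: "'x::ab_group_add \<Rightarrow> 'e \<Rightarrow> 'e \<Rightarrow> 'x"
    and p\<^sub>2 :: "'e \<Rightarrow> 'x \<Rightarrow> 'e \<Rightarrow> 'x"
    and p\<^sub>3 :: "'e \<Rightarrow> 'e \<Rightarrow> 'x \<Rightarrow> 'x"
  assumes p1_p3: "\<lbrakk>a \<in> E; b \<in> E\<rbrakk> \<Longrightarrow> p\<^sub>1 x b a = p\<^sub>3 a b x"
    and p2_commute: "\<lbrakk>a \<in> E; b \<in> E\<rbrakk> \<Longrightarrow> p\<^sub>2 a x b = p\<^sub>2 b x a"
    and main_identity_a: "\<lbrakk>b \<in> E; c \<in> E; d \<in> E; e \<in> E\<rbrakk> \<Longrightarrow>
      p\<^sub>1 x b (tri c d e) = p\<^sub>1 (p\<^sub>1 x b c) d e - p\<^sub>2 c (p\<^sub>2 b x d) e + p\<^sub>3 c d (p\<^sub>1 x b e)"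
    and main_identity_b: "\<lbrakk>a \<in> E; c \<in> E; d \<in> E; e \<in> E\<rbrakk> \<Longrightarrow>
      p\<^sub>2 a x (tri c d e) = p\<^sub>1 (p\<^sub>2 a x c) d e - p\<^sub>2 c (p\<^sub>1 x a d) e + p\<^sub>3 c d (p\<^sub>2 a x e)"
    and main_identity_c: "\<lbrakk>a \<in> E; b \<in> E; d \<in> E; e \<in> E\<rbrakk> \<Longrightarrow>
      p\<^sub>3 a b (p\<^sub>1 x d e) = p\<^sub>1 (p\<^sub>3 a b x) d e - p\<^sub>1 x (tri b a d) e + p\<^sub>1 x d (tri a b e)"
    and main_identity_d: "\<lbrakk>a \<in> E; b \<in> E; c \<in> E; e \<in> E\<rbrakk> \<Longrightarrow>
      p\<^sub>3 a b (p\<^sub>2 c x e) = p\<^sub>2 (tri a b c) x e - p\<^sub>2 c (p\<^sub>3 b a x) e + p\<^sub>2 c x (tri a b e)"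
    and main_identity_e: "\<lbrakk>a \<in> E; b \<in> E; c \<in> E; d \<in> E\<rbrakk> \<Longrightarrow>
      p\<^sub>3 a b (p\<^sub>3 c d x) = p\<^sub>3 (tri a b c) d x - p\<^sub>3 c (tri b a d) x + p\<^sub>3 c d (p\<^sub>3 a b x)"

locale real_jordan_triple_module =
  real_jordan_triple E tri + jordan_triple_module_laws E tri p\<^sub>1 p\<^sub>2 p\<^sub>3
  for E :: "'e::real_vector set" and tri
    and p\<^sub>1 :: "'x::real_vector \<Rightarrow> 'e \<Rightarrow> 'e \<Rightarrow> 'x" and p\<^sub>2 p\<^sub>3 +
  assumes p1_linear1: "\<lbrakk>a \<in> E; b \<in> E\<rbrakk> \<Longrightarrow> real_linear_on UNIV (\<lambda>x. p\<^sub>1 x a b)"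
    and p1_linear2: "b \<in> E \<Longrightarrow> real_linear_on E (\<lambda>a. p\<^sub>1 x a b)"
    and p1_linear3: "a \<in> E \<Longrightarrow> real_linear_on E (\<lambda>b. p\<^sub>1 x a b)"
    and p2_linear1: "b \<in> E \<Longrightarrow> real_linear_on E (\<lambda>a. p\<^sub>2 a x b)"
    and p2_linear2: "\<lbrakk>a \<in> E; b \<in> E\<rbrakk> \<Longrightarrow> real_linear_on UNIV (\<lambda>x. p\<^sub>2 a x b)"
    and p2_linear3: "a \<in> E \<Longrightarrow> real_linear_on E (\<lambda>b. p\<^sub>2 a x b)"
    and p3_linear1: "b \<in> E \<Longrightarrow> real_linear_on E (\<lambda>a. p\<^sub>3 a b x)"
    and p3_linear2: "a \<in> E \<Longrightarrow> real_linear_on E (\<lambda>b. p\<^sub>3 a b x)"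
    and p3_linear3: "\<lbrakk>a \<in> E; b \<in> E\<rbrakk> \<Longrightarrow> real_linear_on UNIV (\<lambda>x. p\<^sub>3 a b x)"

locale complex_jordan_triple_module =
  complex_jordan_triple E tri + jordan_triple_module_laws E tri p\<^sub>1 p\<^sub>2 p\<^sub>3
  for E :: "'e::complex_vector set" and tri
    and p\<^sub>1 :: "'x::complex_vector \<Rightarrow> 'e \<Rightarrow> 'e \<Rightarrow> 'x" and p\<^sub>2 p\<^sub>3 +
  assumes p1_linear1: "\<lbrakk>a \<in> E; b \<in> E\<rbrakk> \<Longrightarrow> complex_linear_on UNIV (\<lambda>x. p\<^sub>1 x a b)"
    and p1_linear2: "b \<in> E \<Longrightarrow> complex_linear_on E (\<lambda>a. p\<^sub>1 x a b)"
    and p1_linear3: "a \<in> E \<Longrightarrow> conj_linear_on E (\<lambda>b. p\<^sub>1 x a b)"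
    and p2_linear1: "b \<in> E \<Longrightarrow> conj_linear_on E (\<lambda>a. p\<^sub>2 a x b)"
    and p2_linear2: "\<lbrakk>a \<in> E; b \<in> E\<rbrakk> \<Longrightarrow> conj_linear_on UNIV (\<lambda>x. p\<^sub>2 a x b)"
    and p2_linear3: "a \<in> E \<Longrightarrow> conj_linear_on E (\<lambda>b. p\<^sub>2 a x b)"
    and p3_linear1: "b \<in> E \<Longrightarrow> conj_linear_on E (\<lambda>a. p\<^sub>3 a b x)"
    and p3_linear2: "a \<in> E \<Longrightarrow> complex_linear_on E (\<lambda>b. p\<^sub>3 a b x)"
    and p3_linear3: "\<lbrakk>a \<in> E; b \<in> E\<rbrakk> \<Longrightarrow> complex_linear_on UNIV (\<lambda>x. p\<^sub>3 a b x)"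

locale jordan_banach_continuity =
  fixes E :: "'e::banach set" and tri :: "'e \<Rightarrow> 'e \<Rightarrow> 'e \<Rightarrow> 'e"
    and p\<^sub>1 :: "'x::banach \<Rightarrow> 'e \<Rightarrow> 'e \<Rightarrow> 'x"
    and p\<^sub>2 :: "'e \<Rightarrow> 'x \<Rightarrow> 'e \<Rightarrow> 'x"
    and p\<^sub>3 :: "'e \<Rightarrow> 'e \<Rightarrow> 'x \<Rightarrow> 'x"
  assumes carrier_complete: "complete E"
    and tri_continuous: "continuous_on (E \<times> E \<times> E) (\<lambda>(a, b, c). tri a b c)"
    and p1_continuous: "continuous_on (UNIV \<times> E \<times> E) (\<lambda>(x, a, b). p\<^sub>1 x a b)"
    and p2_continuous: "continuous_on (E \<times> UNIV \<times> E) (\<lambda>(a, x, b). p\<^sub>2 a x b)"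
    and p3_continuous: "continuous_on (E \<times> E \<times> UNIV) (\<lambda>(a, b, x). p\<^sub>3 a b x)"

locale real_jordan_banach_triple_module =
  real_jordan_triple_module E tri p\<^sub>1 p\<^sub>2 p\<^sub>3 + jordan_banach_continuity E tri p\<^sub>1 p\<^sub>2 p\<^sub>3
  for E :: "'e::banach set" and tri
    and p\<^sub>1 :: "'x::banach \<Rightarrow> 'e \<Rightarrow> 'e \<Rightarrow> 'x" and p\<^sub>2 p\<^sub>3

locale complex_jordan_banach_triple_module =
  complex_jordan_triple_module E tri p\<^sub>1 p\<^sub>2 p\<^sub>3 + jordan_banach_continuity E tri p\<^sub>1 p\<^sub>2 p\<^sub>3
  for E :: "'e::complex_banach set" and tri
    and p\<^sub>1 :: "'x::complex_banach \<Rightarrow> 'e \<Rightarrow> 'e \<Rightarrow> 'x" and p\<^sub>2 p\<^sub>3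

section \<open>Generalised triple derivations\<close>

definition derivation_defect ::
  "('e \<Rightarrow> 'e \<Rightarrow> 'e \<Rightarrow> 'e) \<Rightarrow> ('x \<Rightarrow> 'e \<Rightarrow> 'e \<Rightarrow> 'x) \<Rightarrow> ('e \<Rightarrow> 'x \<Rightarrow> 'e \<Rightarrow> 'x) \<Rightarrow>
   ('e \<Rightarrow> 'e \<Rightarrow> 'x \<Rightarrow> 'x) \<Rightarrow> ('e \<Rightarrow> 'x::ab_group_add) \<Rightarrow> 'e \<times> 'e \<times> 'e \<Rightarrow> 'x" where
  "derivation_defect tri p\<^sub>1 p\<^sub>2 p\<^sub>3 \<delta> =
     (\<lambda>(a, b, c). \<delta> (tri a b c) - p\<^sub>1 (\<delta> a) b c - p\<^sub>2 a (\<delta> b) c - p\<^sub>3 a b (\<delta> c))"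

definition real_generalised_triple_derivation ::
  "'e::banach set \<Rightarrow> ('e \<Rightarrow> 'e \<Rightarrow> 'e \<Rightarrow> 'e) \<Rightarrow> ('x \<Rightarrow> 'e \<Rightarrow> 'e \<Rightarrow> 'x) \<Rightarrow>
   ('e \<Rightarrow> 'x \<Rightarrow> 'e \<Rightarrow> 'x) \<Rightarrow> ('e \<Rightarrow> 'e \<Rightarrow> 'x \<Rightarrow> 'x) \<Rightarrow> ('e \<Rightarrow> 'x::banach) \<Rightarrow> bool" where
  "real_generalised_triple_derivation E tri p\<^sub>1 p\<^sub>2 p\<^sub>3 \<delta> \<longleftrightarrow>
     real_linear_on E \<delta> \<and>
     continuous_on (E \<times> E \<times> E) (derivation_defect tri p\<^sub>1 p\<^sub>2 p\<^sub>3 \<delta>)"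

definition complex_generalised_triple_derivation ::
  "'e::complex_banach set \<Rightarrow> ('e \<Rightarrow> 'e \<Rightarrow> 'e \<Rightarrow> 'e) \<Rightarrow> ('x \<Rightarrow> 'e \<Rightarrow> 'e \<Rightarrow> 'x) \<Rightarrow>
   ('e \<Rightarrow> 'x \<Rightarrow> 'e \<Rightarrow> 'x) \<Rightarrow> ('e \<Rightarrow> 'e \<Rightarrow> 'x \<Rightarrow> 'x) \<Rightarrow> ('e \<Rightarrow> 'x::complex_banach) \<Rightarrow> bool" where
  "complex_generalised_triple_derivation E tri p\<^sub>1 p\<^sub>2 p\<^sub>3 \<delta> \<longleftrightarrow>
     conj_linear_on E \<delta> \<and>
     continuous_on (E \<times> E \<times> E) (derivation_defect tri p\<^sub>1 p\<^sub>2 p\<^sub>3 \<delta>)"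

section \<open>C*-algebras are Jordan triples\<close>

text \<open>Hence these parts of the module locales are automatic for C*-algebras.\<close>

lemma star_scaleR: "star (r *\<^sub>R x) = r *\<^sub>R star (x::'a::cstar_algebra)"
  by (simp add: scaleR_scaleC star_scaleC)

lemma scaleR_scaleC_commute: "r *\<^sub>R (c *\<^sub>C x) = c *\<^sub>C (r *\<^sub>R (x::'a::complex_vector))"
  by (simp add: scaleR_scaleC scaleC_scaleC mult.commute)

lemma cstar_jordan_identity:
  fixes a b c d e :: "'a::cstar_algebra"
  shows "cstar_triple a b (cstar_triple c d e) = cstar_triple (cstar_triple a b c) d e
    - cstar_triple c (cstar_triple b a d) e + cstar_triple c d (cstar_triple a b e)"
proof -
  let ?T = "\<lambda>x y z :: 'a. x * star y * z + z * star y * x"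
  have T: "cstar_triple x y z = (1/2) *\<^sub>R ?T x y z" for x y z :: 'a
    by (simp add: cstar_triple_def)
  have nested1: "cstar_triple x y (cstar_triple z u v) = (1/4) *\<^sub>R ?T x y (?T z u v)"
    and nested2: "cstar_triple (cstar_triple x y z) u v = (1/4) *\<^sub>R ?T (?T x y z) u v"
    and nested3: "cstar_triple x (cstar_triple y z u) v = (1/4) *\<^sub>R ?T x (?T y z u) v"
    for x y z u v :: 'a
    by (simp_all only: T star_scaleR mult_scaleR_left mult_scaleR_right
        scaleR_add_right[symmetric] scaleR_scaleR) simp_all
  have "?T a b (?T c d e) + ?T c (?T b a d) e = ?T (?T a b c) d e + ?T c d (?T a b e)"
    by (simp only: star_add star_mult star_star distrib_left distrib_right mult.assoc add_ac)
  moreover have "p = q - s + r" if "p + s = q + r" for p q r s :: 'a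
    using that by (simp add: eq_diff_eq[symmetric] diff_add_eq)
  ultimately have "?T a b (?T c d e) = ?T (?T a b c) d e - ?T c (?T b a d) e + ?T c d (?T a b e)"
    by blast
  then show ?thesis
    unfolding nested1 nested2 nested3
    by (simp only: scaleR_diff_right[symmetric] scaleR_add_right[symmetric])
qed

lemma norm_star: "norm (star x) = norm (x::'a::cstar_algebra)"
proof -
  have le: "norm y \<le> norm (star y)" for y :: 'a
  proof (cases "y = 0")
    case False
    have "norm y * norm y \<le> norm (star y) * norm y"
      using cstar_identity[of y] norm_mult_ineq[of "star y" y] by (simp add: power2_eq_square)
    then show ?thesis using False by simp
  qed simp
  show ?thesis using le[of x] le[of "star x"] by (simp add: star_star)
qed

lemma continuous_on_star [continuous_intros]:
  assumes "continuous_on S f"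
  shows "continuous_on S (\<lambda>x. star (f x :: 'a::cstar_algebra))"
proof -
  have "bounded_linear (star :: 'a \<Rightarrow> 'a)"
    by (rule bounded_linear_intro[where K = 1]) (simp_all add: star_add star_scaleR norm_star)
  then show ?thesis using assms by (rule bounded_linear.continuous_on)
qed

lemma continuous_on_cstar_triple:
  "continuous_on S (\<lambda>(a, b, c). cstar_triple a b (c::'a::cstar_algebra))"
  unfolding cstar_triple_def case_prod_beta by (intro continuous_intros)

lemma module_scaleC: "module (scaleC :: complex \<Rightarrow> 'a \<Rightarrow> 'a::complex_vector)"
  by unfold_locales (simp_all add: scaleC_add_left scaleC_add_right scaleC_scaleC scaleC_one)

lemma cstar_triple_commute: "cstar_triple a b c = cstar_triple c b (a::'a::cstar_algebra)"
  by (simp add: cstar_triple_def add.commute)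

lemma cstar_complex_jordan_triple:
  "complex_jordan_triple (UNIV :: 'a::cstar_algebra set) cstar_triple"
proof (unfold_locales, goal_cases)
  case 2 show ?case by (rule cstar_triple_commute)
next
  case 3 show ?case by (rule cstar_jordan_identity)
next
  case 4 show ?case by (rule module.subspace_UNIV[OF module_scaleC])
qed (simp_all add: cstar_triple_def complex_linear_on_def conj_linear_on_def star_add star_scaleC
    distrib_left distrib_right scaleC_mult_left scaleC_mult_right scaleR_scaleC_commute
    scaleC_add_right scaleR_add_right add_ac)

lemma real_cstar_real_jordan_triple:
  assumes "real_cstar_algebra A"
  shows "real_jordan_triple A cstar_triple"
proof (unfold_locales, goal_cases)
  case 1 then show ?case
    using assms by (simp add: real_cstar_algebra_def cstar_triple_def subspace_add subspace_scale)
next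
  case 2 show ?case by (rule cstar_triple_commute)
next
  case 3 show ?case by (rule cstar_jordan_identity)
next
  case 4 show ?case using assms by (simp add: real_cstar_algebra_def)
qed (simp_all add: cstar_triple_def real_linear_on_def star_add star_scaleR
    distrib_left distrib_right scaleR_add_right add_ac mult.commute)

lemma real_cstar_complete: "real_cstar_algebra A \<Longrightarrow> complete A"
  by (simp add: real_cstar_algebra_def complete_eq_closed)

end

theory Submission
  imports Defs "HOL-Complex_Analysis.Cauchy_Integral_Formula" "HOL-Real_Asymp.Real_Asymp"
begin

text \<open>
  A complex module is a real one, so only a real C*-algebra \<open>A\<close> has to be treated.  Modulo bounded maps
  \<open>\<delta>\<close> intertwines the multiplication operators \<open>t \<mapsto> {a,b,t}\<close> and \<open>t \<mapsto> {a,t,b}\<close> of \<open>A\<close> with bounded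
  operators of the module; hence the multiplication operators \<open>T\<close> with \<open>\<delta> \<circ> T\<close> bounded form a two-sided
  ideal, and the elements of \<open>A\<close> all of whose multiplication operators are of this kind form a closed
  triple ideal \<open>J\<close>.  Let \<open>I\<close> be the largest two-sided \<open>*\<close>-ideal contained in \<open>J\<close>.  On \<open>I\<close> the map
  \<open>\<delta>{a,b,c}\<close> is separately, hence jointly, bounded, and a self-adjoint or skew element of \<open>I\<close> is \<open>b u b\<close>
  with norm control, so \<open>\<delta>\<close> is bounded on \<open>I\<close>.  A gliding hump argument excludes infinite orthogonal
  sequences outside \<open>I\<close>, so self-adjoint elements have finite spectrum modulo \<open>I\<close>, which makes \<open>A/I\<close>
  finite-dimensional.  Boundedness of \<open>\<delta>\<close> on \<open>I\<close> then gives boundedness on \<open>A\<close>.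
\<close>

text \<open>\<open>A\<close> is only a real algebra and may lack a unit, and this shapes the tools.
  The functional calculus uses limits of real polynomials without constant term, on an interval in
  place of the spectrum. The quotient A/I is handled through congruences and never formed. The real
  scalars also mean that the corner of a minimal projection can look like the reals, the complex
  numbers or the quaternions, so its finite dimension needs its own argument. The obstacle in the
  middle is that \<open>J\<close> absorbs triple products only, while spectral arguments need
  ordinary products. High odd powers bridge the gap: if enough multiplication operators of a
  self-adjoint \<open>y\<close> are null, then \<open>y ^ 3\<close> lies in \<open>J\<close>, and
  the seventh power of a self-adjoint element of \<open>J\<close> lies in \<open>I\<close>. Nothing
  is lost, because a bump function that equals 1 at a point still equals 1 there after taking
  powers. Finite spectra force finite dimension because infinitely many orthogonal projections could
  be summed, with distinct small weights, to an element with infinitely many eigenvalues.\<close>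

section \<open>Polynomials and continuous functions of a self-adjoint element\<close>

text \<open>This is p(h) b. Without a unit p(h) need not be an element, so polynomials with a
  constant term are kept as left multiplication operators.\<close>

definition lact :: "real poly \<Rightarrow> 'a::cstar_algebra \<Rightarrow> 'a \<Rightarrow> 'a" where
  "lact p h b = (\<Sum>i\<le>degree p. coeff p i *\<^sub>R ((*) h ^^ i) b)"

lemma lact_0 [simp]: "lact 0 h b = 0"
  by (simp add: lact_def)

lemma lact_pCons [simp]: "lact (pCons a p) h b = a *\<^sub>R b + h * lact p h b"
proof (cases "p = 0")
  case False
  then show ?thesis
    by (simp add: lact_def sum.atMost_Suc_shift sum_distrib_left del: sum.atMost_Suc)
qed (simp add: lact_def)

lemma lact_add: "lact (p + q) h b = lact p h b + lact q h b"
  by (induction p q rule: poly_induct2) (simp_all add: algebra_simps)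

lemma lact_smult: "lact (smult c p) h b = c *\<^sub>R lact p h b"
  by (induction p) (simp_all add: algebra_simps)

lemma lact_diff: "lact (p - q) h b = lact p h b - lact q h b"
  using lact_add[of "p - q" q h b] by simp

lemma lact_scaleR_right: "lact p h (r *\<^sub>R b) = r *\<^sub>R lact p h b"
  by (induction p) (simp_all add: algebra_simps)

lemma lact_assoc: "lact p h b * c = lact p h (b * c)"
  by (induction p) (simp_all add: algebra_simps)

lemma lact_commute: "lact p h (h * b) = h * lact p h b"
  by (induction p) (simp_all add: algebra_simps)

lemma lact_mult: "lact (p * q) h b = lact p h (lact q h b)"
  by (induction p) (simp_all add: lact_add lact_smult)

lemma lact_pcompose: "lact (p \<circ>\<^sub>p [:0, r:]) h b = lact p (r *\<^sub>R h) b"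
  by (induction p) (simp_all add: pcompose_pCons lact_add lact_mult lact_smult)

lemma star_0 [simp]: "star 0 = (0::'a::cstar_algebra)"
  using star_add[of 0 "0::'a"] by simp

lemma star_minus: "star (- x) = - star (x::'a::cstar_algebra)"
  using star_add[of x "- x"] by (simp add: eq_neg_iff_add_eq_0 add.commute)

lemma star_diff: "star (x - y) = star x - star (y::'a::cstar_algebra)"
  using star_add[of x "- y"] by (simp add: star_minus)

text \<open>For self-adjoint \<open>h\<close> the operator p(h) is symmetric with respect to the
  algebra-valued inner product \<open>star b * c\<close>.\<close>

lemma lact_star:
  assumes "star h = h"
  shows "star (lact p h b) * c = star b * lact p h c"
proof (induction p arbitrary: c)
  case (pCons a p)
  have "star (h * lact p h b) * c = star (lact p h b) * (h * c)"
    by (simp add: star_mult assms mult.assoc)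
  also have "\<dots> = star b * (h * lact p h c)"
    using pCons.IH by (simp add: lact_commute)
  finally show ?case
    by (simp add: star_add star_scaleR algebra_simps)
qed simp

lemma norm_lact_square:
  assumes "star h = h"
  shows "(norm (lact p h b))\<^sup>2 \<le> norm b * norm (lact (p * p) h b)"
proof -
  have "(norm (lact p h b))\<^sup>2 = norm (star b * lact (p * p) h b)"
    by (metis assms cstar_identity lact_mult lact_star)
  also have "\<dots> \<le> norm b * norm (lact (p * p) h b)"
    using norm_mult_ineq[of "star b"] by (simp add: norm_star)
  finally show ?thesis .
qed

text \<open>Repeated use of the C*-identity trades powers of the norm for the norm of a power. This
  later turns an estimate with a factor growing linearly in the degree into a sharp one.\<close>

lemma norm_lact_power:
  assumes "star h = h"
  shows "norm (lact p h b) ^ (2 ^ n) \<le> norm b ^ (2 ^ n - 1) * norm (lact (p ^ (2 ^ n)) h b)"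
proof (induction n)
  case (Suc n)
  let ?N = "2 ^ n :: nat" and ?q = "p ^ (2 ^ n)"
  have N: "2 * ?N - 1 = (?N - 1) * 2 + 1"
  proof -
    have "?N \<ge> 1" by simp
    then show ?thesis by linarith
  qed
  have "norm (lact p h b) ^ (2 * ?N) = (norm (lact p h b) ^ ?N)\<^sup>2"
    by (simp add: power_mult mult.commute[of 2])
  also have "\<dots> \<le> (norm b ^ (?N - 1) * norm (lact ?q h b))\<^sup>2"
    using Suc by (intro power_mono) auto
  also have "\<dots> = norm b ^ ((?N - 1) * 2) * (norm (lact ?q h b))\<^sup>2"
    by (simp add: power_mult_distrib power_mult)
  also have "\<dots> \<le> norm b ^ ((?N - 1) * 2) * (norm b * norm (lact (?q * ?q) h b))"
    using norm_lact_square[OF assms] by (intro mult_left_mono) auto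
  also have "\<dots> = norm b ^ (2 * ?N - 1) * norm (lact (p ^ (2 * ?N)) h b)"
    unfolding N by (simp add: power_add mult_2)
  finally show ?case by simp
qed simp

lemma scaleC_minus_right: "c *\<^sub>C (- x) = - (c *\<^sub>C (x::'a::complex_vector))"
  using scaleC_add_right[of c x "- x"] scaleR_scaleC[of 0 "0::'a"]
    scaleC_scaleC[of c 0 "0::'a"]
  by (simp add: eq_neg_iff_add_eq_0 add.commute)

lemma scaleC_0_right [simp]: "c *\<^sub>C (0::'a::complex_vector) = 0"
  using scaleC_add_right[of c 0 "0::'a"] by simp

lemma scaleC_0_left [simp]: "0 *\<^sub>C (x::'a::complex_vector) = 0"
  using scaleR_scaleC[of 0 x] by simp

lemma scaleC_diff_right: "c *\<^sub>C (x - y) = c *\<^sub>C x - c *\<^sub>C (y::'a::complex_vector)"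
  using scaleC_add_right[of c x "- y"] by (simp add: scaleC_minus_right)

section \<open>Norm bounds for polynomials in a self-adjoint element, through a unitary\<close>

lemma norm_coeff_le:
  fixes q :: "complex poly"
  assumes "\<And>z. cmod z = 1 \<Longrightarrow> cmod (poly q z) \<le> B"
  shows "cmod (coeff q n) \<le> B"
proof -
  have d: "(deriv ^^ n) (poly q) = poly ((pderiv ^^ n) q)"
  proof (induction n)
    case (Suc n)
    have "deriv (poly p) = poly (pderiv p)" for p :: "complex poly"
      by (intro ext DERIV_imp_deriv poly_DERIV)
    then show ?case using Suc by simp
  qed simp
  have "cmod ((deriv ^^ n) (poly q) 0) \<le> fact n * B / 1 ^ n"
    by (rule Cauchy_inequality) (use assms in \<open>auto intro!: holomorphic_intros continuous_intros\<close>)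
  moreover have "(deriv ^^ n) (poly q) 0 = fact n * coeff q n"
    unfolding d poly_0_coeff_0 coeff_higher_pderiv by (simp add: pochhammer_fact)
  ultimately show ?thesis by (simp add: norm_mult)
qed

text \<open>The element \<open>w\<close> plays the role of 1 - sqrt(1 - h^2): \<open>w_eq\<close>
  says (1 - w)^2 = 1 - h^2. Then \<open>U\<close> is left multiplication by the unitary (1 - w) + i
  h of the unitization.\<close>

locale cstar_unitary =
  fixes h w :: "'a::cstar_algebra"
  assumes h_sa: "star h = h" and w_sa: "star w = w" and wh: "w * h = h * w"
    and w_eq: "w + w - w * w = h * h"
begin

definition U :: "'a \<Rightarrow> 'a" where "U b = b - w * b + \<i> *\<^sub>C (h * b)"

definition cact :: "complex poly \<Rightarrow> 'a \<Rightarrow> 'a" where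
  "cact q b = (\<Sum>i\<le>degree q. coeff q i *\<^sub>C (U ^^ i) b)"

lemma U_add: "U (b + c) = U b + U c"
  by (simp add: U_def distrib_left scaleC_add_right)

lemma U_scaleC: "U (r *\<^sub>C b) = r *\<^sub>C U b"
  by (simp add: U_def scaleC_mult_right scaleC_add_right scaleC_diff_right scaleC_scaleC mult.commute)

lemma U_0 [simp]: "U 0 = 0"
  by (simp add: U_def)

lemma U_sum: "U (sum f S) = (\<Sum>i\<in>S. U (f i))"
  by (induction S rule: infinite_finite_induct) (simp_all add: U_add)

lemma U_h: "U (h * b) = h * U b"
  by (simp add: U_def algebra_simps scaleC_mult_right) (simp add: mult.assoc[symmetric] wh)

lemma funpow_U_h: "(U ^^ i) (h * b) = h * (U ^^ i) b"
  by (induction i) (simp_all add: U_h)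

text \<open>Isometry comes from (1 - w)^2 + h^2 = 1; the mixed terms cancel because \<open>w\<close>
  and \<open>h\<close> commute.\<close>

lemma norm_U: "norm (U b) = norm b"
proof -
  let ?v = "b - w * b" and ?u = "h * b"
  have 1: "star ?v * ?v = star b * (b - (w + w - w * w) * b)"
    by (simp add: star_diff star_mult w_sa algebra_simps)
  have 2: "star ?u * ?u = star b * (h * h * b)"
    by (simp add: star_mult h_sa mult.assoc)
  have 3: "star ?v * ?u = star ?u * ?v"
    by (simp add: star_diff star_mult w_sa h_sa algebra_simps) (simp add: mult.assoc[symmetric] wh)
  have "star (U b) * U b = star ?v * ?v + \<i> *\<^sub>C (star ?v * ?u)
      + cnj \<i> *\<^sub>C (star ?u * ?v) + (cnj \<i> * \<i>) *\<^sub>C (star ?u * ?u)"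
    unfolding U_def star_add star_scaleC distrib_left distrib_right
    by (simp only: scaleC_mult_left scaleC_mult_right scaleC_scaleC add_ac mult.commute[of "cnj \<i>" \<i>])
  also have "\<dots> = star ?v * ?v + star ?u * ?u"
    unfolding 3 using scaleC_add_left[of \<i> "cnj \<i>" "star ?u * ?v"] by (simp add: scaleC_one add.assoc)
  also have "\<dots> = star b * b"
    unfolding 1 2 w_eq by (simp add: algebra_simps)
  finally have "(norm (U b))\<^sup>2 = (norm b)\<^sup>2"
    by (metis cstar_identity)
  then show ?thesis by (simp add: power2_eq_iff_nonneg)
qed

lemma norm_funpow_U: "norm ((U ^^ i) b) = norm b"
  by (induction i) (simp_all add: norm_U)

text \<open>The relation U - U^(-1) = 2 i h, multiplied by \<open>U\<close> so that no inverse
  occurs.\<close>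

lemma U_square: "U (U b) - b = (2 * \<i>) *\<^sub>C U (h * b)"
proof -
  have i2: "\<i> *\<^sub>C \<i> *\<^sub>C x = - x" for x :: 'a
    using scaleR_scaleC[of "-1" x] by (simp add: scaleC_scaleC)
  have two: "(2 * \<i>) *\<^sub>C x = \<i> *\<^sub>C x + \<i> *\<^sub>C x" for x :: 'a
    by (simp add: scaleC_add_left[symmetric])
  have hh: "h * (h * b) = w * b + w * b - w * (w * b)"
    using w_eq by (metis distrib_right left_diff_distrib mult.assoc)
  have "U (U b) - b = - (w * b + w * b - w * (w * b)) + \<i> *\<^sub>C (\<i> *\<^sub>C (h * (h * b)))
    + \<i> *\<^sub>C (h * b) + \<i> *\<^sub>C (h * b) - \<i> *\<^sub>C (w * (h * b)) - \<i> *\<^sub>C (w * (h * b))"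
    by (simp add: U_def algebra_simps scaleC_mult_right scaleC_add_right scaleC_diff_right)
      (simp add: mult.assoc[symmetric] wh)
  also have "\<dots> = \<i> *\<^sub>C (h * b - w * (h * b) + \<i> *\<^sub>C (h * (h * b)))
      + \<i> *\<^sub>C (h * b - w * (h * b) + \<i> *\<^sub>C (h * (h * b)))"
    unfolding hh[symmetric] by (simp add: i2 scaleC_add_right scaleC_diff_right)
  finally show ?thesis unfolding two by (simp add: U_def)
qed

lemma cact_0 [simp]: "cact 0 b = 0"
  by (simp add: cact_def)

lemma cact_pCons [simp]: "cact (pCons a q) b = a *\<^sub>C b + U (cact q b)"
proof (cases "q = 0")
  case False
  then show ?thesis
    by (simp add: cact_def sum.atMost_Suc_shift U_sum U_scaleC del: sum.atMost_Suc)
qed (simp add: cact_def)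

lemma cact_add: "cact (p + q) b = cact p b + cact q b"
  by (induction p q rule: poly_induct2) (simp_all add: U_add scaleC_add_left algebra_simps)

lemma cact_smult: "cact (smult c q) b = c *\<^sub>C cact q b"
  by (induction q) (simp_all add: U_scaleC scaleC_add_right scaleC_scaleC)

lemma cact_monom: "cact (monom a d) b = a *\<^sub>C (U ^^ d) b"
  by (induction d) (simp_all add: monom_0 monom_Suc U_scaleC scaleC_0_left)

lemma norm_cact:
  assumes "\<And>z. cmod z = 1 \<Longrightarrow> cmod (poly q z) \<le> B"
  shows "norm (cact q b) \<le> (real (degree q) + 1) * B * norm b"
proof -
  have "norm (cact q b) \<le> (\<Sum>i\<le>degree q. B * norm b)"
    unfolding cact_def
  proof (rule sum_norm_le)
    fix i
    have "cmod (coeff q i) \<le> B" by (rule norm_coeff_le[OF assms])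
    then show "norm (coeff q i *\<^sub>C (U ^^ i) b) \<le> B * norm b"
      by (simp add: norm_scaleC norm_funpow_U mult_right_mono)
  qed
  then show ?thesis by (simp add: algebra_simps)
qed

text \<open>Spectrally \<open>h\<close> is the imaginary part of the unitary \<open>U\<close>, and \<open>h = (U\<^sup>2 - 1) / 2iU\<close>.\<close>

lemma lact_as_cact:
  "degree p \<le> d \<Longrightarrow> \<exists>q. degree q \<le> 2 * d \<and>
     (\<forall>z. cmod z = 1 \<longrightarrow> poly q z = z ^ d * of_real (poly p (Im z))) \<and>
     (\<forall>b. cact q b = (U ^^ d) (lact p h b))"
proof (induction p arbitrary: d)
  case 0
  have "(U ^^ d) 0 = 0" by (induction d) simp_all
  then show ?case by (intro exI[of _ 0]) simp
next
  case (pCons a p)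
  show ?case
  proof (cases "p = 0")
    case True
    have "(U ^^ d) (a *\<^sub>R b) = complex_of_real a *\<^sub>C (U ^^ d) b" for b
      by (induction d) (simp_all add: scaleR_scaleC U_scaleC)
    then show ?thesis
      using True by (intro exI[of _ "monom (of_real a) d"])
        (auto simp: cact_monom poly_monom degree_monom_eq intro: order.trans[OF degree_monom_le])
  next
    case False
    then obtain d' where d: "d = Suc d'" and d': "degree p \<le> d'"
      using pCons.prems by (cases d) auto
    obtain q where q: "degree q \<le> 2 * d'"
      "\<And>z. cmod z = 1 \<Longrightarrow> poly q z = z ^ d' * of_real (poly p (Im z))"
      "\<And>b. cact q b = (U ^^ d') (lact p h b)"
      using pCons.IH[OF d'] by blast
    \<comment> \<open>On the unit circle \<open>c * (z * z - 1) = z * Im z\<close>. So a further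
      factor \<open>Im z\<close> costs a further factor \<open>z\<close>, which the passage from
      \<open>d'\<close> to \<open>d\<close> supplies.\<close>
    define c where "c = 1 / (2 * \<i>)"
    define r where "r = monom (of_real a) d + smult c (pCons 0 (pCons 0 q) - q)"
    have "degree r \<le> 2 * d"
    proof -
      have "degree (pCons 0 (pCons 0 q)) \<le> 2 * d"
        using q(1) d by (auto intro!: order.trans[OF degree_pCons_le])
      moreover have "degree q \<le> 2 * d" using q(1) d by simp
      ultimately have "degree (smult c (pCons 0 (pCons 0 q) - q)) \<le> 2 * d"
        by (intro order.trans[OF degree_smult_le] degree_diff_le) auto
      moreover have "degree (monom (complex_of_real a) d) \<le> 2 * d"
        by (rule order.trans[OF degree_monom_le]) simp
      ultimately show ?thesis unfolding r_def by (intro degree_add_le) auto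
    qed
    moreover have "poly r z = z ^ d * of_real (poly (pCons a p) (Im z))" if z: "cmod z = 1" for z
    proof -
      have "z * cnj z = 1" using z by (simp add: complex_mult_cnj cmod_def)
      moreover have "z - cnj z = 2 * \<i> * of_real (Im z)" by (simp add: complex_eq_iff)
      ultimately have "z * z - 1 = z * (2 * \<i> * of_real (Im z))"
        by (metis right_diff_distrib)
      moreover have "c * (2 * \<i>) = 1" by (simp add: c_def)
      ultimately have "c * (z * z - 1) = z * of_real (Im z)"
        by (metis mult.assoc mult.commute mult_1)
      then have "c * (z * z - 1) * poly q z = z * of_real (Im z) * poly q z" by simp
      then show ?thesis
        using q(2)[OF z] by (simp add: r_def poly_monom d algebra_simps)
    qed
    moreover have "cact r b = (U ^^ d) (lact (pCons a p) h b)" for b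
    proof -
      have m: "cact (- q) b = - cact q b"
        using cact_smult[of "-1" q b] scaleR_scaleC[of "-1" "cact q b"] by simp
      have "cact r b = of_real a *\<^sub>C (U ^^ d) b + c *\<^sub>C (U (U (cact q b)) - cact q b)"
        unfolding r_def diff_conv_add_uminus[of "pCons _ _"] cact_add cact_smult m cact_monom by simp
      also have "c *\<^sub>C (U (U (cact q b)) - cact q b) = U (h * cact q b)"
        unfolding U_square by (simp add: c_def scaleC_scaleC scaleC_one)
      also have "\<dots> = (U ^^ d) (h * lact p h b)"
        by (simp add: q(3) d funpow_U_h U_h)
      also have "of_real a *\<^sub>C (U ^^ d) b = (U ^^ d) (a *\<^sub>R b)"
        by (induction d) (simp_all add: scaleR_scaleC U_scaleC[symmetric])
      also have "(U ^^ d) (a *\<^sub>R b) + (U ^^ d) (h * lact p h b) = (U ^^ d) (lact (pCons a p) h b)"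
        by (induction d) (simp_all add: U_add[symmetric])
      finally show ?thesis .
    qed
    ultimately show ?thesis by blast
  qed
qed

text \<open>Applying \<open>U ^^ d\<close> does not change the norm and makes p(h) a polynomial in
  \<open>U\<close> with at most 2d + 1 coefficients. Each coefficient is at most \<open>B\<close> by
  Cauchy's inequality on the circle.\<close>

lemma norm_lact_crude:
  assumes "\<And>t. \<bar>t\<bar> \<le> 1 \<Longrightarrow> \<bar>poly p t\<bar> \<le> B" and "degree p \<le> d"
  shows "norm (lact p h b) \<le> (2 * real d + 1) * B * norm b"
proof -
  obtain q where q: "degree q \<le> 2 * d"
    "\<And>z. cmod z = 1 \<Longrightarrow> poly q z = z ^ d * of_real (poly p (Im z))"
    "cact q b = (U ^^ d) (lact p h b)"
    using lact_as_cact[OF assms(2)] by blast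
  have B: "B \<ge> 0" using assms(1)[of 0] by linarith
  have "norm (lact p h b) = norm (cact q b)" by (simp add: q(3) norm_funpow_U)
  also have "\<dots> \<le> (real (degree q) + 1) * B * norm b"
  proof (rule norm_cact)
    fix z :: complex assume z: "cmod z = 1"
    have "\<bar>Im z\<bar> \<le> 1" using abs_Im_le_cmod[of z] z by simp
    then show "cmod (poly q z) \<le> B"
      using assms(1) by (simp add: q(2)[OF z] norm_mult norm_power z)
  qed
  also have "\<dots> \<le> (2 * real d + 1) * B * norm b"
    using q(1) B by (intro mult_right_mono) auto
  finally show ?thesis .
qed

text \<open>The crude bound for \<open>p ^ (2 ^ n)\<close> loses only a factor linear in
  \<open>2 ^ n\<close>, whereas by \<open>norm_lact_power\<close> a ratio \<open>r > B\<close> would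
  be amplified to its \<open>2 ^ n\<close>-th power.\<close>

lemma norm_lact_le:
  assumes p: "\<And>t. \<bar>t\<bar> \<le> 1 \<Longrightarrow> \<bar>poly p t\<bar> \<le> B"
  shows "norm (lact p h b) \<le> B * norm b"
proof (rule ccontr)
  assume neg: "\<not> ?thesis"
  have B: "B \<ge> 0" using p[of 0] by linarith
  have b: "norm b > 0"
    using neg B by (cases "b = 0") (auto simp: lact_scaleR_right[of p h 0 0, simplified])
  define r where "r = norm (lact p h b) / norm b"
  have r: "r > B" "r \<ge> 0" using neg b B by (simp_all add: r_def pos_less_divide_eq)
  have main: "r ^ (2 ^ n) \<le> (2 * (degree p * 2 ^ n) + 1) * B ^ (2 ^ n)" for n
  proof -
    let ?N = "2 ^ n :: nat"
    have "?N = Suc (?N - 1)" by simp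
    then have bN: "norm b ^ ?N = norm b ^ (?N - 1) * norm b"
      by (metis power_Suc2)
    have "norm (lact p h b) ^ ?N \<le> norm b ^ (?N - 1) * norm (lact (p ^ ?N) h b)"
      by (rule norm_lact_power[OF h_sa])
    also have "norm (lact (p ^ ?N) h b) \<le> (2 * (degree p * ?N) + 1) * B ^ ?N * norm b"
      using norm_lact_crude[of "p ^ ?N" "B ^ ?N" "degree p * ?N" b] degree_power_le[of p ?N]
        power_mono[OF p, of _ ?N]
      by (simp add: poly_power power_abs add.commute)
    finally have "norm (lact p h b) ^ ?N
        \<le> norm b ^ (?N - 1) * ((2 * (degree p * ?N) + 1) * B ^ ?N * norm b)"
      by (simp add: mult_left_mono)
    then have "norm (lact p h b) ^ ?N \<le> (2 * (degree p * ?N) + 1) * B ^ ?N * norm b ^ ?N"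
      unfolding bN by (simp add: mult_ac)
    then show ?thesis
      using b by (simp add: r_def power_divide field_simps)
  qed
  show False
  proof (cases "B = 0")
    case True
    then show False using main[of 0] r by simp
  next
    case False
    then have B0: "B > 0" using B by simp
    define s where "s = r / B"
    have s: "s > 1" using r B0 by (simp add: s_def)
    have "s ^ (2 ^ n) \<le> 2 * (degree p * 2 ^ n) + 1" for n
      using main[of n] B0 by (simp add: s_def power_divide field_simps)
    moreover have "eventually (\<lambda>m::nat. s ^ m > 2 * (degree p * m) + 1) sequentially"
      using s by real_asymp
    then obtain m0 where "\<And>m. m \<ge> m0 \<Longrightarrow> s ^ m > 2 * (degree p * m) + 1"
      unfolding eventually_sequentially by blast
    then have "s ^ (2 ^ m0) > 2 * (degree p * 2 ^ m0) + 1" 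
      using less_exp[of m0] by (metis less_imp_le of_nat_numeral of_nat_power)
    ultimately show False by (metis not_less)
  qed
qed

end

text \<open>The equation 2 w - w^2 = h^2 is solved as the fixed point of w = (h^2 + w^2) / 2. On the
  ball of radius \<open>norm h\<close> this map is a contraction with constant
  \<open>norm h\<close>, and it preserves the closed conditions of being self-adjoint and commuting
  with \<open>h\<close>.\<close>

lemma exists_cstar_unitary:
  fixes h :: "'a::cstar_algebra"
  assumes h: "star h = h" and r: "norm h < 1"
  shows "\<exists>w. cstar_unitary h w"
proof -
  define S where "S = {w. norm w \<le> norm h \<and> star w = w \<and> w * h = h * w}"
  define F where "F w = (1/2) *\<^sub>R (h * h + w * w)" for w
  have "closed S"
    unfolding S_def by (intro closed_Collect_conj closed_Collect_le closed_Collect_eq continuous_intros)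
  then have "complete S" by (simp add: complete_eq_closed)
  moreover have "S \<noteq> {}" by (auto simp: S_def intro: exI[of _ 0])
  moreover have "F ` S \<subseteq> S"
  proof clarify
    fix w assume w: "w \<in> S"
    have "norm (h * h) \<le> norm h * 1"
      by (rule order.trans[OF norm_mult_ineq]) (use r in \<open>simp add: mult_left_le\<close>)
    moreover have "norm (w * w) \<le> norm h * 1"
      by (rule order.trans[OF norm_mult_ineq], rule mult_mono) (use w r in \<open>auto simp: S_def\<close>)
    ultimately have "norm (F w) \<le> norm h"
      unfolding F_def using norm_triangle_ineq[of "h * h" "w * w"] by simp
    moreover have "w * w * h = h * (w * w)"
      using w by (simp add: S_def mult.assoc) (simp add: mult.assoc[symmetric])
    ultimately show "F w \<in> S"
      using w h by (simp add: S_def F_def star_scaleR star_add star_mult distrib_left distrib_right mult.assoc)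
  qed
  moreover have "dist (F v) (F w) \<le> norm h * dist v w" if "v \<in> S" "w \<in> S" for v w
  proof -
    have "v * v - w * w = v * (v - w) + (v - w) * w" by (simp add: algebra_simps)
    then have "norm (v * v - w * w) \<le> norm v * norm (v - w) + norm (v - w) * norm w"
      by (metis norm_triangle_mono norm_mult_ineq)
    also have "\<dots> \<le> norm h * norm (v - w) + norm (v - w) * norm h"
      using that by (intro add_mono mult_mono) (auto simp: S_def)
    finally have "norm (v * v - w * w) \<le> 2 * (norm h * norm (v - w))" by simp
    moreover have "F v - F w = (1/2) *\<^sub>R (v * v - w * w)"
      by (simp add: F_def scaleR_diff_right[symmetric])
    ultimately show ?thesis by (simp add: dist_norm)
  qed
  ultimately have "\<exists>!w\<in>S. F w = w"
    using r by (intro Banach_fix[where c = "norm h"]) auto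
  then obtain w where w: "w \<in> S" "F w = w" by blast
  have "w + w = h * h + w * w"
    using w(2) unfolding F_def by (metis scaleR_2 scaleR_scaleR scaleR_one mult_2 divide_self_if
        times_divide_eq_right zero_neq_numeral mult.right_neutral)
  then have "w + w - w * w = h * h" by simp
  then show ?thesis
    using w(1) h by (intro exI[of _ w], unfold_locales) (auto simp: S_def)
qed

lemma norm_lact_le_sup:
  fixes h :: "'a::cstar_algebra"
  assumes h: "star h = h" and M: "norm h < M" and p: "\<And>t. \<bar>t\<bar> \<le> M \<Longrightarrow> \<bar>poly p t\<bar> \<le> B"
  shows "norm (lact p h b) \<le> B * norm b"
proof -
  have M0: "M > 0" using M norm_ge_zero[of h] by linarith
  define k where "k = (1 / M) *\<^sub>R h"
  have k: "star k = k" "norm k < 1"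
    using h M M0 by (simp_all add: k_def star_scaleR)
  obtain w where "cstar_unitary k w" using exists_cstar_unitary[OF k] by blast
  then interpret cstar_unitary k w .
  have "norm (lact (p \<circ>\<^sub>p [:0, M:]) k b) \<le> B * norm b"
  proof (rule norm_lact_le)
    fix t :: real assume "\<bar>t\<bar> \<le> 1"
    then show "\<bar>poly (p \<circ>\<^sub>p [:0, M:]) t\<bar> \<le> B"
      using M0 by (simp add: poly_pcompose p abs_mult mult_left_le_one_le)
  qed
  then show ?thesis using M0 by (simp add: lact_pcompose k_def)
qed

text \<open>Applied to \<open>h\<close> itself, p(h) is controlled by the values of t p(t) and not
  of p(t). The factor \<open>h\<close> is moved from the argument into the polynomial by letting t
  p(t) act on the adjoint of the element being estimated.\<close>

lemma norm_lact_self_le_sup: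
  fixes h :: "'a::cstar_algebra"
  assumes h: "star h = h" and M: "norm h < M" and p: "\<And>t. \<bar>t\<bar> \<le> M \<Longrightarrow> \<bar>t * poly p t\<bar> \<le> B"
  shows "norm (lact p h h) \<le> B"
proof -
  let ?x = "lact p h h"
  have "lact (pCons 0 p) h (star ?x) = ?x * star ?x"
    by (simp add: lact_assoc lact_commute)
  moreover have "norm (lact (pCons 0 p) h (star ?x)) \<le> B * norm (star ?x)"
    by (rule norm_lact_le_sup[OF h M]) (use p in simp)
  moreover have "norm (?x * star ?x) = (norm ?x)\<^sup>2"
    using cstar_identity[of "star ?x"] by (simp add: star_star norm_star)
  ultimately have "norm ?x * norm ?x \<le> B * norm ?x"
    by (simp add: norm_star power2_eq_square)
  moreover have "B \<ge> 0" using p[of 0] M norm_ge_zero[of h] by (simp del: norm_ge_zero)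
  ultimately show ?thesis by (cases "?x = 0") auto
qed

section \<open>Continuous functional calculus without a unit\<close>

text \<open>The interval replaces the spectrum; the margin 1 provides the strict inequality that the
  norm bound on polynomials asks for. A relation is used first so that algebraic rules can be read
  off from approximating sequences before uniqueness is known.\<close>

definition fc_rep :: "'a::cstar_algebra \<Rightarrow> (real \<Rightarrow> real) \<Rightarrow> 'a \<Rightarrow> bool" where
  "fc_rep h f x \<longleftrightarrow> (\<exists>P. uniform_limit {- (norm h + 1)..norm h + 1} (\<lambda>n t. t * poly (P n) t) f sequentially
     \<and> (\<lambda>n. lact (P n) h h) \<longlonglongrightarrow> x)"

definition fcalc :: "'a::cstar_algebra \<Rightarrow> (real \<Rightarrow> real) \<Rightarrow> 'a" where
  "fcalc h f = (SOME x. fc_rep h f x)"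

lemma fc_rep_norm_le:
  assumes h: "star h = h" and x: "fc_rep h f x"
    and f: "\<And>t. \<bar>t\<bar> \<le> norm h + 1 \<Longrightarrow> \<bar>f t\<bar> \<le> B"
  shows "norm x \<le> B"
proof (rule field_le_epsilon)
  fix e :: real assume e: "e > 0"
  obtain P where P: "uniform_limit {- (norm h + 1)..norm h + 1} (\<lambda>n t. t * poly (P n) t) f sequentially"
    "(\<lambda>n. lact (P n) h h) \<longlonglongrightarrow> x"
    using x unfolding fc_rep_def by blast
  have "eventually (\<lambda>n. \<forall>t\<in>{- (norm h + 1)..norm h + 1}. dist (t * poly (P n) t) (f t) < e) sequentially"
    by (rule uniform_limitD[OF P(1) e])
  then have "eventually (\<lambda>n. norm (lact (P n) h h) \<le> B + e) sequentially"
  proof (rule eventually_mono)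
    fix n assume n: "\<forall>t\<in>{- (norm h + 1)..norm h + 1}. dist (t * poly (P n) t) (f t) < e"
    show "norm (lact (P n) h h) \<le> B + e"
    proof (rule norm_lact_self_le_sup[OF h])
      fix t assume t: "\<bar>t\<bar> \<le> norm h + 1"
      have "t \<in> {- (norm h + 1)..norm h + 1}" using t by (auto simp: abs_le_iff)
      then show "\<bar>t * poly (P n) t\<bar> \<le> B + e"
        using n f[OF t] by (force simp: dist_real_def)
    qed simp
  qed
  then show "norm x \<le> B + e"
    by (intro tendsto_upperbound[OF tendsto_norm[OF P(2)]]) auto
qed

lemma fc_rep_add: "fc_rep h f x \<Longrightarrow> fc_rep h g y \<Longrightarrow> fc_rep h (\<lambda>t. f t + g t) (x + y)"
  unfolding fc_rep_def
proof (elim exE conjE)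
  fix P Q
  assume u: "uniform_limit {- (norm h + 1)..norm h + 1} (\<lambda>n t. t * poly (P n) t) f sequentially"
    "uniform_limit {- (norm h + 1)..norm h + 1} (\<lambda>n t. t * poly (Q n) t) g sequentially"
    and "(\<lambda>n. lact (P n) h h) \<longlonglongrightarrow> x" "(\<lambda>n. lact (Q n) h h) \<longlonglongrightarrow> y"
  then show "\<exists>R. uniform_limit {- (norm h + 1)..norm h + 1} (\<lambda>n t. t * poly (R n) t) (\<lambda>t. f t + g t) sequentially
     \<and> (\<lambda>n. lact (R n) h h) \<longlonglongrightarrow> x + y"
    using uniform_limit_add[OF u]
    by (intro exI[of _ "\<lambda>n. P n + Q n"]) (auto simp: lact_add distrib_left intro: tendsto_add)
qed

lemma fc_rep_scale: "fc_rep h f x \<Longrightarrow> fc_rep h (\<lambda>t. r * f t) (r *\<^sub>R x)"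
  unfolding fc_rep_def
proof (elim exE conjE)
  fix P
  assume P: "uniform_limit {- (norm h + 1)..norm h + 1} (\<lambda>n t. t * poly (P n) t) f sequentially"
    "(\<lambda>n. lact (P n) h h) \<longlonglongrightarrow> x"
  have "uniform_limit {- (norm h + 1)..norm h + 1} (\<lambda>n t. r * (t * poly (P n) t)) (\<lambda>t. r * f t) sequentially"
    by (rule bounded_linear.uniform_limit[OF bounded_linear_mult_right P(1)])
  then show "\<exists>R. uniform_limit {- (norm h + 1)..norm h + 1} (\<lambda>n t. t * poly (R n) t) (\<lambda>t. r * f t) sequentially
     \<and> (\<lambda>n. lact (R n) h h) \<longlonglongrightarrow> r *\<^sub>R x"
    using P(2) by (intro exI[of _ "\<lambda>n. smult r (P n)"]) (auto simp: lact_smult mult_ac intro: tendsto_scaleR)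
qed

lemma fc_rep_mult:
  assumes "fc_rep h f x" "fc_rep h g y" "continuous_on UNIV f" "continuous_on UNIV g"
  shows "fc_rep h (\<lambda>t. f t * g t) (x * y)"
proof -
  let ?I = "{- (norm h + 1)..norm h + 1}"
  obtain P Q where P: "uniform_limit ?I (\<lambda>n t. t * poly (P n) t) f sequentially" "(\<lambda>n. lact (P n) h h) \<longlonglongrightarrow> x"
    and Q: "uniform_limit ?I (\<lambda>n t. t * poly (Q n) t) g sequentially" "(\<lambda>n. lact (Q n) h h) \<longlonglongrightarrow> y"
    using assms(1,2) unfolding fc_rep_def by blast
  have "bounded (f ` ?I)" "bounded (g ` ?I)"
    using assms(3,4) by (auto intro!: compact_imp_bounded compact_continuous_image intro: continuous_on_subset)
  then have "uniform_limit ?I (\<lambda>n t. (t * poly (P n) t) * (t * poly (Q n) t)) (\<lambda>t. f t * g t) sequentially"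
    using P(1) Q(1) by (intro uniform_lim_mult)
  moreover have "(\<lambda>n. lact (P n) h h * lact (Q n) h h) \<longlonglongrightarrow> x * y"
    by (intro tendsto_mult P Q)
  moreover have "lact (P n) h h * lact (Q n) h h = lact (P n * pCons 0 (Q n)) h h" for n
    by (simp add: lact_mult lact_assoc lact_commute)
  ultimately show ?thesis
    unfolding fc_rep_def by (intro exI[of _ "\<lambda>n. P n * pCons 0 (Q n)"]) (simp add: mult_ac)
qed

lemma fc_rep_unique:
  assumes h: "star h = h" and "fc_rep h f x" "fc_rep h f y"
  shows "x = y"
proof -
  have "fc_rep h (\<lambda>t. f t + - 1 * f t) (x + - 1 *\<^sub>R y)"
    by (intro fc_rep_add fc_rep_scale assms)
  then have "norm (x + - 1 *\<^sub>R y) \<le> 0"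
    by (rule fc_rep_norm_le[OF h]) simp
  then show ?thesis by simp
qed

lemma real_poly_approx:
  assumes "continuous_on {a..b} (f :: real \<Rightarrow> real)" "e > 0"
  shows "\<exists>p. \<forall>t\<in>{a..b}. \<bar>f t - poly p t\<bar> < e"
proof -
  obtain g where g: "real_polynomial_function g" "\<And>t. t \<in> {a..b} \<Longrightarrow> \<bar>f t - g t\<bar> < e"
    using Stone_Weierstrass_real_polynomial_function[OF compact_Icc assms] by blast
  obtain c n where "g = (\<lambda>x. \<Sum>i\<le>n. c i * x ^ i)"
    using g(1) unfolding real_polynomial_function_iff_sum by blast
  then have "g t = poly (\<Sum>i\<le>n. monom (c i) i) t" for t
    by (simp add: poly_sum poly_monom)
  then show ?thesis using g(2) by metis
qed

lemma fc_rep_exists: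
  assumes h: "star h = h" and f: "continuous_on UNIV f" and f0: "f 0 = 0"
  shows "\<exists>x. fc_rep h f x"
proof -
  let ?I = "{- (norm h + 1)..norm h + 1}"
  have "\<exists>p. \<forall>t\<in>?I. \<bar>f t - t * poly p t\<bar> < 1 / Suc n" for n
  proof -
    obtain q where q: "\<forall>t\<in>?I. \<bar>f t - poly q t\<bar> < 1 / (2 * Suc n)"
      using real_poly_approx[of "- (norm h + 1)" "norm h + 1" f "1 / (2 * Suc n)"] f
      by (auto intro: continuous_on_subset)
    \<comment> \<open>Since \<open>f 0 = 0\<close>, the constant term of \<open>q\<close> is itself
      an approximation error. Dropping it at most doubles the error, hence the factor 2 in the
      tolerance for \<open>q\<close>.\<close>
    obtain c p where c: "q = pCons c p" by (cases q)
    have "0 \<in> ?I" using norm_ge_zero[of h] by (simp del: norm_ge_zero)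
    then have "\<bar>f 0 - poly q 0\<bar> < 1 / (2 * Suc n)" using q by blast
    then have c_small: "\<bar>c\<bar> < 1 / (2 * Suc n)" by (simp add: c f0)
    have "\<bar>f t - t * poly p t\<bar> < 1 / Suc n" if "t \<in> ?I" for t
    proof -
      have "\<bar>f t - t * poly p t\<bar> \<le> \<bar>f t - poly q t\<bar> + \<bar>c\<bar>" by (simp add: c)
      also have "\<dots> < 1 / (2 * Suc n) + 1 / (2 * Suc n)" using q that c_small by (intro add_strict_mono) auto
      also have "\<dots> = 1 / Suc n" by (simp add: field_simps)
      finally show ?thesis .
    qed
    then show ?thesis by blast
  qed
  then obtain P where P: "\<And>n t. t \<in> ?I \<Longrightarrow> \<bar>f t - t * poly (P n) t\<bar> < 1 / Suc n" by metis
  have lim: "uniform_limit ?I (\<lambda>n t. t * poly (P n) t) f sequentially"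
    unfolding uniform_limit_iff eventually_sequentially
  proof (intro allI impI)
    fix e :: real assume "e > 0"
    then obtain N where N: "1 / Suc N < e" by (metis nat_approx_posE)
    have "dist (t * poly (P n) t) (f t) < e" if "n \<ge> N" "t \<in> ?I" for n t
    proof -
      have "1 / Suc n \<le> 1 / Suc N" using that(1) by (simp add: frac_le)
      then show ?thesis using P[OF that(2), of n] N by (simp add: dist_real_def abs_minus_commute)
    qed
    then show "\<exists>N. \<forall>n\<ge>N. \<forall>t\<in>?I. dist (t * poly (P n) t) (f t) < e" by blast
  qed
  have "Cauchy (\<lambda>n. lact (P n) h h)"
    unfolding Cauchy_def
  proof (intro allI impI)
    fix e :: real assume e: "e > 0"
    then obtain N where N: "1 / Suc N < e / 2" by (metis half_gt_zero nat_approx_posE)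
    have "dist (lact (P m) h h) (lact (P n) h h) < e" if "m \<ge> N" "n \<ge> N" for m n
    proof -
      have "norm (lact (P m - P n) h h) \<le> 1 / Suc m + 1 / Suc n"
      proof (rule norm_lact_self_le_sup[OF h])
        fix t assume "\<bar>t\<bar> \<le> norm h + 1"
        then have "t \<in> ?I" by (auto simp: abs_le_iff)
        from P[OF this, of m] P[OF this, of n]
        show "\<bar>t * poly (P m - P n) t\<bar> \<le> 1 / Suc m + 1 / Suc n"
          by (simp add: algebra_simps)
      qed simp
      also have "\<dots> \<le> 1 / Suc N + 1 / Suc N" using that by (intro add_mono) (simp_all add: frac_le)
      also have "\<dots> < e" using N by simp
      finally show ?thesis by (simp add: dist_norm lact_diff)
    qed
    then show "\<exists>N. \<forall>m\<ge>N. \<forall>n\<ge>N. dist (lact (P m) h h) (lact (P n) h h) < e" by blast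
  qed
  then show ?thesis
    using lim unfolding fc_rep_def Cauchy_convergent_iff convergent_def by blast
qed

definition c0fun :: "(real \<Rightarrow> real) \<Rightarrow> bool" where
  "c0fun f \<longleftrightarrow> continuous_on UNIV f \<and> f 0 = 0"

lemma fcalc_rep: "star h = h \<Longrightarrow> c0fun f \<Longrightarrow> fc_rep h f (fcalc h f)"
  unfolding fcalc_def c0fun_def by (rule someI_ex) (simp add: fc_rep_exists)

lemma fcalc_eqI: "star h = h \<Longrightarrow> fc_rep h f x \<Longrightarrow> fcalc h f = x"
  unfolding fcalc_def by (rule some_equality) (auto intro: fc_rep_unique)

lemma fcalc_add:
  "star h = h \<Longrightarrow> c0fun f \<Longrightarrow> c0fun g \<Longrightarrow> fcalc h (\<lambda>t. f t + g t) = fcalc h f + fcalc h g"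
  by (intro fcalc_eqI fc_rep_add fcalc_rep)

lemma fcalc_scale: "star h = h \<Longrightarrow> c0fun f \<Longrightarrow> fcalc h (\<lambda>t. r * f t) = r *\<^sub>R fcalc h f"
  by (intro fcalc_eqI fc_rep_scale fcalc_rep)

lemma fcalc_diff:
  assumes "star h = h" "c0fun f" "c0fun g"
  shows "fcalc h (\<lambda>t. f t - g t) = fcalc h f - fcalc h g"
proof -
  have "fc_rep h (\<lambda>t. f t + - 1 * g t) (fcalc h f + - 1 *\<^sub>R fcalc h g)"
    by (intro fc_rep_add fc_rep_scale fcalc_rep assms)
  then show ?thesis by (intro fcalc_eqI assms) simp
qed

lemma fcalc_mult:
  "star h = h \<Longrightarrow> c0fun f \<Longrightarrow> c0fun g \<Longrightarrow> fcalc h (\<lambda>t. f t * g t) = fcalc h f * fcalc h g"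
  by (intro fcalc_eqI fc_rep_mult fcalc_rep) (auto simp: c0fun_def)

lemma fcalc_id: "star h = h \<Longrightarrow> fcalc h (\<lambda>t. t) = h"
  by (rule fcalc_eqI) (auto simp: fc_rep_def intro!: exI[of _ "\<lambda>_. [:1:]"] uniform_limit_const)

lemma fcalc_norm_le:
  "star h = h \<Longrightarrow> c0fun f \<Longrightarrow> (\<And>t. \<bar>t\<bar> \<le> norm h + 1 \<Longrightarrow> \<bar>f t\<bar> \<le> B) \<Longrightarrow> norm (fcalc h f) \<le> B"
  by (rule fc_rep_norm_le[OF _ fcalc_rep])

text \<open>A property of f(h) reduces to a choice of \<open>S\<close>: the algebra, an ideal, the
  commutant of an element, or the self-adjoint elements commuting with \<open>h\<close>.\<close>

lemma fcalc_mem: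
  assumes "star h = h" "c0fun f" and S: "closed S" "subspace S" and h: "h \<in> S"
    and mult: "\<And>x. x \<in> S \<Longrightarrow> h * x \<in> S"
  shows "fcalc h f \<in> S"
proof -
  have lact: "lact p h h \<in> S" for p
    by (induction p) (use S(2) h mult in \<open>auto intro: subspace_0 subspace_add subspace_scale\<close>)
  then show ?thesis
    using fcalc_rep[OF assms(1,2)] closed_sequentially[OF S(1), of "\<lambda>n. lact (P n) h h" for P] lact
    unfolding fc_rep_def by metis
qed

lemma fcalc_star:
  assumes "star h = h" "c0fun f"
  shows "star (fcalc h f) = fcalc h f"
proof -
  have "fcalc h f \<in> {x. star x = x \<and> h * x = x * h}"
  proof (rule fcalc_mem[OF assms])
    show "closed {x. star x = x \<and> h * x = x * h}"
      by (intro closed_Collect_conj closed_Collect_eq continuous_intros)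
    show "subspace {x. star x = x \<and> h * x = x * h}"
      by (auto simp: subspace_def star_add star_scaleR distrib_left distrib_right)
    show "h * x \<in> {x. star x = x \<and> h * x = x * h}" if "x \<in> {x. star x = x \<and> h * x = x * h}" for x
      using that assms(1) by (simp add: star_mult) (metis mult.assoc)
  qed (simp add: assms)
  then show ?thesis by simp
qed

lemma fcalc_commute:
  assumes "star h = h" "c0fun f" "a * h = h * a"
  shows "a * fcalc h f = fcalc h f * a"
proof -
  have "fcalc h f \<in> {x. a * x = x * a}"
  proof (rule fcalc_mem[OF assms(1,2)])
    show "closed {x. a * x = x * a}"
      by (intro closed_Collect_eq continuous_intros)
    show "subspace {x. a * x = x * a}"
      by (auto simp: subspace_def distrib_left distrib_right)
    show "h * x \<in> {x. a * x = x * a}" if "x \<in> {x. a * x = x * a}" for x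
      using that assms(3) by simp (metis mult.assoc)
  qed (simp add: assms)
  then show ?thesis by simp
qed

lemma c0fun_add [intro]: "c0fun f \<Longrightarrow> c0fun g \<Longrightarrow> c0fun (\<lambda>t. f t + g t)"
  and c0fun_diff [intro]: "c0fun f \<Longrightarrow> c0fun g \<Longrightarrow> c0fun (\<lambda>t. f t - g t)"
  and c0fun_mult [intro]: "c0fun f \<Longrightarrow> continuous_on UNIV g \<Longrightarrow> c0fun (\<lambda>t. f t * g t)"
  and c0fun_mult' [intro]: "continuous_on UNIV f \<Longrightarrow> c0fun g \<Longrightarrow> c0fun (\<lambda>t. f t * g t)"
  and c0fun_id [intro]: "c0fun (\<lambda>t. t)"
  by (auto simp: c0fun_def intro!: continuous_intros)

section \<open>Uniform boundedness on a closed subspace\<close>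

definition bounded_over :: "'a::real_normed_vector set \<Rightarrow> ('a \<Rightarrow> 'c::real_normed_vector) \<Rightarrow> bool" where
  "bounded_over S f \<longleftrightarrow> (\<exists>C. \<forall>x\<in>S. norm (f x) \<le> C * norm x)"

lemma bounded_overI: "(\<And>x. x \<in> S \<Longrightarrow> norm (f x) \<le> C * norm x) \<Longrightarrow> bounded_over S f"
  unfolding bounded_over_def by blast

lemma bounded_overE:
  assumes "bounded_over S f"
  obtains C where "C \<ge> 0" "\<And>x. x \<in> S \<Longrightarrow> norm (f x) \<le> C * norm x"
proof -
  obtain C where C: "\<And>x. x \<in> S \<Longrightarrow> norm (f x) \<le> C * norm x"
    using assms unfolding bounded_over_def by blast
  have "norm (f x) \<le> max C 0 * norm x" if "x \<in> S" for x
    by (rule order.trans[OF C[OF that]]) (simp add: mult_right_mono)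
  then show ?thesis using that[of "max C 0"] by simp
qed

lemma bounded_over_add:
  assumes "bounded_over S f" "bounded_over S g"
  shows "bounded_over S (\<lambda>x. f x + g x)"
proof -
  obtain C D where "\<And>x. x \<in> S \<Longrightarrow> norm (f x) \<le> C * norm x" "\<And>x. x \<in> S \<Longrightarrow> norm (g x) \<le> D * norm x"
    using assms unfolding bounded_over_def by blast
  then have "norm (f x + g x) \<le> (C + D) * norm x" if "x \<in> S" for x
    using that norm_triangle_mono[of "f x" "C * norm x" "g x" "D * norm x"] by (simp add: distrib_right)
  then show ?thesis by (rule bounded_overI)
qed

lemma bounded_over_scale: "bounded_over S f \<Longrightarrow> bounded_over S (\<lambda>x. r *\<^sub>R f x)"
  unfolding bounded_over_def norm_scaleR
  by (metis abs_ge_zero mult.assoc mult_left_mono)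

lemma bounded_over_cong: "(\<And>x. x \<in> S \<Longrightarrow> f x = g x) \<Longrightarrow> bounded_over S f = bounded_over S g"
  by (simp add: bounded_over_def)

lemma bounded_over_bounded_linear:
  assumes "bounded_linear D" "bounded_over S f"
  shows "bounded_over S (\<lambda>x. D (f x))"
proof -
  obtain C where C: "\<And>x. norm (D x) \<le> norm x * C"
    using bounded_linear.bounded[OF assms(1)] by blast
  obtain K where K: "K \<ge> 0" "\<And>x. x \<in> S \<Longrightarrow> norm (f x) \<le> K * norm x"
    using bounded_overE[OF assms(2)] by blast
  have "C \<ge> 0 \<or> (\<forall>x. D x = 0)"
    using C by (metis norm_ge_zero norm_le_zero_iff mult_nonneg_nonpos order.trans not_le order.strict_implies_order)
  then have "norm (D (f x)) \<le> (max C 0 * K) * norm x" if "x \<in> S" for x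
  proof -
    have "norm (D (f x)) \<le> norm (f x) * max C 0"
      by (rule order.trans[OF C]) (simp add: mult_left_mono)
    also have "\<dots> \<le> K * norm x * max C 0" by (intro mult_right_mono K that) simp
    finally show ?thesis by (simp add: mult_ac)
  qed
  then show ?thesis by (rule bounded_overI)
qed

lemma bounded_over_comp:
  assumes "bounded_over S f" "bounded_over S' g" "\<And>x. x \<in> S' \<Longrightarrow> g x \<in> S"
  shows "bounded_over S' (\<lambda>x. f (g x))"
proof -
  obtain K where K: "K \<ge> 0" "\<And>x. x \<in> S \<Longrightarrow> norm (f x) \<le> K * norm x"
    using bounded_overE[OF assms(1)] by blast
  obtain L where L: "\<And>x. x \<in> S' \<Longrightarrow> norm (g x) \<le> L * norm x"
    using bounded_overE[OF assms(2)] by blast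
  have "norm (f (g x)) \<le> (K * L) * norm x" if "x \<in> S'" for x
  proof -
    have "norm (f (g x)) \<le> K * norm (g x)" using K assms(3) that by blast
    also have "\<dots> \<le> K * (L * norm x)" by (intro mult_left_mono L that K)
    finally show ?thesis by (simp add: mult_ac)
  qed
  then show ?thesis by (rule bounded_overI)
qed

lemma bounded_linear_bounded_over: "bounded_linear D \<Longrightarrow> bounded_over S D"
proof -
  assume D: "bounded_linear D"
  have "bounded_over S (\<lambda>x. x)" by (rule bounded_overI[where C = 1]) simp
  from bounded_over_bounded_linear[OF D this] show ?thesis .
qed

lemma real_linear_on_0: "real_linear_on S f \<Longrightarrow> subspace S \<Longrightarrow> f 0 = 0"
  unfolding real_linear_on_def by (metis scaleR_zero_left subspace_0)

lemma real_linear_on_diff: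
  assumes "real_linear_on S f" "subspace S" "x \<in> S" "y \<in> S"
  shows "f (x - y) = f x - f y"
proof -
  have "x - y \<in> S" using assms by (simp add: subspace_diff)
  then have "f (x - y + y) = f (x - y) + f y" using assms unfolding real_linear_on_def by blast
  then show ?thesis by simp
qed

lemma real_linear_on_continuous_bounded:
  assumes f: "real_linear_on S f" and S: "subspace S" and cont: "continuous_on S f"
  shows "bounded_over S f"
proof -
  have f0: "f 0 = 0" by (rule real_linear_on_0[OF f S])
  have "0 \<in> S" by (rule subspace_0[OF S])
  then obtain d where d: "d > 0" "\<And>x. x \<in> S \<Longrightarrow> dist x 0 < d \<Longrightarrow> dist (f x) (f 0) < 1"
    using cont unfolding continuous_on_iff by (metis zero_less_one)
  have "norm (f x) \<le> (2 / d) * norm x" if x: "x \<in> S" for x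
  proof (cases "x = 0")
    case False
    define r where "r = d / (2 * norm x)"
    have r: "r > 0" using d False by (simp add: r_def)
    have "norm (r *\<^sub>R x) < d" using d False by (simp add: r_def)
    then have "norm (f (r *\<^sub>R x)) < 1"
      using d(2)[of "r *\<^sub>R x"] S x by (simp add: f0 subspace_scale)
    then have "r * norm (f x) < 1"
      using f x r unfolding real_linear_on_def by simp
    then have "norm (f x) < 1 / r" using r by (simp add: pos_less_divide_eq mult.commute)
    then show ?thesis by (simp add: r_def)
  qed (simp add: f0)
  then show ?thesis by (rule bounded_overI)
qed

lemma real_linear_on_bounded_continuous:
  assumes f: "real_linear_on S f" and S: "subspace S" and bd: "bounded_over S f"
  shows "continuous_on S f"
proof -
  obtain C where C: "C \<ge> 0" "\<And>x. x \<in> S \<Longrightarrow> norm (f x) \<le> C * norm x"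
    using bounded_overE[OF bd] by blast
  have "C-lipschitz_on S f"
    by (rule lipschitz_onI)
      (use C S in \<open>simp_all add: dist_norm real_linear_on_diff[OF f S, symmetric] subspace_diff\<close>)
  then show ?thesis by (rule lipschitz_on_continuous_on)
qed

lemma real_linear_on_bounded_linear:
  assumes "real_linear_on UNIV f" "continuous_on UNIV f"
  shows "bounded_linear f"
proof -
  obtain C where "\<And>x. norm (f x) \<le> C * norm x"
    using real_linear_on_continuous_bounded[OF assms(1) subspace_UNIV assms(2)]
    unfolding bounded_over_def by blast
  then show ?thesis
    using assms(1) by (intro bounded_linear_intro[of _ C]) (auto simp: real_linear_on_def mult.commute)
qed

text \<open>\<open>N\<close> is the operator norm on \<open>S\<close>. Any proportion strictly
  between 1/2 and 1 would serve the uniform boundedness argument; 2/3 is the one used.\<close>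

lemma almost_attained_bound:
  assumes "bounded_over S f" and S: "subspace S" and f: "real_linear_on S f"
  shows "\<exists>N u. N \<ge> 0 \<and> (\<forall>x\<in>S. norm (f x) \<le> N * norm x) \<and> u \<in> S \<and> norm u \<le> 1 \<and> norm (f u) \<ge> 2/3 * N"
proof -
  define V where "V = (\<lambda>x. norm (f x)) ` {x\<in>S. norm x \<le> 1}"
  define N where "N = Sup V"
  obtain C where C: "C \<ge> 0" "\<And>x. x \<in> S \<Longrightarrow> norm (f x) \<le> C * norm x"
    using bounded_overE[OF assms(1)] by blast
  have f0: "f 0 = 0" by (rule real_linear_on_0[OF f S])
  have "norm (f x) \<le> C" if "x \<in> S" "norm x \<le> 1" for x
    using C(2)[OF that(1)] mult_left_mono[OF that(2) C(1)] by simp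
  then have bdd: "bdd_above V" unfolding V_def by (intro bdd_aboveI[of _ C]) auto
  have "0 \<in> V" unfolding V_def using subspace_0[OF S] f0 by (intro image_eqI[of _ _ 0]) auto
  then have N0: "N \<ge> 0" unfolding N_def using bdd by (rule cSup_upper)
  have N: "norm (f x) \<le> N * norm x" if x: "x \<in> S" for x
  proof (cases "x = 0")
    case False
    have "norm (f ((1 / norm x) *\<^sub>R x)) \<in> V"
      unfolding V_def using S x False by (intro imageI) (simp add: subspace_scale)
    then have "norm (f ((1 / norm x) *\<^sub>R x)) \<le> N" unfolding N_def using bdd by (rule cSup_upper)
    moreover have "f ((1 / norm x) *\<^sub>R x) = (1 / norm x) *\<^sub>R f x"
      using f x unfolding real_linear_on_def by blast
    ultimately show ?thesis using False by (simp add: divide_le_eq)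
  qed (simp add: f0)
  have "\<exists>u. u \<in> S \<and> norm u \<le> 1 \<and> norm (f u) \<ge> 2/3 * N"
  proof (cases "N = 0")
    case True
    then show ?thesis using subspace_0[OF S] by (intro exI[of _ 0]) simp
  next
    case False
    then have "2/3 * N < Sup V" using N0 by (simp add: N_def)
    then obtain v where "v \<in> V" "2/3 * N < v"
      using \<open>0 \<in> V\<close> less_cSupD[of V] by blast
    then show ?thesis unfolding V_def by force
  qed
  then show ?thesis using N0 N by blast
qed

text \<open>Sokal's proof of the uniform boundedness principle, for maps on a closed subspace.\<close>

lemma uniform_boundedness:
  fixes f :: "'i \<Rightarrow> 'a::banach \<Rightarrow> 'c::real_normed_vector"
  assumes S: "closed S" "subspace S"
    and lin: "\<And>i. i \<in> I \<Longrightarrow> real_linear_on S (f i)" and bd: "\<And>i. i \<in> I \<Longrightarrow> bounded_over S (f i)"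
    and pw: "\<And>x. x \<in> S \<Longrightarrow> \<exists>C. \<forall>i\<in>I. norm (f i x) \<le> C"
  shows "\<exists>C. \<forall>i\<in>I. \<forall>x\<in>S. norm (f i x) \<le> C * norm x"
proof (rule ccontr)
  assume neg: "\<not> ?thesis"
  \<comment> \<open>The growth \<open>3 ^ n\<close> compensates the step lengths \<open>r n\<close>,
    and the 6 compensates the surplus 2/3 - 1/2 = 1/6 left at the end.\<close>
  have "\<exists>i N u. i \<in> I \<and> (\<forall>x\<in>S. norm (f i x) \<le> N * norm x) \<and> u \<in> S \<and> norm u \<le> 1
      \<and> norm (f i u) \<ge> 2/3 * N \<and> N > 6 * real n * 3 ^ n" for n
  proof -
    obtain i where i: "i \<in> I" "\<not> (\<forall>x\<in>S. norm (f i x) \<le> (6 * real n * 3 ^ n) * norm x)"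
      using neg by blast
    obtain N u where N: "N \<ge> 0" "\<forall>x\<in>S. norm (f i x) \<le> N * norm x" "u \<in> S" "norm u \<le> 1" "norm (f i u) \<ge> 2/3 * N"
      using almost_attained_bound[OF bd[OF i(1)] S(2) lin[OF i(1)]] by blast
    have "N > 6 * real n * 3 ^ n"
      using i(2) N(2) by (meson mult_right_mono norm_ge_zero not_le order.trans order.strict_implies_order)
    then show ?thesis using i N by blast
  qed
  then obtain i N u where I: "\<And>n. i n \<in> I" and N: "\<And>n x. x \<in> S \<Longrightarrow> norm (f (i n) x) \<le> N n * norm x"
    and u: "\<And>n. u n \<in> S" "\<And>n. norm (u n) \<le> 1" "\<And>n. norm (f (i n) (u n)) \<ge> 2/3 * N n"
    and big: "\<And>n. N n > 6 * real n * 3 ^ n" by metis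
  define r where "r n = (1/3::real) ^ n" for n :: nat
  \<comment> \<open>The images of v + y and v - y differ by twice the image of y, so at least one of
    them is as large as the image of y. The sign is chosen accordingly.\<close>
  define x where "x = rec_nat 0 (\<lambda>n v. if norm (f (i n) (v + r n *\<^sub>R u n)) \<ge> r n * norm (f (i n) (u n))
      then v + r n *\<^sub>R u n else v - r n *\<^sub>R u n)"
  have x_Suc: "x (Suc n) = x n + r n *\<^sub>R u n \<or> x (Suc n) = x n - r n *\<^sub>R u n" for n
    by (simp add: x_def)
  have xS: "x n \<in> S" for n
    by (induction n) (use x_Suc u(1) S(2) in \<open>auto simp: x_def subspace_0 subspace_add subspace_diff subspace_scale\<close>)
  have grow: "norm (f (i n) (x (Suc n))) \<ge> r n * norm (f (i n) (u n))" for n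
  proof (cases "norm (f (i n) (x n + r n *\<^sub>R u n)) \<ge> r n * norm (f (i n) (u n))")
    case False
    let ?f = "f (i n)"
    have ru: "r n *\<^sub>R u n \<in> S" using S u by (simp add: subspace_scale)
    have add: "?f (x n + r n *\<^sub>R u n) = ?f (x n) + r n *\<^sub>R ?f (u n)"
      using lin[OF I] xS[of n] ru u(1)[of n] unfolding real_linear_on_def by metis
    have diff: "?f (x n - r n *\<^sub>R u n) = ?f (x n) - r n *\<^sub>R ?f (u n)"
      using real_linear_on_diff[OF lin[OF I] S(2) xS ru] lin[OF I] u(1)[of n] unfolding real_linear_on_def by metis
    have two: "(a + c) - (a - c) = 2 *\<^sub>R c" for a c :: 'c
    proof -
      have "(a + c) - (a - c) = c + c" by simp
      then show ?thesis by (simp only: scaleR_2)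
    qed
    have "norm (2 *\<^sub>R (r n *\<^sub>R ?f (u n))) \<le> norm (?f (x n) + r n *\<^sub>R ?f (u n)) + norm (?f (x n) - r n *\<^sub>R ?f (u n))"
      using norm_triangle_ineq4[of "?f (x n) + r n *\<^sub>R ?f (u n)" "?f (x n) - r n *\<^sub>R ?f (u n)"]
      by (simp only: two)
    moreover have "r n \<ge> 0" by (simp add: r_def)
    then have "norm (2 *\<^sub>R (r n *\<^sub>R ?f (u n))) = 2 * (r n * norm (?f (u n)))" by simp
    moreover have "norm (?f (x n) + r n *\<^sub>R ?f (u n)) < r n * norm (?f (u n))"
      using False unfolding add by simp
    ultimately have "r n * norm (?f (u n)) \<le> norm (?f (x n) - r n *\<^sub>R ?f (u n))"
      by linarith
    then show ?thesis using False diff by (simp add: x_def)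
  qed (simp add: x_def)
  have close: "norm (x (Suc n + k) - x (Suc n)) \<le> (r n - r (n + k)) / 2" for n k
  proof (induction k)
    case (Suc k)
    have "norm (x (Suc (Suc n + k)) - x (Suc n + k)) \<le> r (Suc n + k)"
      using x_Suc[of "Suc n + k"] u(2)[of "Suc n + k"] by (auto simp: r_def mult_left_le)
    moreover have "x (Suc n + Suc k) - x (Suc n) = (x (Suc (Suc n + k)) - x (Suc n + k)) + (x (Suc n + k) - x (Suc n))"
      by simp
    ultimately have "norm (x (Suc n + Suc k) - x (Suc n)) \<le> r (Suc n + k) + (r n - r (n + k)) / 2"
      using Suc norm_triangle_mono by metis
    also have "\<dots> = (r n - r (n + Suc k)) / 2" by (simp add: r_def field_simps)
    finally show ?case .
  qed simp
  have close': "norm (x m - x (Suc n)) \<le> r n / 2" if "m \<ge> Suc n" for m n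
  proof -
    obtain k where k: "m = Suc n + k" using le_Suc_ex[OF \<open>m \<ge> Suc n\<close>] by blast
    have "r (n + k) \<ge> 0" by (simp add: r_def)
    then have "(r n - r (n + k)) / 2 \<le> r n / 2" by simp
    with close[of n k] show ?thesis unfolding k by (rule order.trans)
  qed
  have r0: "r \<longlonglongrightarrow> 0" unfolding r_def by (rule LIMSEQ_power_zero) simp
  have "Cauchy x"
    unfolding Cauchy_def
  proof (intro allI impI)
    fix e :: real assume "e > 0"
    then have "eventually (\<lambda>n. r n < e) sequentially" using order_tendstoD(2)[OF r0] by simp
    then obtain n where n: "r n < e" by (auto simp: eventually_sequentially)
    have "dist (x m) (x k) < e" if "m \<ge> Suc n" "k \<ge> Suc n" for m k
    proof -
      have "dist (x m) (x k) \<le> dist (x m) (x (Suc n)) + dist (x k) (x (Suc n))" by (rule dist_triangle2)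
      also have "\<dots> \<le> r n" using close'[OF that(1)] close'[OF that(2)] by (simp add: dist_norm)
      finally show ?thesis using n by simp
    qed
    then show "\<exists>M. \<forall>m\<ge>M. \<forall>n\<ge>M. dist (x m) (x n) < e" by blast
  qed
  then obtain z where z: "x \<longlonglongrightarrow> z" by (auto simp: Cauchy_convergent_iff convergent_def)
  have zS: "z \<in> S" by (rule closed_sequentially[OF S(1) xS z])
  have near: "norm (z - x (Suc n)) \<le> r n / 2" for n
  proof (rule tendsto_upperbound)
    show "(\<lambda>m. norm (x m - x (Suc n))) \<longlonglongrightarrow> norm (z - x (Suc n))" by (intro tendsto_intros z)
    show "\<forall>\<^sub>F m in sequentially. norm (x m - x (Suc n)) \<le> r n / 2"
      by (rule eventually_mono[OF eventually_ge_at_top[of "Suc n"]]) (rule close')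
  qed simp
  obtain C where C: "\<And>j. j \<in> I \<Longrightarrow> norm (f j z) \<le> C" using pw[OF zS] by blast
  have "real n \<le> C" for n
  proof -
    let ?f = "f (i n)"
    have N0: "N n \<ge> 0" using big[of n] by (smt (verit) mult_nonneg_nonneg of_nat_0_le_iff zero_le_power)
    have rn: "r n > 0" by (simp add: r_def)
    have "?f (x (Suc n)) = ?f z - ?f (z - x (Suc n))"
      using real_linear_on_diff[OF lin[OF I] S(2) zS xS, of n "Suc n"] by simp
    then have "norm (?f (x (Suc n))) \<le> norm (?f z) + norm (?f (z - x (Suc n)))"
      by (simp add: norm_triangle_ineq4)
    also have "norm (?f (z - x (Suc n))) \<le> N n * (r n / 2)"
      by (rule order.trans[OF N[OF subspace_diff[OF S(2) zS xS]] mult_left_mono[OF near N0]])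
    \<comment> \<open>The steps after the n-th have total length at most \<open>r n / 2\<close>, so
      they cannot undo the 2/3 gained at that step.\<close>
    finally have "r n * (2/3 * N n) \<le> C + N n * (r n / 2)"
      using grow[of n] mult_left_mono[OF u(3)[of n], of "r n"] C[OF I, of n] rn by linarith
    then have "r n * N n \<le> 6 * C" by (simp add: algebra_simps)
    moreover have "r n * N n > r n * (6 * real n * 3 ^ n)" by (intro mult_strict_left_mono big rn)
    moreover have "r n * (6 * real n * 3 ^ n) = 6 * real n" by (simp add: r_def power_divide)
    ultimately show ?thesis by simp
  qed
  then show False using reals_Archimedean2[of C] by (meson not_le)
qed

section \<open>Bounded maps across finite codimension\<close>

text \<open>A vector outside the closed subspace has positive distance \<open>d\<close> from it, so
  the coefficient \<open>r\<close> of \<open>w + r *\<^sub>R v\<close> is at most the norm divided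
  by \<open>d\<close>. This gives both closedness of the enlarged space and the bound on it.\<close>

lemma bounded_over_insert:
  fixes f :: "'a::banach \<Rightarrow> 'c::real_normed_vector"
  assumes W: "closed W" "subspace W" and V: "subspace V" "W \<subseteq> V" "v \<in> V"
    and f: "real_linear_on V f" "bounded_over W f"
  shows "\<exists>W'. closed W' \<and> subspace W' \<and> insert v W \<subseteq> W' \<and> W' \<subseteq> V \<and> bounded_over W' f"
proof (cases "v \<in> W")
  case True
  then show ?thesis using assms by blast
next
  case False
  have "open (- W)" "v \<in> - W" using W(1) False by (auto simp: closed_def)
  then obtain d where d: "d > 0" and dW: "\<forall>y. dist y v < d \<longrightarrow> y \<in> - W"
    unfolding open_dist by blast
  have d: "d > 0" "\<And>w. w \<in> W \<Longrightarrow> dist v w \<ge> d"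
  proof -
    show "dist v w \<ge> d" if "w \<in> W" for w
      using dW that by (metis ComplD dist_commute not_le)
  qed (rule d)
  have coeff: "\<bar>r\<bar> * d \<le> norm (w + r *\<^sub>R v)" if "w \<in> W" for r w
  proof (cases "r = 0")
    case False
    have "- (1 / r) *\<^sub>R w \<in> W" by (rule subspace_scale[OF W(2) that])
    from d(2)[OF this] have "d \<le> norm (v + (1 / r) *\<^sub>R w)" by (simp add: dist_norm)
    then have "\<bar>r\<bar> * d \<le> norm (r *\<^sub>R (v + (1 / r) *\<^sub>R w))" by (simp add: mult_left_mono)
    then show ?thesis using False by (simp add: scaleR_add_right add.commute)
  qed simp
  define W' where "W' = {w + r *\<^sub>R v | w r. w \<in> W}"
  have W'I: "w + r *\<^sub>R v \<in> W'" if "w \<in> W" for w r using that unfolding W'_def by blast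
  have W'E: "\<exists>w r. w \<in> W \<and> x = w + r *\<^sub>R v" if "x \<in> W'" for x using that unfolding W'_def by blast
  have sub: "subspace W'"
    unfolding subspace_def
  proof (intro conjI ballI allI)
    show "0 \<in> W'" using W'I[OF subspace_0[OF W(2)], of 0] by simp
  next
    fix x y assume "x \<in> W'" "y \<in> W'"
    then obtain a r b s where "a \<in> W" "b \<in> W" "x = a + r *\<^sub>R v" "y = b + s *\<^sub>R v"
      using W'E by meson
    then have "x + y = (a + b) + (r + s) *\<^sub>R v" "a + b \<in> W"
      using W by (auto simp: algebra_simps subspace_add)
    then show "x + y \<in> W'" using W'I by metis
  next
    fix c x assume "x \<in> W'"
    then obtain a r where "a \<in> W" "x = a + r *\<^sub>R v" using W'E by meson
    then have "c *\<^sub>R x = c *\<^sub>R a + (c * r) *\<^sub>R v" "c *\<^sub>R a \<in> W"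
      using W by (auto simp: algebra_simps subspace_scale)
    then show "c *\<^sub>R x \<in> W'" using W'I by metis
  qed
  have "closed W'"
    unfolding closed_sequential_limits
  proof (intro allI impI, elim conjE)
    fix x l assume x: "\<forall>n. x n \<in> W'" and l: "x \<longlonglongrightarrow> l"
    have "\<forall>n. \<exists>a c. a \<in> W \<and> x n = a + c *\<^sub>R v" using x W'E by blast
    then obtain w r where w: "\<And>n. w n \<in> W" and x_eq: "\<And>n. x n = w n + r n *\<^sub>R v"
      by metis
    have "Cauchy r"
      unfolding Cauchy_def
    proof (intro allI impI)
      fix e :: real assume "e > 0"
      then have "e * d > 0" using d by simp
      then obtain M where M: "\<And>m n. m \<ge> M \<Longrightarrow> n \<ge> M \<Longrightarrow> dist (x m) (x n) < e * d"
        using LIMSEQ_imp_Cauchy[OF l] unfolding Cauchy_def by meson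
      have "dist (r m) (r n) < e" if "m \<ge> M" "n \<ge> M" for m n
      proof -
        have "x m - x n = (w m - w n) + (r m - r n) *\<^sub>R v" by (simp add: x_eq algebra_simps)
        then have "\<bar>r m - r n\<bar> * d \<le> dist (x m) (x n)"
          using coeff[of "w m - w n" "r m - r n"] w W by (simp add: dist_norm subspace_diff)
        then have "\<bar>r m - r n\<bar> * d < e * d" using M[OF that] by linarith
        then show ?thesis using d by (simp add: dist_real_def)
      qed
      then show "\<exists>M. \<forall>m\<ge>M. \<forall>n\<ge>M. dist (r m) (r n) < e" by blast
    qed
    then obtain s where s: "r \<longlonglongrightarrow> s" by (auto simp: Cauchy_convergent_iff convergent_def)
    have "(\<lambda>n. x n - r n *\<^sub>R v) \<longlonglongrightarrow> l - s *\<^sub>R v" by (intro tendsto_intros l s)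
    then have "w \<longlonglongrightarrow> l - s *\<^sub>R v" by (simp add: x_eq)
    then have "l - s *\<^sub>R v \<in> W" using closed_sequentially[OF W(1)] w by blast
    then show "l \<in> W'" using W'I[of "l - s *\<^sub>R v" s] by simp
  qed
  moreover have "insert v W \<subseteq> W'"
    using W'I[OF subspace_0[OF W(2)], of 1] W'I[of _ 0] by auto
  moreover have "W' \<subseteq> V"
    using V by (metis W'E subsetD subsetI subspace_add subspace_scale)
  moreover have "bounded_over W' f"
  proof -
    obtain C where C: "C \<ge> 0" "\<And>x. x \<in> W \<Longrightarrow> norm (f x) \<le> C * norm x"
      using bounded_overE[OF f(2)] by blast
    have "norm (f x) \<le> (C + (C * norm v + norm (f v)) / d) * norm x" if "x \<in> W'" for x
    proof -
      obtain w r where w: "w \<in> W" "x = w + r *\<^sub>R v" using W'E[OF \<open>x \<in> W'\<close>] by blast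
      have "f x = f w + r *\<^sub>R f v"
        using f(1) w V subspace_scale[OF V(1) V(3), of r] unfolding real_linear_on_def by (simp add: subsetD)
      then have "norm (f x) \<le> norm (f w) + \<bar>r\<bar> * norm (f v)" by (metis norm_scaleR norm_triangle_ineq)
      also have "norm (f w) \<le> C * (norm x + \<bar>r\<bar> * norm v)"
      proof -
        have "norm w \<le> norm x + \<bar>r\<bar> * norm v"
          using norm_triangle_ineq4[of x "r *\<^sub>R v"] w(2) by simp
        then show ?thesis using C w(1) by (meson mult_left_mono order.trans)
      qed
      also have "C * (norm x + \<bar>r\<bar> * norm v) + \<bar>r\<bar> * norm (f v) = C * norm x + \<bar>r\<bar> * (C * norm v + norm (f v))"
        by (simp add: algebra_simps)
      also have "\<dots> \<le> C * norm x + (norm x / d) * (C * norm v + norm (f v))"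
        using coeff[OF w(1), of r] d(1) C(1) w(2) by (intro add_left_mono mult_right_mono) (simp_all add: pos_le_divide_eq)
      finally show ?thesis by (simp add: field_simps)
    qed
    then show ?thesis by (rule bounded_overI)
  qed
  ultimately show ?thesis using sub by blast
qed

lemma bounded_over_finite_codim:
  fixes f :: "'a::banach \<Rightarrow> 'c::real_normed_vector"
  assumes W: "closed W" "subspace W" and V: "subspace V" "W \<subseteq> V" "B \<subseteq> V" "finite B"
    and f: "real_linear_on V f" "bounded_over W f"
    and span: "\<And>x. x \<in> V \<Longrightarrow> \<exists>y\<in>span B. x - y \<in> W"
  shows "bounded_over V f"
proof -
  have "\<exists>W'. closed W' \<and> subspace W' \<and> B \<union> W \<subseteq> W' \<and> W' \<subseteq> V \<and> bounded_over W' f"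
    using V(4,3)
  proof (induction B)
    case empty
    show ?case using W V(2) f by (intro exI[of _ W]) simp
  next
    case (insert v B)
    then obtain W1 where W1: "closed W1" "subspace W1" "B \<union> W \<subseteq> W1" "W1 \<subseteq> V" "bounded_over W1 f" by auto
    have "v \<in> V" using insert.prems by simp
    from bounded_over_insert[OF W1(1,2) V(1) W1(4) this f(1) W1(5)]
    obtain W2 where "closed W2" "subspace W2" "insert v W1 \<subseteq> W2" "W2 \<subseteq> V" "bounded_over W2 f" by blast
    moreover from this W1(3) have "insert v B \<union> W \<subseteq> W2" by blast
    ultimately show ?case by blast
  qed
  then obtain W' where W': "subspace W'" "B \<union> W \<subseteq> W'" "bounded_over W' f" by blast
  have "V \<subseteq> W'"
  proof
    fix x assume "x \<in> V"
    then obtain y where "y \<in> span B" "x - y \<in> W" using span by blast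
    then have "y \<in> W'" "x - y \<in> W'" using W' span_minimal[of B W'] by auto
    then show "x \<in> W'" using subspace_add[OF W'(1), of y "x - y"] by simp
  qed
  then show ?thesis using W'(3) unfolding bounded_over_def by blast
qed

section \<open>Null operators\<close>

lemma bounded_linear_star: "bounded_linear (star :: 'a::cstar_algebra \<Rightarrow> 'a)"
  by (rule bounded_linear_intro[where K = 1]) (simp_all add: star_add star_scaleR norm_star)

lemma norm_cstar_triple: "norm (cstar_triple a b c) \<le> norm a * norm b * norm (c::'a::cstar_algebra)"
proof -
  have "norm (a * star b * c) \<le> norm a * norm b * norm c" "norm (c * star b * a) \<le> norm a * norm b * norm c"
    using mult_right_mono[OF norm_mult_ineq[of a "star b"], of "norm c"] norm_mult_ineq[of "a * star b" c]
      mult_right_mono[OF norm_mult_ineq[of c "star b"], of "norm a"] norm_mult_ineq[of "c * star b" a]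
    by (simp_all add: norm_star mult_ac)
  then show ?thesis
    using norm_triangle_ineq[of "a * star b * c" "c * star b * a"] by (simp add: cstar_triple_def)
qed

lemma cstar_triple_add:
  fixes a b c :: "'a::cstar_algebra"
  shows "cstar_triple (a + a') b c = cstar_triple a b c + cstar_triple a' b c"
    and "cstar_triple a (b + b') c = cstar_triple a b c + cstar_triple a b' c"
    and "cstar_triple a b (c + c') = cstar_triple a b c + cstar_triple a b c'"
  by (simp_all add: cstar_triple_def star_add algebra_simps)

lemma cstar_triple_scaleR:
  fixes a b c :: "'a::cstar_algebra"
  shows "cstar_triple (r *\<^sub>R a) b c = r *\<^sub>R cstar_triple a b c"
    and "cstar_triple a (r *\<^sub>R b) c = r *\<^sub>R cstar_triple a b c"
    and "cstar_triple a b (r *\<^sub>R c) = r *\<^sub>R cstar_triple a b c"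
  by (simp_all add: cstar_triple_def star_scaleR scaleR_add_right mult.commute)

lemma cstar_triple_0 [simp]:
  fixes a b :: "'a::cstar_algebra"
  shows "cstar_triple 0 a b = 0" "cstar_triple a 0 b = 0" "cstar_triple a b 0 = 0"
  by (simp_all add: cstar_triple_def)

lemma bounded_linear_triple_outer: "bounded_linear (\<lambda>t. cstar_triple a b (t::'a::cstar_algebra))"
  by (rule bounded_linear_intro[where K = "norm a * norm b"])
    (simp_all add: cstar_triple_add cstar_triple_scaleR mult.commute norm_cstar_triple[THEN order.trans])

lemma bounded_linear_triple_inner: "bounded_linear (\<lambda>t. cstar_triple a t (b::'a::cstar_algebra))"
proof (rule bounded_linear_intro[where K = "norm a * norm b"])
  show "norm (cstar_triple a x b) \<le> norm x * (norm a * norm b)" for x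
    using norm_cstar_triple[of a x b] by (simp add: mult_ac)
qed (simp_all add: cstar_triple_add cstar_triple_scaleR)

locale real_cstar =
  fixes A :: "'b::cstar_algebra set"
  assumes real_cstar: "real_cstar_algebra A"
begin

lemma closed_A: "closed A" and subspace_A: "subspace A"
  and mult_A [simp]: "a \<in> A \<Longrightarrow> b \<in> A \<Longrightarrow> a * b \<in> A" and star_A [simp]: "a \<in> A \<Longrightarrow> star a \<in> A"
  using real_cstar by (auto simp: real_cstar_algebra_def)

lemma zero_A [simp]: "0 \<in> A"
  and add_A [simp]: "a \<in> A \<Longrightarrow> b \<in> A \<Longrightarrow> a + b \<in> A"
  and diff_A [simp]: "a \<in> A \<Longrightarrow> b \<in> A \<Longrightarrow> a - b \<in> A"
  and scaleR_A [simp]: "a \<in> A \<Longrightarrow> r *\<^sub>R a \<in> A"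
  using subspace_A by (simp_all add: subspace_0 subspace_add subspace_diff subspace_scale)

lemma triple_A [simp]: "a \<in> A \<Longrightarrow> b \<in> A \<Longrightarrow> c \<in> A \<Longrightarrow> cstar_triple a b c \<in> A"
  by (simp add: cstar_triple_def)

end

text \<open>
  Of the module structure only the continuity of the products is kept: modulo bounded maps, \<open>\<delta>\<close>
  intertwines every multiplication operator of \<open>A\<close> with a bounded operator on the module.
\<close>

locale triple_map = real_cstar A for A :: "'b::cstar_algebra set" +
  fixes \<delta> :: "'b \<Rightarrow> 'y::banach" and m\<^sub>2 :: "'b \<Rightarrow> 'y \<Rightarrow> 'b \<Rightarrow> 'y" and m\<^sub>3 :: "'b \<Rightarrow> 'b \<Rightarrow> 'y \<Rightarrow> 'y"
  assumes linear_\<delta>: "real_linear_on A \<delta>"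
    and outer_bounded: "a \<in> A \<Longrightarrow> b \<in> A \<Longrightarrow> bounded_linear (m\<^sub>3 a b)"
    and inner_bounded: "a \<in> A \<Longrightarrow> b \<in> A \<Longrightarrow> bounded_linear (\<lambda>x. m\<^sub>2 a x b)"
    and outer_continuous1: "b \<in> A \<Longrightarrow> continuous_on A (\<lambda>a. m\<^sub>3 a b x)"
    and outer_continuous2: "a \<in> A \<Longrightarrow> continuous_on A (\<lambda>b. m\<^sub>3 a b x)"
    and inner_continuous: "b \<in> A \<Longrightarrow> continuous_on A (\<lambda>a. m\<^sub>2 a x b)"
    and outer_defect: "a \<in> A \<Longrightarrow> b \<in> A \<Longrightarrow>
      bounded_over A (\<lambda>t. \<delta> (cstar_triple a b t) - m\<^sub>3 a b (\<delta> t))"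
    and inner_defect: "a \<in> A \<Longrightarrow> b \<in> A \<Longrightarrow>
      bounded_over A (\<lambda>t. \<delta> (cstar_triple a t b) - m\<^sub>2 a (\<delta> t) b)"
begin

lemma \<delta>_add: "x \<in> A \<Longrightarrow> y \<in> A \<Longrightarrow> \<delta> (x + y) = \<delta> x + \<delta> y"
  and \<delta>_scale: "x \<in> A \<Longrightarrow> \<delta> (r *\<^sub>R x) = r *\<^sub>R \<delta> x"
  using linear_\<delta> by (auto simp: real_linear_on_def)

lemma \<delta>_0 [simp]: "\<delta> 0 = 0"
  by (rule real_linear_on_0[OF linear_\<delta> subspace_A])

lemma \<delta>_sum: "(\<And>i. i \<in> S \<Longrightarrow> f i \<in> A) \<Longrightarrow> \<delta> (sum f S) = (\<Sum>i\<in>S. \<delta> (f i))"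
  by (induction S rule: infinite_finite_induct)
    (simp_all add: \<delta>_add subspace_sum[OF subspace_A])

definition oper :: "('b \<Rightarrow> 'b) \<Rightarrow> bool" where
  "oper T \<longleftrightarrow> bounded_linear T \<and> (\<forall>t\<in>A. T t \<in> A)"

definition null :: "('b \<Rightarrow> 'b) \<Rightarrow> bool" where
  "null T \<longleftrightarrow> oper T \<and> bounded_over A (\<lambda>t. \<delta> (T t))"

lemma oper_outer: "a \<in> A \<Longrightarrow> b \<in> A \<Longrightarrow> oper (\<lambda>t. cstar_triple a b t)"
  by (simp add: oper_def bounded_linear_triple_outer)

lemma oper_inner: "a \<in> A \<Longrightarrow> b \<in> A \<Longrightarrow> oper (\<lambda>t. cstar_triple a t b)"
  by (simp add: oper_def bounded_linear_triple_inner)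

lemma oper_comp: "oper T \<Longrightarrow> oper U \<Longrightarrow> oper (\<lambda>t. T (U t))"
  by (simp add: oper_def bounded_linear_compose)

lemma oper_mem: "oper T \<Longrightarrow> t \<in> A \<Longrightarrow> T t \<in> A"
  by (simp add: oper_def)

lemma oper_bounded_over: "oper T \<Longrightarrow> bounded_over A T"
  by (simp add: oper_def bounded_linear_bounded_over)

lemma oper_scale: "oper T \<Longrightarrow> oper (\<lambda>t. r *\<^sub>R T t)"
  unfolding oper_def by (auto intro: bounded_linear_const_scaleR)

lemma oper_add: "oper T \<Longrightarrow> oper U \<Longrightarrow> oper (\<lambda>t. T t + U t)"
  unfolding oper_def by (auto intro: bounded_linear_add)

lemma null_oper: "null T \<Longrightarrow> oper T"
  by (simp add: null_def)

lemma null_0: "null (\<lambda>t. 0)"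
  unfolding null_def oper_def by (auto intro: bounded_overI[where C = 0])

lemma null_add:
  assumes "null T" "null U"
  shows "null (\<lambda>t. T t + U t)"
proof -
  have "bounded_over A (\<lambda>t. \<delta> (T t) + \<delta> (U t))"
    using assms unfolding null_def by (intro bounded_over_add) auto
  then have "bounded_over A (\<lambda>t. \<delta> (T t + U t))"
    using assms by (subst bounded_over_cong[where g = "\<lambda>t. \<delta> (T t) + \<delta> (U t)"])
      (simp_all add: \<delta>_add oper_mem null_oper)
  then show ?thesis using assms by (simp add: null_def oper_add)
qed

lemma null_scale:
  assumes "null T"
  shows "null (\<lambda>t. r *\<^sub>R T t)"
proof -
  have "bounded_over A (\<lambda>t. r *\<^sub>R \<delta> (T t))"
    using assms unfolding null_def by (intro bounded_over_scale) auto
  then have "bounded_over A (\<lambda>t. \<delta> (r *\<^sub>R T t))"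
    using assms by (subst bounded_over_cong[where g = "\<lambda>t. r *\<^sub>R \<delta> (T t)"])
      (simp_all add: \<delta>_scale oper_mem null_oper)
  then show ?thesis using assms by (simp add: null_def oper_scale)
qed

lemma null_diff: "null T \<Longrightarrow> null U \<Longrightarrow> null (\<lambda>t. T t - U t)"
  using null_add[of T "\<lambda>t. (-1) *\<^sub>R U t"] null_scale[of U "-1"] by simp

lemma null_right:
  assumes "null T" "oper U"
  shows "null (\<lambda>t. T (U t))"
proof -
  have "bounded_over A (\<lambda>t. \<delta> (T (U t)))"
    using assms unfolding null_def
    by (intro bounded_over_comp[of A "\<lambda>t. \<delta> (T t)" A U]) (auto simp: oper_bounded_over oper_mem)
  then show ?thesis using assms by (simp add: null_def oper_comp)
qed

text \<open>Composition on the left needs an intertwiner: \<delta>(M(T t)) is the defect of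
  \<open>M\<close> at \<open>T t\<close> plus \<open>M'\<close> applied to the bounded map
  \<delta>(T t). Composition on the right works for every \<open>oper\<close>.\<close>

lemma null_intertwined:
  assumes M: "bounded_linear M'" "bounded_over A (\<lambda>t. \<delta> (M t) - M' (\<delta> t))" "oper M" and T: "null T"
  shows "null (\<lambda>t. M (T t))"
proof -
  have "bounded_over A (\<lambda>t. (\<delta> (M (T t)) - M' (\<delta> (T t))) + M' (\<delta> (T t)))"
  proof (rule bounded_over_add)
    show "bounded_over A (\<lambda>t. \<delta> (M (T t)) - M' (\<delta> (T t)))"
      using T by (intro bounded_over_comp[OF M(2), of A T])
        (auto simp: oper_bounded_over oper_mem null_oper)
    show "bounded_over A (\<lambda>t. M' (\<delta> (T t)))"
      using T unfolding null_def by (intro bounded_over_bounded_linear[OF M(1)]) simp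
  qed
  then show ?thesis using T M(3) by (simp add: null_def oper_comp)
qed

lemma null_outer: "a \<in> A \<Longrightarrow> b \<in> A \<Longrightarrow> null T \<Longrightarrow> null (\<lambda>t. cstar_triple a b (T t))"
  by (rule null_intertwined[OF outer_bounded outer_defect oper_outer])

lemma null_inner: "a \<in> A \<Longrightarrow> b \<in> A \<Longrightarrow> null T \<Longrightarrow> null (\<lambda>t. cstar_triple a (T t) b)"
  by (rule null_intertwined[OF inner_bounded inner_defect oper_inner])

lemma bounded_over_defect_iff:
  assumes "bounded_over A (\<lambda>t. f t - g t)"
  shows "bounded_over A f \<longleftrightarrow> bounded_over A (g :: 'b \<Rightarrow> 'y)"
proof
  assume "bounded_over A f"
  from bounded_over_add[OF this bounded_over_scale[OF assms, of "-1"]] show "bounded_over A g" by simp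
next
  assume "bounded_over A g"
  from bounded_over_add[OF this assms] show "bounded_over A f" by simp
qed

text \<open>Pointwise convergence makes the family \<open>D n (\<delta> t)\<close> pointwise
  bounded, and uniform boundedness gives a constant that survives in the limit.\<close>

lemma bounded_over_pointwise_limit:
  assumes D: "\<And>n. bounded_linear (D n)" "\<And>n. bounded_over A (\<lambda>t. D n (\<delta> t))"
    and lim: "\<And>t. t \<in> A \<Longrightarrow> (\<lambda>n. D n (\<delta> t)) \<longlonglongrightarrow> E (\<delta> t :: 'y)"
  shows "bounded_over A (\<lambda>t. E (\<delta> t))"
proof -
  have "\<exists>C. \<forall>n\<in>UNIV. \<forall>t\<in>A. norm (D n (\<delta> t)) \<le> C * norm t"
  proof (rule uniform_boundedness[OF closed_A subspace_A])
    show "real_linear_on A (\<lambda>t. D n (\<delta> t))" for n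
      unfolding real_linear_on_def
      by (simp add: \<delta>_add \<delta>_scale bounded_linear.linear[OF D(1)] linear_add linear_cmul)
    show "\<exists>C. \<forall>n\<in>UNIV. norm (D n (\<delta> t)) \<le> C" if "t \<in> A" for t
      using convergent_imp_Bseq[OF convergentI[OF lim[OF that]]] unfolding Bseq_def by blast
  qed (rule D(2))
  then obtain C where C: "\<And>n t. t \<in> A \<Longrightarrow> norm (D n (\<delta> t)) \<le> C * norm t" by blast
  have "norm (E (\<delta> t)) \<le> C * norm t" if "t \<in> A" for t
    by (rule tendsto_upperbound[OF tendsto_norm[OF lim[OF that]]]) (use C[OF that] in auto)
  then show ?thesis by (rule bounded_overI)
qed

text \<open>Limits cannot be taken inside \<delta>, which may be discontinuous. The defects carry
  nullness over to the module operators, and those converge pointwise by separate continuity of the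
  module products.\<close>

lemma null_limit:
  assumes a: "\<And>n. a n \<in> A" "a \<longlonglongrightarrow> l" and b: "b \<in> A"
  shows "(\<And>n. null (\<lambda>t. cstar_triple (a n) b t)) \<Longrightarrow> null (\<lambda>t. cstar_triple l b t)"
    and "(\<And>n. null (\<lambda>t. cstar_triple b (a n) t)) \<Longrightarrow> null (\<lambda>t. cstar_triple b l t)"
    and "(\<And>n. null (\<lambda>t. cstar_triple (a n) t b)) \<Longrightarrow> null (\<lambda>t. cstar_triple l t b)"
proof -
  have l: "l \<in> A" by (rule closed_sequentially[OF closed_A a])
  note lim = continuous_on_tendsto_compose[OF _ a(2) l always_eventually[OF allI[OF a(1)]]]
  note defect = bounded_over_defect_iff[OF outer_defect] bounded_over_defect_iff[OF inner_defect]
  show "null (\<lambda>t. cstar_triple l b t)" if "\<And>n. null (\<lambda>t. cstar_triple (a n) b t)"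
    using that unfolding null_def
    by (simp add: defect a l b oper_outer oper_inner)
      (rule bounded_over_pointwise_limit[of "\<lambda>n. m\<^sub>3 (a n) b"], auto intro!: outer_bounded a b lim[OF outer_continuous1])
  show "null (\<lambda>t. cstar_triple b l t)" if "\<And>n. null (\<lambda>t. cstar_triple b (a n) t)"
    using that unfolding null_def
    by (simp add: defect a l b oper_outer oper_inner)
      (rule bounded_over_pointwise_limit[of "\<lambda>n. m\<^sub>3 b (a n)"], auto intro!: outer_bounded a b lim[OF outer_continuous2])
  show "null (\<lambda>t. cstar_triple l t b)" if "\<And>n. null (\<lambda>t. cstar_triple (a n) t b)"
    using that unfolding null_def
    by (simp add: defect a l b oper_outer oper_inner)
      (rule bounded_over_pointwise_limit[of "\<lambda>n x. m\<^sub>2 (a n) x b"], auto intro!: inner_bounded a b lim[OF inner_continuous])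
qed

section \<open>The closed triple ideal of elements with null multiplication operators\<close>

definition J :: "'b set" where
  "J = {a\<in>A. \<forall>b\<in>A. null (\<lambda>t. cstar_triple a b t) \<and> null (\<lambda>t. cstar_triple b a t) \<and>
    null (\<lambda>t. cstar_triple a t b)}"

lemma J_A: "j \<in> J \<Longrightarrow> j \<in> A"
  by (simp add: J_def)

lemma J_null:
  assumes "j \<in> J" "b \<in> A"
  shows "null (\<lambda>t. cstar_triple j b t)" "null (\<lambda>t. cstar_triple b j t)" "null (\<lambda>t. cstar_triple j t b)"
    and "null (\<lambda>t. cstar_triple b t j)" "null (\<lambda>t. cstar_triple t b j)" "null (\<lambda>t. cstar_triple t j b)"
  using assms by (simp_all add: J_def cstar_triple_commute[of b _ j] cstar_triple_commute[of _ b j]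
    cstar_triple_commute[of _ j b])

lemma closed_J: "closed J"
  unfolding closed_sequential_limits
proof (intro allI impI, elim conjE)
  fix a l assume "\<forall>n. a n \<in> J" and l: "a \<longlonglongrightarrow> l"
  then have a: "\<And>n. a n \<in> J" by blast
  have A: "\<And>n. a n \<in> A" using a J_A by blast
  show "l \<in> J"
    unfolding J_def
    using closed_sequentially[OF closed_A A l] null_limit[OF A l] J_null[OF a] by blast
qed

lemma subspace_J: "subspace J"
  unfolding subspace_def
proof (intro conjI ballI allI)
  have "cstar_triple 0 b = (\<lambda>t. 0)" "cstar_triple b 0 = (\<lambda>t. 0)" for b :: 'b by auto
  then show "0 \<in> J" by (simp add: J_def null_0)
next
  fix x y assume x: "x \<in> J" and y: "y \<in> J"
  have "null (\<lambda>t. cstar_triple (x + y) b t)" "null (\<lambda>t. cstar_triple b (x + y) t)"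
    "null (\<lambda>t. cstar_triple (x + y) t b)" if b: "b \<in> A" for b
    unfolding cstar_triple_add by (intro null_add J_null(1-3) x y b)+
  then show "x + y \<in> J" using J_A[OF x] J_A[OF y] unfolding J_def by simp
next
  fix r x assume x: "x \<in> J"
  have "null (\<lambda>t. cstar_triple (r *\<^sub>R x) b t)" "null (\<lambda>t. cstar_triple b (r *\<^sub>R x) t)"
    "null (\<lambda>t. cstar_triple (r *\<^sub>R x) t b)" if b: "b \<in> A" for b
    unfolding cstar_triple_scaleR by (intro null_scale J_null(1-3) x b)+
  then show "r *\<^sub>R x \<in> J" using J_A[OF x] unfolding J_def by simp
qed

text \<open>The Jordan identity writes each multiplication operator of {c,d,j} through operators of
  \<open>j\<close>, composed on the right with arbitrary operators and on the left only with
  multiplication operators, where nullness is known to persist.\<close>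

lemma J_outer:
  assumes c: "c \<in> A" and d: "d \<in> A" and j: "j \<in> J"
  shows "cstar_triple c d j \<in> J"
proof -
  have jA: "j \<in> A" by (rule J_A[OF j])
  show ?thesis
    unfolding J_def
  proof (intro CollectI conjI ballI)
    show "cstar_triple c d j \<in> A" using c d jA by simp
  next
    fix b assume b: "b \<in> A"
    have "cstar_triple (cstar_triple c d j) b t = cstar_triple c d (cstar_triple j b t)
        + cstar_triple j (cstar_triple d c b) t - cstar_triple j b (cstar_triple c d t)" for t
      using cstar_jordan_identity[of c d j b t] by (simp add: algebra_simps)
    then show "null (\<lambda>t. cstar_triple (cstar_triple c d j) b t)"
      using null_diff[OF null_add[OF null_outer[OF c d J_null(1)[OF j b]] J_null(1)[OF j triple_A[OF d c b]]] null_right[OF J_null(1)[OF j b] oper_outer[OF c d]]]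
      by simp
  next
    fix b assume b: "b \<in> A"
    have "cstar_triple b (cstar_triple c d j) t = cstar_triple (cstar_triple d c b) j t
        + cstar_triple b j (cstar_triple d c t) - cstar_triple d c (cstar_triple b j t)" for t
      using cstar_jordan_identity[of d c b j t] by (simp add: algebra_simps)
    then show "null (\<lambda>t. cstar_triple b (cstar_triple c d j) t)"
      using null_diff[OF null_add[OF J_null(2)[OF j triple_A[OF d c b]] null_right[OF J_null(2)[OF j b] oper_outer[OF d c]]] null_outer[OF d c J_null(2)[OF j b]]]
      by simp
  next
    fix b assume b: "b \<in> A"
    have "cstar_triple (cstar_triple c d j) t b = cstar_triple c d (cstar_triple j t b)
        + cstar_triple j (cstar_triple d c t) b - cstar_triple j t (cstar_triple c d b)" for t
      using cstar_jordan_identity[of c d j t b] by (simp add: algebra_simps)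
    then show "null (\<lambda>t. cstar_triple (cstar_triple c d j) t b)"
      using null_diff[OF null_add[OF null_outer[OF c d J_null(3)[OF j b]] null_right[OF J_null(3)[OF j b] oper_outer[OF d c]]] J_null(3)[OF j triple_A[OF c d b]]]
      by simp
  qed
qed

text \<open>The Jordan identity again, but the first two operators also involve those of {j,c,b}.
  That element is in \<open>J\<close> by \<open>J_outer\<close>, so the two lemmas cannot be proved
  in the other order.\<close>

lemma J_inner:
  assumes c: "c \<in> A" and d: "d \<in> A" and j: "j \<in> J"
  shows "cstar_triple c j d \<in> J"
proof -
  have jA: "j \<in> A" by (rule J_A[OF j])
  have jcb: "cstar_triple j c b \<in> J" if "b \<in> A" for b
    using J_outer[OF that c j] by (simp add: cstar_triple_commute[of j])
  show ?thesis
    unfolding J_def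
  proof (intro CollectI conjI ballI)
    show "cstar_triple c j d \<in> A" using c d jA by simp
  next
    fix b assume b: "b \<in> A"
    have "cstar_triple (cstar_triple c j d) b t = cstar_triple c j (cstar_triple d b t)
        + cstar_triple d (cstar_triple j c b) t - cstar_triple d b (cstar_triple c j t)" for t
      using cstar_jordan_identity[of c j d b t] by (simp add: algebra_simps)
    then show "null (\<lambda>t. cstar_triple (cstar_triple c j d) b t)"
      using null_diff[OF null_add[OF null_right[OF J_null(2)[OF j c] oper_outer[OF d b]] J_null(2)[OF jcb[OF b] d]] null_outer[OF d b J_null(2)[OF j c]]]
      by simp
  next
    fix b assume b: "b \<in> A"
    have "cstar_triple b (cstar_triple c j d) t = cstar_triple (cstar_triple j c b) d t
        + cstar_triple b d (cstar_triple j c t) - cstar_triple j c (cstar_triple b d t)" for t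
      using cstar_jordan_identity[of j c b d t] by (simp add: algebra_simps)
    then show "null (\<lambda>t. cstar_triple b (cstar_triple c j d) t)"
      using null_diff[OF null_add[OF J_null(1)[OF jcb[OF b] d] null_outer[OF b d J_null(1)[OF j c]]] null_right[OF J_null(1)[OF j c] oper_outer[OF b d]]]
      by simp
  next
    fix b assume b: "b \<in> A"
    have "cstar_triple (cstar_triple c j d) t b = cstar_triple d j (cstar_triple b t c)
        + cstar_triple c j (cstar_triple b t d) - cstar_triple c (cstar_triple j b t) d" for t
      using cstar_jordan_identity[of b t c j d]
      by (simp add: algebra_simps cstar_triple_commute[of "cstar_triple c j d" t b]
        cstar_triple_commute[of d j] cstar_triple_commute[of j b t])
    then show "null (\<lambda>t. cstar_triple (cstar_triple c j d) t b)"
      using null_diff[OF null_add[OF null_right[OF J_null(2)[OF j d] oper_inner[OF b c]] null_right[OF J_null(2)[OF j c] oper_inner[OF b d]]] null_inner[OF c d J_null(1)[OF j b]]]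
      by simp
  qed
qed

end

section \<open>From the triple ideal to a two-sided ideal\<close>

lemma scaleR_halves:
  fixes x w :: "'a::real_vector"
  shows "(1/4) *\<^sub>R x + (1/4) *\<^sub>R x = (1/2) *\<^sub>R x" "(1/4) *\<^sub>R x + ((1/4) *\<^sub>R x + w) = (1/2) *\<^sub>R x + w"
    "(1/2) *\<^sub>R x + (1/2) *\<^sub>R x = x" "(1/2) *\<^sub>R x + ((1/2) *\<^sub>R x + w) = x + w"
  unfolding add.assoc[symmetric] scaleR_left_distrib[symmetric] by simp_all

context triple_map
begin

text \<open>For orthogonal sequences only the operators {y,y,t} and {y,t,b} are shown to be null;
  {y,b,t} and {b,y,t} remain out of reach. For the cube {y,y,y}, all three kinds of operator factor
  through the two that are known.\<close>

lemma J_cube: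
  assumes y: "y \<in> A" "star y = y" and L: "null (\<lambda>t. cstar_triple y y t)"
    and Q: "\<And>b. b \<in> A \<Longrightarrow> null (\<lambda>t. cstar_triple y t b)"
  shows "y * y * y \<in> J"
proof -
  have cube: "y * y * y = cstar_triple y y y" by (simp add: cstar_triple_def y(2))
  have 1: "cstar_triple (y * y * y) b t = 2 *\<^sub>R cstar_triple y y (cstar_triple y b t)
      - cstar_triple y (cstar_triple y t b) y" for b t
    by (simp add: cstar_triple_def star_add star_mult star_star star_scaleR y(2) scaleR_halves algebra_simps)
  have 2: "cstar_triple b (y * y * y) t = 2 *\<^sub>R cstar_triple b y (cstar_triple y y t)
      - cstar_triple b (cstar_triple y t y) y" for b t
    by (simp add: cstar_triple_def star_add star_mult star_star star_scaleR y(2) scaleR_halves algebra_simps)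
  have 3: "cstar_triple (y * y * y) t b = cstar_triple y y (cstar_triple y t b)
      + cstar_triple y (cstar_triple y y t) b - cstar_triple y t (cstar_triple y y b)" for b t
    unfolding cube using cstar_jordan_identity[of y y y t b] by (simp add: algebra_simps)
  show ?thesis
    unfolding J_def
  proof (intro CollectI conjI ballI)
    show "y * y * y \<in> A" using y by simp
    fix b assume b: "b \<in> A"
    show "null (\<lambda>t. cstar_triple (y * y * y) b t)"
      unfolding 1
      using null_diff[OF null_scale[OF null_right[OF L oper_outer[OF y(1) b]], of 2] null_inner[OF y(1) y(1) Q[OF b]]]
      by simp
    show "null (\<lambda>t. cstar_triple b (y * y * y) t)"
      unfolding 2
      using null_diff[OF null_scale[OF null_outer[OF b y(1) L], of 2] null_inner[OF b y(1) Q[OF y(1)]]]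
      by simp
    show "null (\<lambda>t. cstar_triple (y * y * y) t b)"
      unfolding 3
      using null_diff[OF null_add[OF null_outer[OF y(1) y(1) Q[OF b]] null_right[OF Q[OF b] oper_outer[OF y(1) y(1)]]]
        Q[OF triple_A[OF y(1) y(1) b]]]
      by simp
  qed
qed

text \<open>In the absence of a unit, \<open>a\<close>, the one-sided products and
  \<open>b * a * c\<close> have to be listed separately.\<close>

definition two_sided :: "'b \<Rightarrow> bool" where
  "two_sided a \<longleftrightarrow> a \<in> J \<and> (\<forall>b\<in>A. b * a \<in> J \<and> a * b \<in> J) \<and> (\<forall>b\<in>A. \<forall>c\<in>A. b * a * c \<in> J)"

text \<open>The largest two-sided \<open>*\<close>-ideal contained in \<^term>\<open>J\<close>.\<close>

definition I :: "'b set" where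
  "I = {a. two_sided a \<and> two_sided (star a)}"

lemma I_J: "a \<in> I \<Longrightarrow> a \<in> J"
  by (simp add: I_def two_sided_def)

lemma I_A: "a \<in> I \<Longrightarrow> a \<in> A"
  by (rule J_A[OF I_J])

lemma I_star: "a \<in> I \<Longrightarrow> star a \<in> I"
  by (simp add: I_def star_star)

lemma two_sided_mult: "two_sided a \<Longrightarrow> b \<in> A \<Longrightarrow> two_sided (b * a) \<and> two_sided (a * b)"
  unfolding two_sided_def by (simp add: mult.assoc[symmetric]) (simp add: mult.assoc)

lemma I_mult: "a \<in> I \<Longrightarrow> b \<in> A \<Longrightarrow> b * a \<in> I" "a \<in> I \<Longrightarrow> b \<in> A \<Longrightarrow> a * b \<in> I"
  by (simp_all add: I_def two_sided_mult star_mult)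

lemma two_sided_add: "two_sided x \<Longrightarrow> two_sided y \<Longrightarrow> two_sided (x + y)"
  by (simp add: two_sided_def distrib_left distrib_right subspace_add[OF subspace_J])

lemma two_sided_scaleR: "two_sided x \<Longrightarrow> two_sided (r *\<^sub>R x)"
  by (simp add: two_sided_def subspace_scale[OF subspace_J])

lemma two_sided_0: "two_sided 0"
  by (simp add: two_sided_def subspace_0[OF subspace_J])

lemma subspace_I: "subspace I"
  by (auto simp: subspace_def I_def star_add star_scaleR two_sided_add two_sided_scaleR two_sided_0)

lemma closed_two_sided: "closed {a. two_sided a}"
  unfolding closed_sequential_limits
proof (intro allI impI, elim conjE)
  fix a l assume a: "\<forall>n. a n \<in> {a. two_sided a}" and l: "a \<longlonglongrightarrow> l"
  have J: "F l \<in> J" if F: "\<And>n. F (a n) \<in> J" "(\<lambda>n. F (a n)) \<longlonglongrightarrow> F l" for F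
    by (rule closed_sequentially[OF closed_J F])
  show "l \<in> {a. two_sided a}"
    using a unfolding two_sided_def
    by (auto intro!: J[of "\<lambda>x. x"] J[of "\<lambda>x. _ * x"] J[of "\<lambda>x. x * _"] J[of "\<lambda>x. _ * x * _"] tendsto_intros l)
qed

lemma closed_I: "closed I"
proof -
  have "I = {a. two_sided a} \<inter> star -` {a. two_sided a}" by (auto simp: I_def)
  moreover have "closed (star -` {a. two_sided a})"
    by (intro closed_vimage closed_two_sided continuous_intros)
  ultimately show ?thesis by (metis closed_Int closed_two_sided)
qed

text \<open>With v = y^3, the Jordan product a v + v a is 2 {a,y,y^2}, and the commutator a v - v a
  is c y^2 + y c y + y^2 c with c = a y - y a; both lie in \<open>J\<close>, hence so do a v and v
  a. For products on both sides, a y^7 b is the product (a v) y (v b): the triple 2 {a v, y, v b}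
  contains it together with v b y a v, and the latter is again a triple product with entries
  \<open>v\<close>. This is where 7 = 3 + 1 + 3 comes from.\<close>

lemma I_seventh_power:
  assumes y: "y \<in> J" "star y = y"
  shows "y * y * y * y * y * y * y \<in> I"
proof -
  have yA: "y \<in> A" by (rule J_A[OF y(1)])
  let ?v = "y * y * y"
  have v: "?v \<in> J"
    using J_outer[OF yA yA y(1)] by (simp add: cstar_triple_def y(2))
  have vs: "star ?v = ?v" by (simp add: star_mult y(2) mult.assoc)
  note J_lin = subspace_add[OF subspace_J] subspace_diff[OF subspace_J] subspace_scale[OF subspace_J]
  have comm: "a * ?v \<in> J \<and> ?v * a \<in> J" if a: "a \<in> A" for a
  proof -
    let ?s = "2 *\<^sub>R cstar_triple a y (y * y)" and ?c = "a * y - y * a"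
    let ?d = "2 *\<^sub>R cstar_triple ?c y y + cstar_triple y (star ?c) y"
    have c: "?c \<in> A" using a yA by simp
    have sJ: "?s \<in> J" using J_inner[OF a mult_A[OF yA yA] y(1)] by (intro J_lin)
    have "cstar_triple ?c y y \<in> J" "cstar_triple y (star ?c) y \<in> J"
      using J_outer[OF c yA y(1)] J_outer[OF yA star_A[OF c] y(1)] by auto
    then have dJ: "?d \<in> J" by (intro J_lin)
    have "?s = a * ?v + ?v * a" by (simp add: cstar_triple_def y(2) mult.assoc)
    moreover have "?d = a * ?v - ?v * a"
      by (simp add: cstar_triple_def y(2) star_star star_diff star_mult scaleR_halves algebra_simps)
    ultimately have "(1/2) *\<^sub>R (?s + ?d) = a * ?v" "(1/2) *\<^sub>R (?s - ?d) = ?v * a"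
      by (simp_all add: scaleR_2[symmetric])
    then show ?thesis using sJ dJ by (metis J_lin)
  qed
  let ?p = "y * y * y * y * y * y * y"
  have both: "a * ?p * b \<in> J" if a: "a \<in> A" and b: "b \<in> A" for a b
  proof -
    have "2 *\<^sub>R cstar_triple (a * ?v) y (?v * b) - cstar_triple ?v (star (b * y * a)) ?v \<in> J"
      using J_inner[of "a * ?v" "?v * b", OF _ _ y(1)] J_outer[of ?v "star (b * y * a)", OF _ _ v] a b yA
      by (intro J_lin) simp_all
    moreover have "2 *\<^sub>R cstar_triple (a * ?v) y (?v * b) - cstar_triple ?v (star (b * y * a)) ?v = a * ?p * b"
      by (simp add: cstar_triple_def y(2) star_star mult.assoc)
    ultimately show ?thesis by simp
  qed
  have "?p \<in> J"
    using J_inner[of ?v ?v, OF _ _ y(1)] yA by (simp add: cstar_triple_def y(2) mult.assoc scaleR_2[symmetric])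
  moreover have "a * ?p \<in> J \<and> ?p * a \<in> J" if a: "a \<in> A" for a
    using comm[of "a * y * y * y * y"] comm[of "y * y * y * y * a"] a yA by (simp add: mult.assoc)
  ultimately have "two_sided ?p" using both by (simp add: two_sided_def)
  moreover have "star ?p = ?p" by (simp add: star_mult y(2) mult.assoc)
  ultimately show ?thesis by (simp add: I_def)
qed

end

section \<open>The gliding hump\<close>

lemma not_bounded_over_large:
  assumes f: "real_linear_on S f" and S: "subspace S" and neg: "\<not> bounded_over S f" and e: "e > 0"
  shows "\<exists>r\<in>S. norm r \<le> e \<and> norm (f r) > B"
proof (rule ccontr)
  assume "\<not> ?thesis"
  then have *: "norm (f r) \<le> B" if "r \<in> S" "norm r \<le> e" for r
    using that by (meson not_le)
  have "norm (f t) \<le> (B / e) * norm t" if t: "t \<in> S" for t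
  proof (cases "t = 0")
    case False
    have "norm ((e / norm t) *\<^sub>R t) = e" using False e by simp
    then have "norm (f ((e / norm t) *\<^sub>R t)) \<le> B"
      by (intro * subspace_scale[OF S t]) simp
    moreover have "f ((e / norm t) *\<^sub>R t) = (e / norm t) *\<^sub>R f t"
      using f t unfolding real_linear_on_def by blast
    ultimately have "(e / norm t) * norm (f t) \<le> B" using e by simp
    then show ?thesis using e False by (simp add: field_simps)
  qed (simp add: real_linear_on_0[OF f S])
  then show False using neg bounded_overI[of S f] by blast
qed

text \<open>The starting index is kept so that the tail of a series with terms
  \<open>opcomp T 0 k (t k)\<close> can be factored through
  \<open>opcomp T 0 (Suc n)\<close>.\<close>

primrec opcomp :: "(nat \<Rightarrow> 'a \<Rightarrow> 'a) \<Rightarrow> nat \<Rightarrow> nat \<Rightarrow> 'a \<Rightarrow> 'a" where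
  "opcomp T n 0 t = t"
| "opcomp T n (Suc k) t = opcomp T n k (T (n + k) t)"

lemma opcomp_add: "opcomp T m (n + k) t = opcomp T m n (opcomp T (m + n) k t)"
  by (induction k arbitrary: t) (simp_all add: add.assoc)

context triple_map
begin

lemma oper_opcomp: "(\<And>n. oper (T n)) \<Longrightarrow> oper (opcomp T n k)"
proof (induction k)
  case 0
  then show ?case by (simp add: oper_def bounded_linear_ident)
next
  case (Suc k)
  have "oper (\<lambda>t. opcomp T n k (T (n + k) t))" by (rule oper_comp[OF Suc.IH[OF Suc.prems] Suc.prems])
  then show ?case by simp
qed

text \<open>
  With \<open>V\<^sub>n = T\<^sub>0 \<dots> T\<^bsub>n-1\<^esub>\<close>, a sum \<open>\<Sum> V\<^sub>k t\<^sub>k\<close> with \<open>t\<^sub>k\<close> small but \<open>\<delta> (D\<^sub>k V\<^sub>k t\<^sub>k)\<close> huge cannot have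
  an image under \<open>\<delta>\<close>: composing with \<open>D\<^sub>n\<close> annihilates, up to a bounded error, all terms beyond the \<open>n\<close>-th.
\<close>

lemma gliding_hump:
  assumes T: "\<And>n. oper (T n)" and D: "\<And>n. oper (D n)"
    and intertwined: "\<And>n. \<exists>D'. bounded_linear D' \<and> bounded_over A (\<lambda>t. \<delta> (D n t) - D' (\<delta> t))"
    and null: "\<And>n. null (\<lambda>t. D n (opcomp T 0 (Suc n) t))"
  shows "\<exists>n. null (\<lambda>t. D n (opcomp T 0 n t))"
proof (rule ccontr)
  assume neg: "\<not> ?thesis"
  let ?V = "opcomp T 0"
  have V: "oper (opcomp T n k)" for n k by (rule oper_opcomp[OF T])
  have DV: "oper (\<lambda>t. D n (?V k t))" for n k by (rule oper_comp[OF D V])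
  have "\<exists>\<tau>\<ge>1. \<forall>t. norm (T n t) \<le> \<tau> * norm t" for n
  proof -
    obtain K where K: "\<And>t. norm (T n t) \<le> norm t * K"
      using T[of n] bounded_linear.bounded unfolding oper_def by blast
    have "norm (T n t) \<le> max K 1 * norm t" for t
      by (rule order.trans[OF K]) (simp add: mult.commute[of "norm t"] mult_right_mono)
    then show ?thesis by (intro exI[of _ "max K 1"]) simp
  qed
  then obtain \<tau> where \<tau>: "\<And>n. \<tau> n \<ge> 1" "\<And>n t. norm (T n t) \<le> \<tau> n * norm t" by metis
  define \<pi> where "\<pi> n = (\<Prod>i<n. \<tau> i)" for n
  have \<pi>: "\<pi> n \<ge> 1" for n unfolding \<pi>_def by (intro prod_ge_1) (use \<tau> in auto)
  have norm_V: "norm (opcomp T n k t) \<le> \<pi> (n + k) * norm t" for n k t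
  proof (induction k arbitrary: t)
    case 0
    then show ?case using mult_right_mono[OF \<pi>[of n], of "norm t"] by simp
  next
    case (Suc k)
    have "norm (opcomp T n (Suc k) t) \<le> \<pi> (n + k) * norm (T (n + k) t)" using Suc by simp
    also have "\<dots> \<le> \<pi> (n + k) * (\<tau> (n + k) * norm t)"
      using \<pi>[of "n + k"] by (intro mult_left_mono \<tau>) simp
    finally show ?case by (simp add: \<pi>_def mult_ac)
  qed
  have "\<exists>d\<ge>1. \<forall>t\<in>A. norm (\<delta> (D n t)) \<le> d * (norm (\<delta> t) + norm t)" for n
  proof -
    obtain D' where D': "bounded_linear D'" "bounded_over A (\<lambda>t. \<delta> (D n t) - D' (\<delta> t))"
      using intertwined by blast
    obtain K where K: "\<And>x. norm (D' x) \<le> norm x * K" using bounded_linear.bounded[OF D'(1)] by blast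
    obtain C where C: "C \<ge> 0" "\<And>t. t \<in> A \<Longrightarrow> norm (\<delta> (D n t) - D' (\<delta> t)) \<le> C * norm t"
      using bounded_overE[OF D'(2)] by blast
    define d where "d = max 1 (max C K)"
    have "norm (\<delta> (D n t)) \<le> d * (norm (\<delta> t) + norm t)" if t: "t \<in> A" for t
    proof -
      have "norm (\<delta> (D n t)) \<le> norm (D' (\<delta> t)) + norm (\<delta> (D n t) - D' (\<delta> t))"
        using norm_triangle_ineq[of "D' (\<delta> t)" "\<delta> (D n t) - D' (\<delta> t)"] by simp
      also have "\<dots> \<le> norm (\<delta> t) * K + C * norm t" by (intro add_mono K C t)
      also have "\<dots> \<le> norm (\<delta> t) * d + d * norm t"
        by (intro add_mono mult_left_mono mult_right_mono) (auto simp: d_def)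
      finally show ?thesis by (simp add: algebra_simps)
    qed
    then show ?thesis by (intro exI[of _ d]) (simp add: d_def)
  qed
  then obtain d where d: "\<And>n. d n \<ge> 1" "\<And>n t. t \<in> A \<Longrightarrow> norm (\<delta> (D n t)) \<le> d n * (norm (\<delta> t) + norm t)"
    by metis
  have "\<exists>\<kappa>\<ge>0. \<forall>t\<in>A. norm (\<delta> (D n (?V (Suc n) t))) \<le> \<kappa> * norm t" for n
  proof -
    have "bounded_over A (\<lambda>t. \<delta> (D n (?V (Suc n) t)))" using null[of n] unfolding null_def by blast
    then show ?thesis by (rule bounded_overE) blast
  qed
  then obtain \<kappa> where \<kappa>: "\<And>n. \<kappa> n \<ge> 0" "\<And>n t. t \<in> A \<Longrightarrow> norm (\<delta> (D n (?V (Suc n) t))) \<le> \<kappa> n * norm t"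
    by metis
  \<comment> \<open>Dividing by \<open>\<pi> n\<close>, a bound for the norm of the first n
    operators composed, makes the series converge geometrically. The lower bound pays for the
    earlier terms, for the tail (\<open>\<kappa> n\<close>) and for the norm of \<open>D n\<close>
    on the module side (\<open>d n\<close>), and still leaves a multiple n of
    \<open>d n\<close>.\<close>
  define P where "P f n r \<longleftrightarrow> r \<in> A \<and> norm r \<le> (1/2) ^ n / \<pi> n \<and>
    norm (\<delta> (D n (?V n r))) > n * d n + (\<Sum>k<n. norm (\<delta> (D n (?V k (f k))))) + \<kappa> n" for f n r
  have "\<exists>t. \<forall>n. P t n (t n)"
  proof (rule dependent_wellorder_choice)
    show "P f n r = P g n r" if "\<And>k. k < n \<Longrightarrow> f k = g k" for r f g n
      using that by (simp add: P_def)
    show "\<exists>r. P f n r" for f n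
    proof -
      have l: "linear (\<lambda>t. D n (?V n t))"
        using DV[of n n] by (simp add: oper_def bounded_linear.linear)
      have lin: "real_linear_on A (\<lambda>t. \<delta> (D n (?V n t)))"
        unfolding real_linear_on_def
        using oper_mem[OF DV[of n n]] linear_add[OF l] linear_cmul[OF l] by (simp add: \<delta>_add \<delta>_scale)
      have "\<not> bounded_over A (\<lambda>t. \<delta> (D n (?V n t)))"
        using neg DV[of n n] unfolding null_def by blast
      from not_bounded_over_large[OF lin subspace_A this, of "(1/2) ^ n / \<pi> n"
          "n * d n + (\<Sum>k<n. norm (\<delta> (D n (?V k (f k))))) + \<kappa> n"]
      show ?thesis using \<pi>[of n] unfolding P_def by force
    qed
  qed
  then obtain t where t: "\<And>n. t n \<in> A" "\<And>n. norm (t n) \<le> (1/2) ^ n / \<pi> n"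
    and big: "\<And>n. norm (\<delta> (D n (?V n (t n)))) > n * d n + (\<Sum>k<n. norm (\<delta> (D n (?V k (t k))))) + \<kappa> n"
    unfolding P_def by blast
  have small: "norm (opcomp T n k (t (n + k))) \<le> (1/2) ^ (n + k)" for n k
  proof -
    have "\<pi> (n + k) > 0" using \<pi>[of "n + k"] by linarith
    then have "\<pi> (n + k) * norm (t (n + k)) \<le> (1/2) ^ (n + k)"
      using t(2)[of "n + k"] by (simp add: pos_le_divide_eq mult.commute)
    then show ?thesis using norm_V[of n k "t (n + k)"] by linarith
  qed
  have summable: "summable (\<lambda>k. opcomp T n k (t (n + k)))" for n
  proof (rule summable_comparison_test'[where N = 0])
    show "summable (\<lambda>k. (1/2::real) ^ k)" by (rule summable_geometric) simp
    fix k :: nat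
    have "(1/2::real) ^ (n + k) \<le> (1/2) ^ k" by (rule power_decreasing) auto
    then show "norm (opcomp T n k (t (n + k))) \<le> (1/2) ^ k" using small[of n k] by linarith
  qed
  define z where "z n = (\<Sum>k. opcomp T n k (t (n + k)))" for n
  have zA: "z n \<in> A" for n
  proof -
    have "(\<lambda>m. \<Sum>k<m. opcomp T n k (t (n + k))) \<longlonglongrightarrow> z n"
      using summable_LIMSEQ[OF summable] by (simp add: z_def)
    moreover have "(\<Sum>k<m. opcomp T n k (t (n + k))) \<in> A" for m
      by (rule subspace_sum[OF subspace_A]) (rule oper_mem[OF V t(1)])
    ultimately show ?thesis
      by (rule closed_sequentially[OF closed_A, rotated])
  qed
  have norm_z: "norm (z (Suc n)) \<le> 1" for n
  proof -
    have "norm (z (Suc n)) \<le> (\<Sum>k. (1/2::real) ^ Suc k)"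
      unfolding z_def
    proof (rule norm_suminf_le)
      fix k
      have "(1/2::real) ^ (Suc n + k) \<le> (1/2) ^ Suc k" by (rule power_decreasing) auto
      then show "norm (opcomp T (Suc n) k (t (Suc n + k))) \<le> (1/2) ^ Suc k" using small[of "Suc n" k] by linarith
      show "summable (\<lambda>k. (1/2::real) ^ Suc k)" using power_half_series by (rule sums_summable)
    qed
    then show ?thesis using sums_unique[OF power_half_series] by simp
  qed
  let ?c = "z 0"
  \<comment> \<open>The whole tail is one value of \<open>?V (Suc n)\<close>, and composing that
    with \<open>D n\<close> is null; as \<open>z (Suc n)\<close> has norm at most 1, the tail
    contributes at most \<open>\<kappa> n\<close>.\<close>
  have split: "?c = (\<Sum>k<n. ?V k (t k)) + ?V n (t n) + ?V (Suc n) (z (Suc n))" for n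
  proof -
    have "?c = (\<Sum>k. ?V (k + Suc n) (t (k + Suc n))) + (\<Sum>k<Suc n. ?V k (t k))"
      unfolding z_def using suminf_split_initial_segment[OF summable[of 0], of "Suc n"] by simp
    also have "(\<Sum>k. ?V (k + Suc n) (t (k + Suc n))) = (\<Sum>k. ?V (Suc n) (opcomp T (Suc n) k (t (Suc n + k))))"
      using opcomp_add[of T 0 "Suc n"] by (simp only: add.commute[of _ "Suc n"] add_0 add_0_right)
    also have "\<dots> = ?V (Suc n) (z (Suc n))"
      unfolding z_def using V[of 0 "Suc n"] unfolding oper_def
      by (intro bounded_linear.suminf[symmetric] summable) (elim conjE)
    finally show ?thesis by (simp add: add_ac)
  qed
  have "real n \<le> norm (\<delta> ?c) + norm ?c" for n
  proof -
    have lin: "linear (D n)" using D[of n] by (simp add: oper_def bounded_linear.linear)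
    have mem: "D n (?V k x) \<in> A" if "x \<in> A" for k x by (rule oper_mem[OF DV that])
    have "D n ?c = (\<Sum>k<n. D n (?V k (t k))) + D n (?V n (t n)) + D n (?V (Suc n) (z (Suc n)))"
      unfolding split[of n] using lin by (simp add: linear_add linear_sum)
    then have "\<delta> (D n ?c) = (\<Sum>k<n. \<delta> (D n (?V k (t k)))) + \<delta> (D n (?V n (t n))) + \<delta> (D n (?V (Suc n) (z (Suc n))))"
      using mem[OF t(1)] mem[OF zA] by (simp only: \<delta>_add \<delta>_sum add_A subspace_sum[OF subspace_A])
    then have "norm (\<delta> (D n (?V n (t n)))) \<le> norm (\<delta> (D n ?c)) + norm (\<Sum>k<n. \<delta> (D n (?V k (t k))))
        + norm (\<delta> (D n (?V (Suc n) (z (Suc n)))))"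
      using norm_triangle_ineq4[of "\<delta> (D n ?c) - (\<Sum>k<n. \<delta> (D n (?V k (t k))))" "\<delta> (D n (?V (Suc n) (z (Suc n))))"]
        norm_triangle_ineq4[of "\<delta> (D n ?c)" "\<Sum>k<n. \<delta> (D n (?V k (t k)))"] by (simp add: algebra_simps)
    moreover have "norm (\<Sum>k<n. \<delta> (D n (?V k (t k)))) \<le> (\<Sum>k<n. norm (\<delta> (D n (?V k (t k)))))"
      by (rule norm_sum)
    moreover have "norm (\<delta> (D n (?V (Suc n) (z (Suc n))))) \<le> \<kappa> n"
      using \<kappa>(2)[OF zA, of n "Suc n"] mult_left_mono[OF norm_z \<kappa>(1), of n n] by linarith
    moreover have "norm (\<delta> (D n ?c)) \<le> d n * (norm (\<delta> ?c) + norm ?c)" by (rule d(2)[OF zA])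
    ultimately have "d n * n \<le> d n * (norm (\<delta> ?c) + norm ?c)" using big[of n] by (simp add: mult.commute)
    then show ?thesis using d(1)[of n] by (simp add: mult_le_cancel_left)
  qed
  then show False using reals_Archimedean2[of "norm (\<delta> ?c) + norm ?c"] by (meson not_le)
qed

end

section \<open>Cutting off orthogonal elements\<close>

text \<open>This is (1 - g^2) t (1 - g^2), expanded because there may be no 1.\<close>

definition complement :: "'a::cstar_algebra \<Rightarrow> 'a \<Rightarrow> 'a" where
  "complement g t = t - g * g * t - t * (g * g) + g * g * t * (g * g)"

lemma bounded_linear_complement: "bounded_linear (complement g)"
  unfolding complement_def
  by (intro bounded_linear_add bounded_linear_sub bounded_linear_ident bounded_linear_mult_right
      bounded_linear_mult_left bounded_linear_compose[OF bounded_linear_mult_left bounded_linear_mult_right])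

text \<open>For \<open>y\<close> orthogonal to \<open>g\<close>, cutting off \<open>g\<close> does
  nothing if the other outer argument is orthogonal to \<open>g\<close> as well. Otherwise the
  change factors through {y,t,g}, so its nullness depends on that single operator.\<close>

lemma complement_triples:
  fixes y g :: "'a::cstar_algebra"
  assumes g: "star g = g" and y: "star y = y" and yg: "y * g = 0" "g * y = 0"
  shows "k * g = 0 \<Longrightarrow> g * k = 0 \<Longrightarrow> cstar_triple y (complement g t) k = cstar_triple y t k"
    and "cstar_triple y (complement g t) b = cstar_triple y t b - 2 *\<^sub>R cstar_triple b g (cstar_triple y t g)"
    and "cstar_triple y y (complement g t) = cstar_triple y y t - 2 *\<^sub>R cstar_triple y (cstar_triple y t g) g"
proof -
  have *: "y * (g * z) = 0" "g * (y * z) = 0" for z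
    using yg by (simp_all add: mult.assoc[symmetric])
  show "cstar_triple y (complement g t) k = cstar_triple y t k" if k: "k * g = 0" "g * k = 0"
  proof -
    have "k * (g * z) = 0" "g * (k * z) = 0" for z
      using k by (simp_all add: mult.assoc[symmetric])
    then show ?thesis
      by (simp add: cstar_triple_def complement_def star_add star_diff star_mult g algebra_simps yg * k)
  qed
  show "cstar_triple y (complement g t) b = cstar_triple y t b - 2 *\<^sub>R cstar_triple b g (cstar_triple y t g)"
    by (simp add: cstar_triple_def complement_def star_add star_diff star_mult g algebra_simps yg *)
  show "cstar_triple y y (complement g t) = cstar_triple y y t - 2 *\<^sub>R cstar_triple y (cstar_triple y t g) g"
    by (simp add: cstar_triple_def g y complement_def star_add star_mult star_scaleR
      star_star scaleR_halves algebra_simps yg *)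
qed

lemma complement_triples_unit:
  fixes y g :: "'a::cstar_algebra"
  assumes g: "star g = g" and y: "star y = y" and gy: "g * g * y = y"
  shows "cstar_triple y (complement g t) k = 0" "cstar_triple y y (complement g t) = 0"
proof -
  have "star (g * g * y) = star y" using gy by simp
  then have yg: "y * (g * g) = y" by (simp add: star_mult g y mult.assoc)
  have *: "g * (g * y) = y" "y * (g * (g * z)) = y * z" "g * (g * (y * z)) = y * z" for z
    using gy yg by (simp_all add: mult.assoc[symmetric])
  show "cstar_triple y (complement g t) k = 0" "cstar_triple y y (complement g t) = 0"
    by (simp_all add: cstar_triple_def complement_def star_add star_diff star_mult g y algebra_simps yg *)
qed

context triple_map
begin

lemma oper_complement: "g \<in> A \<Longrightarrow> oper (complement g)"
  by (simp add: oper_def bounded_linear_complement) (simp add: complement_def)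

lemma outer_intertwined:
  "a \<in> A \<Longrightarrow> b \<in> A \<Longrightarrow> \<exists>D'. bounded_linear D' \<and> bounded_over A (\<lambda>t. \<delta> (cstar_triple a b t) - D' (\<delta> t))"
  using outer_bounded outer_defect by blast

lemma inner_intertwined:
  "a \<in> A \<Longrightarrow> b \<in> A \<Longrightarrow> \<exists>D'. bounded_linear D' \<and> bounded_over A (\<lambda>t. \<delta> (cstar_triple a t b) - D' (\<delta> t))"
  using inner_bounded inner_defect by blast

text \<open>
  The two cases of the proof: either some \<open>g v\<close> is joined to infinitely many \<open>y n\<close> by an operator
  \<open>{y n, \<cdot>, g v}\<close> that is not null, or, along a subsequence, cutting off finitely many
  \<open>g i\<close> changes the multiplication operators of \<open>y n\<close> only by null operators.
\<close>

lemma orthogonal_null: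
  assumes A: "\<And>n. y n \<in> A" "\<And>n. g n \<in> A" and sa: "\<And>n. star (y n) = y n" "\<And>n. star (g n) = g n"
    and gy: "\<And>n. g n * g n * y n = y n" and orth: "\<And>m n. m \<noteq> n \<Longrightarrow> g m * y n = 0" "\<And>m n. m \<noteq> n \<Longrightarrow> g m * g n = 0"
  shows "\<exists>n::nat. null (\<lambda>t. cstar_triple (y n) (y n) t) \<and> (\<forall>b\<in>A. null (\<lambda>t. cstar_triple (y n) t b))"
proof (rule ccontr)
  assume neg: "\<not> ?thesis"
  have orth': "y n * g m = 0" if "m \<noteq> n" for m n
  proof -
    have "star (g m * y n) = 0" using orth(1)[OF that] by simp
    then show ?thesis by (simp add: star_mult sa)
  qed
  let ?K = "\<lambda>n v t. cstar_triple (y n) t (g v)"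
  show False
  proof (cases "\<exists>v. infinite {n. \<not> null (?K n v)}")
    case True
    then obtain v where "infinite {n. \<not> null (?K n v)}" by blast
    \<comment> \<open>With \<open>v\<close> itself removed, each cut \<open>g (r i)\<close> is
      orthogonal to \<open>g v\<close>, so the cuts before the n-th leave \<open>?D n\<close>
      unchanged while the n-th annihilates it.\<close>
    then have "infinite ({n. \<not> null (?K n v)} - {v})" by simp
    from infinite_enumerate[OF this] obtain r :: "nat \<Rightarrow> nat"
      where r: "strict_mono r" "\<And>n. r n \<in> {n. \<not> null (?K n v)} - {v}" by blast
    let ?T = "\<lambda>n. complement (g (r n))" and ?D = "\<lambda>n. ?K (r n) v"
    have inj: "r i \<noteq> r n" if "i \<noteq> n" for i n using r(1) that by (simp add: strict_mono_eq)
    have other: "?D n (?T i t) = ?D n t" if "i \<noteq> n" for i n t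
      using r(2)[of i] inj[OF that]
      by (intro complement_triples(1)) (auto simp: sa orth orth')
    have prefix: "?D n (opcomp ?T 0 k t) = ?D n t" if "k \<le> n" for n k t
      using that by (induction k arbitrary: t) (simp_all add: other)
    have "\<exists>n. null (\<lambda>t. ?D n (opcomp ?T 0 n t))"
    proof (rule gliding_hump)
      show "null (\<lambda>t. ?D n (opcomp ?T 0 (Suc n) t))" for n
        using complement_triples_unit(1)[OF sa(2) sa(1) gy] by (simp add: prefix null_0)
    qed (auto intro: oper_complement oper_inner inner_intertwined A)
    then show False using r(2) by (simp add: prefix)
  next
    case False
    have "\<exists>e. \<forall>n\<ge>e. null (?K n v)" for v
    proof -
      obtain e where "\<forall>n\<in>{n. \<not> null (?K n v)}. n < e"
        using False unfolding finite_nat_set_iff_bounded by blast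
      then show ?thesis by (intro exI[of _ e]) (auto simp: not_less[symmetric])
    qed
    then obtain e where e: "\<And>v n. n \<ge> e v \<Longrightarrow> null (?K n v)" by metis
    \<comment> \<open>The sum dominates every threshold \<open>e i\<close> with
      \<open>i \<le> m\<close>, so each new index lies beyond the thresholds of all earlier
      ones.\<close>
    define r where "r = rec_nat 0 (\<lambda>_ m. Suc m + (\<Sum>i\<le>m. e i))"
    have r_Suc: "r (Suc n) = Suc (r n) + (\<Sum>i\<le>r n. e i)" for n by (simp add: r_def)
    have mono: "strict_mono r" by (rule strict_monoI_Suc) (simp add: r_Suc)
    have joined: "null (?K (r n) (r i))" if "i < n" for i n
    proof -
      obtain m where n: "n = Suc m" using \<open>i < n\<close> by (cases n) auto
      then have "r i \<le> r m" using that mono by (simp add: strict_mono_less_eq)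
      then have "e (r i) \<le> (\<Sum>i\<le>r m. e i)" by (intro member_le_sum) auto
      then show ?thesis by (intro e) (simp add: n r_Suc)
    qed
    have "\<forall>n. \<exists>D. \<not> null D \<and> (D = (\<lambda>t. cstar_triple (y (r n)) (y (r n)) t) \<or>
        (\<exists>b\<in>A. D = (\<lambda>t. cstar_triple (y (r n)) t b)))"
      using neg by blast
    then obtain D where D: "\<And>n. \<not> null (D n)"
      and D_eq: "\<And>n. D n = (\<lambda>t. cstar_triple (y (r n)) (y (r n)) t) \<or> (\<exists>b\<in>A. D n = (\<lambda>t. cstar_triple (y (r n)) t b))"
      by metis
    let ?T = "\<lambda>n. complement (g (r n))"
    have operD: "oper (D n)" for n using D_eq[of n] oper_outer[OF A(1) A(1), of "r n" "r n"] oper_inner[OF A(1), of _ "r n"]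
      by (elim disjE bexE) simp_all
    \<comment> \<open>Here an earlier cut may alter \<open>D n\<close>, but only by an operator that
      factors through \<open>?K (r n) (r i)\<close>, which is null by the choice of
      \<open>r\<close>.\<close>
    have step: "null (\<lambda>t. D n (?T i t) - D n t)" if "i < n" for i n
    proof -
      have ne: "r i \<noteq> r n" using mono that by (simp add: strict_mono_eq)
      note rel = sa(2)[of "r i"] sa(1)[of "r n"] orth'[OF ne] orth(1)[OF ne]
      have N: "null (?K (r n) (r i))" by (rule joined[OF that])
      consider "D n = (\<lambda>t. cstar_triple (y (r n)) (y (r n)) t)"
        | b where "b \<in> A" "D n = (\<lambda>t. cstar_triple (y (r n)) t b)" using D_eq[of n] by blast
      then show ?thesis
      proof cases
        case 1
        have "D n (?T i t) - D n t = (- 2) *\<^sub>R cstar_triple (y (r n)) (?K (r n) (r i) t) (g (r i))" for t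
          unfolding 1 complement_triples(3)[OF rel] by simp
        then show ?thesis using null_scale[OF null_inner[OF A N], of "-2"] by simp
      next
        case 2
        have "D n (?T i t) - D n t = (- 2) *\<^sub>R cstar_triple b (g (r i)) (?K (r n) (r i) t)" for t
          unfolding 2 complement_triples(2)[OF rel] by simp
        then show ?thesis using null_scale[OF null_outer[OF 2(1) A(2) N], of "-2"] by simp
      qed
    qed
    have prefix: "null (\<lambda>t. D n (opcomp ?T 0 k t) - D n t)" if "k \<le> n" for n k
      using that
    proof (induction k)
      case 0
      then show ?case by (simp add: null_0)
    next
      case (Suc k)
      have "null (\<lambda>t. (D n (opcomp ?T 0 k (?T k t)) - D n (?T k t)) + (D n (?T k t) - D n t))"
        by (rule null_add[OF null_right[OF Suc.IH oper_complement[OF A(2)]] step]) (use Suc.prems in auto)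
      then show ?case by simp
    qed
    have kill: "D n (?T n t) = 0" for n t
      using D_eq[of n] complement_triples_unit[OF sa(2)[of "r n"] sa(1)[of "r n"] gy[of "r n"]] by auto
    have "\<exists>n. null (\<lambda>t. D n (opcomp ?T 0 n t))"
    proof (rule gliding_hump)
      show "null (\<lambda>t. D n (opcomp ?T 0 (Suc n) t))" for n
        using null_right[OF prefix[of n n] oper_complement[OF A(2), of "r n"]] by (simp add: kill)
      show "\<exists>D'. bounded_linear D' \<and> bounded_over A (\<lambda>t. \<delta> (D n t) - D' (\<delta> t))" for n
        using D_eq[of n] outer_intertwined[OF A(1) A(1), of "r n" "r n"] inner_intertwined[OF A(1), of _ "r n"]
        by (elim disjE bexE) simp_all
    qed (auto intro: oper_complement A operD)
    then obtain n where "null (\<lambda>t. D n (opcomp ?T 0 n t))" by blast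
    from null_diff[OF this prefix[of n n]] have "null (D n)" by simp
    then show False using D by blast
  qed
qed

end

section \<open>Factorization in ideals\<close>

lemma c0fun_const_mult [intro]: "c0fun f \<Longrightarrow> c0fun (\<lambda>t. r * f t)"
  and c0fun_zero [intro]: "c0fun (\<lambda>t. 0)"
  by (auto simp: c0fun_def intro!: continuous_intros)

lemma c0fun_sum [intro]: "(\<And>i. i \<in> S \<Longrightarrow> c0fun (f i)) \<Longrightarrow> c0fun (\<lambda>t. \<Sum>i\<in>S. f i t)"
  by (induction S rule: infinite_finite_induct) auto

lemma fcalc_zero: "star h = h \<Longrightarrow> fcalc h (\<lambda>t. 0) = 0"
  using fcalc_scale[of h "\<lambda>t. 0" 0] by (simp add: c0fun_zero)

lemma fcalc_sum:
  assumes "star h = h" "\<And>i. i \<in> S \<Longrightarrow> c0fun (f i)"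
  shows "fcalc h (\<lambda>t. \<Sum>i\<in>S. f i t) = (\<Sum>i\<in>S. fcalc h (f i))"
  using assms(2)
  by (induction S rule: infinite_finite_induct) (simp_all add: assms(1) fcalc_zero fcalc_add c0fun_sum)

text \<open>With k = a* a, the C*-identity turns the squared norm of a f(k) into the norm of k
  f(k)^2.\<close>

lemma norm_mult_fcalc:
  fixes a :: "'a::cstar_algebra"
  assumes f: "c0fun f" and B: "\<And>t. \<bar>t\<bar> \<le> norm (star a * a) + 1 \<Longrightarrow> \<bar>t * (f t * f t)\<bar> \<le> B"
  shows "(norm (a * fcalc (star a * a) f))\<^sup>2 \<le> B"
proof -
  let ?k = "star a * a"
  have k: "star ?k = ?k" by (simp add: star_mult star_star)
  have ff: "c0fun (\<lambda>t. f t * f t)" and tff: "c0fun (\<lambda>t. t * (f t * f t))"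
    using f by (auto simp: c0fun_def intro!: continuous_intros)
  have "star (a * fcalc ?k f) * (a * fcalc ?k f) = ?k * (fcalc ?k f * fcalc ?k f)"
    using fcalc_commute[OF k f, of ?k] by (simp add: star_mult fcalc_star[OF k f] mult.assoc[symmetric])
  also have "\<dots> = fcalc ?k (\<lambda>t. t * (f t * f t))"
    using fcalc_mult[OF k f f] fcalc_mult[OF k c0fun_id ff] by (simp add: fcalc_id[OF k])
  finally have "(norm (a * fcalc ?k f))\<^sup>2 = norm (fcalc ?k (\<lambda>t. t * (f t * f t)))"
    by (metis cstar_identity)
  also have "\<dots> \<le> B" by (rule fcalc_norm_le[OF k tff B])
  finally show ?thesis .
qed

text \<open>The same computation for a (1 - f(k)). As 1 - f does not vanish at 0, it has no
  functional calculus of its own and the square is multiplied out.\<close>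

lemma norm_diff_mult_fcalc:
  fixes a :: "'a::cstar_algebra"
  assumes f: "c0fun f" and B: "\<And>t. \<bar>t\<bar> \<le> norm (star a * a) + 1 \<Longrightarrow> \<bar>t * ((1 - f t) * (1 - f t))\<bar> \<le> B"
  shows "(norm (a - a * fcalc (star a * a) f))\<^sup>2 \<le> B"
proof -
  let ?k = "star a * a" and ?x = "fcalc (star a * a) f"
  have k: "star ?k = ?k" by (simp add: star_mult star_star)
  have tf: "c0fun (\<lambda>t. t * f t)" and tff: "c0fun (\<lambda>t. t * f t * f t)"
    using f by (auto simp: c0fun_def intro!: continuous_intros)
  have comm: "?x * ?k = ?k * ?x" using fcalc_commute[OF k f, of ?k] by simp
  have e1: "fcalc ?k (\<lambda>t. t * f t) = ?k * ?x"
    using fcalc_mult[OF k c0fun_id f] by (simp add: fcalc_id[OF k])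
  have e2: "fcalc ?k (\<lambda>t. t * f t * f t) = ?k * ?x * ?x"
    using fcalc_mult[OF k tf f] by (simp add: e1)
  have xa: "star (a * ?x) = ?x * star a" by (simp add: star_mult fcalc_star[OF k f])
  have "star (a - a * ?x) * (a - a * ?x) = ?k - ?k * ?x - ?x * ?k + ?x * ?k * ?x"
    unfolding star_diff xa by (simp add: left_diff_distrib right_diff_distrib mult.assoc)
  also have "\<dots> = (?k - ?k * ?x) - (?k * ?x - ?k * ?x * ?x)" unfolding comm by simp
  also have "\<dots> = fcalc ?k (\<lambda>t. (t - t * f t) - (t * f t - t * f t * f t))"
    by (subst fcalc_diff[OF k c0fun_diff[OF c0fun_id tf] c0fun_diff[OF tf tff]],
        subst fcalc_diff[OF k c0fun_id tf], subst fcalc_diff[OF k tf tff], simp only: e1 e2 fcalc_id[OF k])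
  also have "(\<lambda>t. (t - t * f t) - (t * f t - t * f t * f t)) = (\<lambda>t. t * ((1 - f t) * (1 - f t)))"
    by (intro ext) (simp add: algebra_simps)
  finally have "(norm (a - a * ?x))\<^sup>2 = norm (fcalc ?k (\<lambda>t. t * ((1 - f t) * (1 - f t))))"
    by (metis cstar_identity)
  also have "\<dots> \<le> B"
  proof (rule fcalc_norm_le[OF k _ B])
    show "c0fun (\<lambda>t. t * ((1 - f t) * (1 - f t)))"
      using f by (auto simp: c0fun_def intro!: continuous_intros)
  qed
  finally show ?thesis .
qed

locale cstar_ideal = real_cstar A for A :: "'b::cstar_algebra set" +
  fixes I :: "'b set"
  assumes ideal_closed: "closed I" and ideal_subspace: "subspace I" and ideal_A: "x \<in> I \<Longrightarrow> x \<in> A"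
    and ideal_star: "x \<in> I \<Longrightarrow> star x \<in> I"
    and ideal_left: "x \<in> I \<Longrightarrow> a \<in> A \<Longrightarrow> a * x \<in> I" and ideal_right: "x \<in> I \<Longrightarrow> a \<in> A \<Longrightarrow> x * a \<in> I"
begin

lemma ideal_0 [simp]: "0 \<in> I"
  and ideal_add: "x \<in> I \<Longrightarrow> y \<in> I \<Longrightarrow> x + y \<in> I"
  and ideal_diff: "x \<in> I \<Longrightarrow> y \<in> I \<Longrightarrow> x - y \<in> I"
  and ideal_scaleR: "x \<in> I \<Longrightarrow> r *\<^sub>R x \<in> I"
  and ideal_minus: "x \<in> I \<Longrightarrow> - x \<in> I"
  and ideal_sum: "(\<And>i. i \<in> S \<Longrightarrow> F i \<in> I) \<Longrightarrow> sum F S \<in> I"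
  using ideal_subspace
  by (simp_all add: subspace_0 subspace_add subspace_diff subspace_scale subspace_neg subspace_sum)

lemma fcalc_A: "h \<in> A \<Longrightarrow> star h = h \<Longrightarrow> c0fun f \<Longrightarrow> fcalc h f \<in> A"
  by (rule fcalc_mem[OF _ _ closed_A subspace_A]) simp_all

lemma fcalc_ideal: "h \<in> I \<Longrightarrow> star h = h \<Longrightarrow> c0fun f \<Longrightarrow> fcalc h f \<in> I"
  by (rule fcalc_mem[OF _ _ ideal_closed ideal_subspace]) (simp_all add: ideal_left ideal_A)

lemma ideal_limit: "(\<And>n. X n \<in> I) \<Longrightarrow> X \<longlonglongrightarrow> x \<Longrightarrow> x \<in> I"
  by (rule closed_sequentially[OF ideal_closed])

text \<open>The elements f_n(b* b) act on \<open>b\<close> as an approximate unit: the squared norm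
  of b - b f_n(b* b) is at most the supremum of |t| (1 - f_n(t))^2, hence at most 1/(n+1). In A/I
  this says that b* b = 0 implies b = 0.\<close>

lemma ideal_star_mult_self:
  assumes b: "b \<in> A" and bb: "star b * b \<in> I"
  shows "b \<in> I"
proof -
  let ?k = "star b * b"
  have k: "star ?k = ?k" by (simp add: star_mult star_star)
  define f where "f n t = \<bar>t\<bar> / (\<bar>t\<bar> + 1 / real (Suc n))" for n :: nat and t :: real
  have pos: "\<bar>t\<bar> + 1 / real (Suc n) > 0" for n and t :: real
    by (rule add_nonneg_pos) auto
  have c0: "c0fun (f n)" for n
    unfolding c0fun_def f_def using pos[THEN less_imp_neq] by (auto intro!: continuous_intros simp: less_imp_neq)
  have small: "\<bar>t * ((1 - f n t) * (1 - f n t))\<bar> \<le> 1 / real (Suc n)" for n t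
  proof -
    let ?e = "1 / real (Suc n)"
    have e: "?e > 0" by simp
    have "1 - f n t = ?e / (\<bar>t\<bar> + ?e)"
      using pos[of t n] by (simp add: f_def field_simps)
    then have "\<bar>t * ((1 - f n t) * (1 - f n t))\<bar> = ?e * ((\<bar>t\<bar> / (\<bar>t\<bar> + ?e)) * (?e / (\<bar>t\<bar> + ?e)))"
      by (simp add: abs_mult)
    also have "\<dots> \<le> ?e * (1 * 1)"
    proof -
      have "x / (x + y) \<le> 1" "y / (x + y) \<le> 1" if "x \<ge> 0" "y \<ge> 0" for x y :: real
        using that by (auto simp: divide_le_eq_1)
      from this[of "\<bar>t\<bar>" ?e] show ?thesis using e by (intro mult_left_mono mult_mono) simp_all
    qed
    finally show ?thesis by simp
  qed
  have "(\<lambda>n. b * fcalc ?k (f n)) \<longlonglongrightarrow> b"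
  proof (rule LIMSEQ_I)
    fix r :: real assume r: "r > 0"
    then obtain N where N: "1 / real (Suc N) < r\<^sup>2" by (metis nat_approx_posE zero_less_power)
    have "norm (b * fcalc ?k (f n) - b) < r" if "n \<ge> N" for n
    proof -
      have "(norm (b - b * fcalc ?k (f n)))\<^sup>2 \<le> 1 / real (Suc n)"
        by (rule norm_diff_mult_fcalc[OF c0 small])
      also have "\<dots> \<le> 1 / real (Suc N)" using that by (simp add: frac_le)
      also have "\<dots> < r\<^sup>2" by (rule N)
      finally have "norm (b - b * fcalc ?k (f n)) < r" using r by (simp add: power2_less_imp_less)
      then show ?thesis by (simp add: norm_minus_commute)
    qed
    then show "\<exists>no. \<forall>n\<ge>no. norm (b * fcalc ?k (f n) - b) < r" by blast
  qed
  moreover have "b * fcalc ?k (f n) \<in> I" for n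
    by (rule ideal_left[OF fcalc_ideal[OF bb k c0] b])
  ultimately show ?thesis by (rule ideal_limit[rotated])
qed

text \<open>The factor \<open>u\<close> is the limit of \<open>a g\<^sub>n(a\<^sup>*a)\<close>, where \<open>g\<^sub>n(t) \<longlonglongrightarrow> t\<^bsup>-1/4\<^esup>\<close>, and \<open>b = (a\<^sup>*a)\<^bsup>1/8\<^esup>\<close>.\<close>

lemma ideal_factorization:
  assumes a: "a \<in> I" and sym: "star a = \<sigma> *\<^sub>R a" and norm_a: "norm a = 1"
  shows "\<exists>b\<in>I. \<exists>u\<in>I. star b = b \<and> a = b * u * b \<and> norm b \<le> 2 \<and> norm u \<le> 2"
proof -
  let ?k = "star a * a"
  have k: "star ?k = ?k" by (simp add: star_mult star_star)
  have kI: "?k \<in> I" using a by (simp add: ideal_right ideal_A ideal_star)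
  have nk: "norm ?k = 1" by (simp add: cstar_identity norm_a)
  \<comment> \<open>Working with the fourth root makes all later bounds rational in \<open>s\<close>
    and \<open>\<rho> n\<close>; the absolute value extends them to the negative half of the
    interval.\<close>
  define s where "s t = sqrt (sqrt \<bar>t\<bar>)" for t
  have s0: "s t \<ge> 0" for t by (simp add: s_def)
  have s4: "s t ^ 4 = \<bar>t\<bar>" for t
  proof -
    have "s t ^ 4 = ((s t)\<^sup>2)\<^sup>2" by simp
    then show ?thesis by (simp add: s_def del: power_mult)
  qed
  have s2: "s t \<le> 2" if "\<bar>t\<bar> \<le> norm ?k + 1" for t
  proof (rule ccontr)
    assume "\<not> ?thesis"
    then have "s t ^ 4 > 2 ^ 4" by (intro power_strict_mono) auto
    then show False using that nk by (simp add: s4)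
  qed
  define \<rho> where "\<rho> n = 1 / real (Suc n)" for n
  have \<rho>: "\<rho> n > 0" "\<rho> n \<le> 1" for n by (simp_all add: \<rho>_def)
  \<comment> \<open>A regularization of \<open>1 / s\<close> that vanishes at 0. It satisfies
    \<open>s ^ 2 * g n \<le> s\<close>, which bounds the approximations of \<open>u\<close>.\<close>
  define g where "g n t = s t ^ 3 / (s t ^ 4 + \<rho> n ^ 4)" for n t
  have den: "s t ^ 4 + \<rho> n ^ 4 > 0" for t n
    using s0[of t] \<rho>(1)[of n] by (intro add_nonneg_pos) auto
  have cont_s: "continuous_on UNIV s"
    unfolding s_def by (intro continuous_intros)
  have s00: "s 0 = 0" by (simp add: s_def)
  have c0g: "c0fun (g n)" for n
    unfolding c0fun_def g_def using den[of _ n]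
    by (auto intro!: continuous_intros cont_s simp: s00 less_imp_neq[THEN not_sym])
  have c0\<phi>: "c0fun (\<lambda>t. sqrt (s t))"
    unfolding c0fun_def by (auto intro!: continuous_intros cont_s simp: s00)
  let ?b = "fcalc ?k (\<lambda>t. sqrt (s t))" and ?u = "\<lambda>n. a * fcalc ?k (g n)"
  have bI: "?b \<in> I" by (rule fcalc_ideal[OF kI k c0\<phi>])
  have uI: "?u n \<in> I" for n
    by (rule ideal_right[OF a ideal_A[OF fcalc_ideal[OF kI k c0g]]])
  have g_le: "(s t)\<^sup>2 * g n t \<le> s t" and g_0: "g n t \<ge> 0" for n t
  proof -
    have "(s t)\<^sup>2 * g n t = s t * (s t ^ 4 / (s t ^ 4 + \<rho> n ^ 4))" by (simp add: g_def power_numeral_reduce)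
    also have "\<dots> \<le> s t * 1" using s0[of t] \<rho>(1)[of n] den[of t n] by (intro mult_left_mono) auto
    finally show "(s t)\<^sup>2 * g n t \<le> s t" by simp
    show "g n t \<ge> 0" using s0[of t] den[of t n] by (simp add: g_def)
  qed
  have t_eq: "\<bar>t * (x * x)\<bar> = ((s t)\<^sup>2 * \<bar>x\<bar>)\<^sup>2" for t x :: real
  proof -
    have "\<bar>t * (x * x)\<bar> = s t ^ 4 * (\<bar>x\<bar> * \<bar>x\<bar>)" by (simp add: abs_mult s4)
    then show ?thesis by (simp add: power2_eq_square power_numeral_reduce)
  qed
  have norm_u: "norm (?u n) \<le> 2" for n
  proof -
    have "(norm (?u n))\<^sup>2 \<le> 2\<^sup>2"
    proof (rule norm_mult_fcalc[OF c0g])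
      fix t assume "\<bar>t\<bar> \<le> norm ?k + 1"
      then have "(s t)\<^sup>2 * \<bar>g n t\<bar> \<le> 2" using g_le[of t n] s2[of t] g_0[of n t] by simp
      then show "\<bar>t * (g n t * g n t)\<bar> \<le> 2\<^sup>2" unfolding t_eq by (intro power_mono) auto
    qed
    then show ?thesis by (rule power2_le_imp_le) simp
  qed
  \<comment> \<open>This gives the Cauchy rate \<open>\<rho> m\<close> uniformly in t, in particular
    near 0 where \<open>1 / s\<close> blows up.\<close>
  have weighted: "x * r ^ 4 \<le> r * (x ^ 4 + r ^ 4)" if "x \<ge> 0" "r \<ge> 0" for x r :: real
  proof (cases "x \<le> r")
    case True
    then have "x * r ^ 4 \<le> r * r ^ 4" using that by (intro mult_right_mono) auto
    also have "\<dots> \<le> r * (x ^ 4 + r ^ 4)" using that by (intro mult_left_mono) auto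
    finally show ?thesis .
  next
    case False
    then have "x * r ^ 3 \<le> x * x ^ 3" using that by (intro mult_left_mono power_mono) auto
    also have "\<dots> \<le> x ^ 4 + r ^ 4" using that by (simp add: power_numeral_reduce)
    finally have "r * (x * r ^ 3) \<le> r * (x ^ 4 + r ^ 4)" using that by (intro mult_left_mono)
    then show ?thesis by (simp add: power_numeral_reduce mult_ac)
  qed
  have g_close: "(s t)\<^sup>2 * \<bar>g m t - g n t\<bar> \<le> \<rho> m" if "m \<le> n" for m n t
  proof -
    let ?x = "s t" let ?p = "?x ^ 4 + \<rho> m ^ 4" and ?q = "?x ^ 4 + \<rho> n ^ 4"
    have le: "\<rho> n \<le> \<rho> m" using that by (simp add: \<rho>_def frac_le)
    have "g n t - g m t = ?x ^ 3 * (?p - ?q) / (?p * ?q)"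
      using den[of t m] den[of t n] by (simp add: g_def divide_simps) (simp add: algebra_simps)
    then have "(s t)\<^sup>2 * \<bar>g m t - g n t\<bar> = (?x ^ 4 / ?q) * (?x * (\<rho> m ^ 4 - \<rho> n ^ 4) / ?p)"
      using den[of t m] den[of t n] s0[of t] power_mono[OF le, of 4] \<rho>(1)[of n]
      by (simp add: abs_minus_commute[of "g m t"] abs_mult power_numeral_reduce mult_ac)
    also have "\<dots> \<le> 1 * (?x * \<rho> m ^ 4 / ?p)"
      using den[of t m] den[of t n] s0[of t] power_mono[OF le, of 4] \<rho>(1)[of n]
      by (intro mult_mono divide_right_mono mult_left_mono) (auto simp: divide_le_eq_1)
    also have "\<dots> \<le> \<rho> m"
      using weighted[OF s0[of t], of "\<rho> m"] \<rho>(1)[of m] den[of t m] by (simp add: divide_le_eq)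
    finally show ?thesis .
  qed
  have u_close: "norm (?u m - ?u n) \<le> \<rho> m" if "m \<le> n" for m n
  proof -
    have "?u m - ?u n = a * fcalc ?k (\<lambda>t. g m t - g n t)"
      by (simp add: fcalc_diff[OF k c0g c0g] right_diff_distrib)
    moreover have "(norm (a * fcalc ?k (\<lambda>t. g m t - g n t)))\<^sup>2 \<le> (\<rho> m)\<^sup>2"
    proof (rule norm_mult_fcalc[OF c0fun_diff[OF c0g c0g]])
      show "\<bar>t * ((g m t - g n t) * (g m t - g n t))\<bar> \<le> (\<rho> m)\<^sup>2" for t
        unfolding t_eq using g_close[OF that, of t] by (intro power_mono) auto
    qed
    ultimately show ?thesis using \<rho>(1)[of m] by (metis power2_le_imp_le less_imp_le)
  qed
  have \<rho>_lim: "\<rho> \<longlonglongrightarrow> 0" unfolding \<rho>_def by (rule LIMSEQ_Suc[OF lim_1_over_n])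
  have "Cauchy ?u"
    unfolding Cauchy_def
  proof (intro allI impI)
    fix e :: real assume "e > 0"
    then obtain N where N: "\<rho> N < e / 2" unfolding \<rho>_def by (metis half_gt_zero nat_approx_posE)
    have "dist (?u m) (?u n) < e" if "m \<ge> N" "n \<ge> N" for m n
    proof -
      have "dist (?u m) (?u n) \<le> dist (?u N) (?u m) + dist (?u N) (?u n)" by (rule dist_triangle3)
      also have "\<dots> \<le> \<rho> N + \<rho> N" unfolding dist_norm using that by (intro add_mono u_close)
      finally show ?thesis using N by simp
    qed
    then show "\<exists>M. \<forall>m\<ge>M. \<forall>n\<ge>M. dist (?u m) (?u n) < e" by blast
  qed
  then obtain u where u: "?u \<longlonglongrightarrow> u" by (auto simp: Cauchy_convergent_iff convergent_def)
  have ub: "?u n * ?b * ?b = a * fcalc ?k (\<lambda>t. g n t * sqrt (s t) * sqrt (s t))" for n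
  proof -
    have c0: "c0fun (\<lambda>t. g n t * sqrt (s t))"
      using c0g[of n] c0\<phi> unfolding c0fun_def by (auto intro!: continuous_intros)
    show ?thesis
      unfolding fcalc_mult[OF k c0 c0\<phi>] fcalc_mult[OF k c0g c0\<phi>] by (simp only: mult.assoc)
  qed
  have "norm (a - ?u n * ?b * ?b) \<le> \<rho> n" for n
  proof -
    have c0: "c0fun (\<lambda>t. g n t * sqrt (s t) * sqrt (s t))"
      using c0g[of n] c0\<phi> unfolding c0fun_def by (auto intro!: continuous_intros)
    have "(norm (a - ?u n * ?b * ?b))\<^sup>2 \<le> (\<rho> n)\<^sup>2"
      unfolding ub
    proof (rule norm_diff_mult_fcalc[OF c0])
      fix t
      have "1 - g n t * sqrt (s t) * sqrt (s t) = \<rho> n ^ 4 / (s t ^ 4 + \<rho> n ^ 4)"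
      proof -
        have "g n t * sqrt (s t) * sqrt (s t) = s t ^ 4 / (s t ^ 4 + \<rho> n ^ 4)"
          using s0[of t] by (simp add: mult.assoc g_def power_numeral_reduce mult.commute)
        then show ?thesis using den[of t n] by (simp add: field_simps)
      qed
      moreover have "(s t)\<^sup>2 * (\<rho> n ^ 4 / (s t ^ 4 + \<rho> n ^ 4)) \<le> \<rho> n"
      proof (cases "s t = 0")
        case False
        have "2 * ((s t)\<^sup>2 * (\<rho> n)\<^sup>2) \<le> s t ^ 4 + \<rho> n ^ 4"
          using zero_le_power2[of "(s t)\<^sup>2 - (\<rho> n)\<^sup>2"] by (simp add: power2_diff algebra_simps power_numeral_reduce power2_eq_square)
        then have "(s t)\<^sup>2 * (\<rho> n)\<^sup>2 \<le> s t ^ 4 + \<rho> n ^ 4" using den[of t n] by (smt (verit) mult_nonneg_nonneg zero_le_power2)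
        then have "(\<rho> n)\<^sup>2 * ((s t)\<^sup>2 * (\<rho> n)\<^sup>2) \<le> \<rho> n * (s t ^ 4 + \<rho> n ^ 4)"
          using \<rho>[of n] by (intro mult_mono) (auto simp: power2_eq_square mult_left_le)
        then show ?thesis using den[of t n] by (simp add: divide_le_eq power_numeral_reduce power2_eq_square mult_ac)
      qed (use \<rho>(1)[of n] in simp)
      ultimately have "(s t)\<^sup>2 * \<bar>1 - g n t * sqrt (s t) * sqrt (s t)\<bar> \<le> \<rho> n"
        using den[of t n] \<rho>(1)[of n] by simp
      then show "\<bar>t * ((1 - g n t * sqrt (s t) * sqrt (s t)) * (1 - g n t * sqrt (s t) * sqrt (s t)))\<bar> \<le> (\<rho> n)\<^sup>2"
        unfolding t_eq by (intro power_mono) auto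
    qed
    then show ?thesis using \<rho>(1)[of n] by (metis power2_le_imp_le less_imp_le)
  qed
  then have "(\<lambda>n. a - ?u n * ?b * ?b) \<longlonglongrightarrow> 0"
    by (intro Lim_null_comparison[OF always_eventually \<rho>_lim]) simp
  from tendsto_diff[OF tendsto_const this, of a] have "(\<lambda>n. ?u n * ?b * ?b) \<longlonglongrightarrow> a" by simp
  moreover have "(\<lambda>n. ?u n * ?b * ?b) \<longlonglongrightarrow> u * ?b * ?b" by (intro tendsto_intros u)
  ultimately have a_eq: "a = u * ?b * ?b" by (rule LIMSEQ_unique)
  \<comment> \<open>The symmetry hypothesis enters here: \<open>a\<close> commutes with a* a, so one
    factor \<open>?b\<close> can be moved to the left of \<open>u\<close>.\<close>
  have ak: "a * ?k = ?k * a" by (simp add: sym mult.assoc)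
  have ab: "a * ?b = ?b * a" by (rule fcalc_commute[OF k c0\<phi> ak])
  have "fcalc ?k (g n) * ?b = ?b * fcalc ?k (g n)" for n
    by (rule fcalc_commute[OF k c0\<phi>]) (simp add: fcalc_commute[OF k c0g])
  then have "?u n * ?b = ?b * ?u n" for n
    using ab by (metis mult.assoc)
  then have "(\<lambda>n. ?u n * ?b) \<longlonglongrightarrow> ?b * u" by (simp add: tendsto_mult_left u)
  moreover have "(\<lambda>n. ?u n * ?b) \<longlonglongrightarrow> u * ?b" by (intro tendsto_intros u)
  ultimately have "u * ?b = ?b * u" by (metis LIMSEQ_unique)
  then have "a = ?b * u * ?b" using a_eq by simp
  moreover have "u \<in> I" by (rule ideal_limit[OF uI u])
  moreover have "norm u \<le> 2" by (rule tendsto_upperbound[OF tendsto_norm[OF u]]) (use norm_u in auto)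
  moreover have "norm ?b \<le> 2"
  proof (rule fcalc_norm_le[OF k c0\<phi>])
    fix t assume "\<bar>t\<bar> \<le> norm ?k + 1"
    then have "sqrt (s t) \<le> sqrt 4" using s2[of t] by (intro real_sqrt_le_mono) simp
    then show "\<bar>sqrt (s t)\<bar> \<le> 2" using s0[of t] by simp
  qed
  ultimately show ?thesis using bI fcalc_star[OF k c0\<phi>] by blast
qed

end

section \<open>The spectrum modulo the annihilating ideal\<close>

sublocale triple_map \<subseteq> ideal: cstar_ideal A I
  by unfold_locales (simp_all add: closed_I subspace_I I_A I_star I_mult)

context triple_map
begin

section \<open>Boundedness on the ideal\<close>

text \<open>Uniform boundedness is used twice: for fixed \<open>b\<close> over all \<open>u\<close>
  in the unit ball, then over all pairs (u, c) with \<open>b\<close> as the variable.\<close>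

lemma triple_bounded_I:
  "\<exists>K\<ge>0. \<forall>b\<in>I. \<forall>u\<in>I. \<forall>c\<in>I. norm u \<le> 1 \<longrightarrow> norm c \<le> 1 \<longrightarrow> norm (\<delta> (cstar_triple b u c)) \<le> K * norm b"
proof -
  let ?U = "{u\<in>I. norm u \<le> 1}"
  have lin: "real_linear_on I (\<lambda>c. \<delta> (cstar_triple b u c))" if "b \<in> I" "u \<in> I" for b u
    using that unfolding real_linear_on_def
    by (simp add: cstar_triple_add cstar_triple_scaleR \<delta>_add \<delta>_scale I_A)
  have bd: "bounded_over I (\<lambda>c. \<delta> (cstar_triple b u c))" if b: "b \<in> I" and u: "u \<in> I" for b u
  proof -
    have "bounded_over A (\<lambda>c. \<delta> (cstar_triple b u c))"
      using J_null(1)[OF I_J[OF b] I_A[OF u]] by (simp add: null_def)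
    then show ?thesis unfolding bounded_over_def using I_A by blast
  qed
  have step: "\<exists>K. \<forall>u\<in>?U. \<forall>c\<in>I. norm (\<delta> (cstar_triple b u c)) \<le> K * norm c" if b: "b \<in> I" for b
  proof (rule uniform_boundedness[OF closed_I subspace_I])
    fix c assume c: "c \<in> I"
    have "bounded_over A (\<lambda>u. \<delta> (cstar_triple b u c))"
      using J_null(3)[OF I_J[OF b] I_A[OF c]] by (simp add: null_def)
    then obtain C where C: "C \<ge> 0" "\<And>u. u \<in> A \<Longrightarrow> norm (\<delta> (cstar_triple b u c)) \<le> C * norm u"
      by (rule bounded_overE) blast
    have "norm (\<delta> (cstar_triple b u c)) \<le> C" if "u \<in> ?U" for u
      using C(2)[OF I_A[of u]] mult_left_mono[of "norm u" 1 C] C(1) that by simp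
    then show "\<exists>C. \<forall>u\<in>?U. norm (\<delta> (cstar_triple b u c)) \<le> C" by blast
  qed (use b lin bd in auto)
  have "\<exists>K. \<forall>p\<in>?U \<times> ?U. \<forall>b\<in>I. norm (\<delta> (cstar_triple b (fst p) (snd p))) \<le> K * norm b"
  proof (rule uniform_boundedness[OF closed_I subspace_I])
    fix b assume b: "b \<in> I"
    obtain K where K: "\<forall>u\<in>?U. \<forall>c\<in>I. norm (\<delta> (cstar_triple b u c)) \<le> K * norm c"
      using step[OF b] by blast
    have "norm (\<delta> (cstar_triple b u c)) \<le> max K 0" if "u \<in> ?U" "c \<in> ?U" for u c
    proof -
      have "norm (\<delta> (cstar_triple b u c)) \<le> K * norm c" using K that by blast
      also have "\<dots> \<le> max K 0 * norm c" by (intro mult_right_mono) auto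
      also have "\<dots> \<le> max K 0 * 1" using that by (intro mult_left_mono) auto
      finally show ?thesis by simp
    qed
    then show "\<exists>C. \<forall>p\<in>?U \<times> ?U. norm (\<delta> (cstar_triple b (fst p) (snd p))) \<le> C" by auto
  next
    fix p assume "p \<in> ?U \<times> ?U"
    then have p: "fst p \<in> I" "snd p \<in> I" by auto
    show "real_linear_on I (\<lambda>b. \<delta> (cstar_triple b (fst p) (snd p)))"
      using lin[OF p(2,1)] by (simp add: cstar_triple_commute[of _ "fst p"])
    show "bounded_over I (\<lambda>b. \<delta> (cstar_triple b (fst p) (snd p)))"
      using bd[OF p(2,1)] by (simp add: cstar_triple_commute[of _ "fst p"])
  qed
  then obtain K where K: "\<forall>p\<in>?U \<times> ?U. \<forall>b\<in>I. norm (\<delta> (cstar_triple b (fst p) (snd p))) \<le> K * norm b" by blast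
  have "norm (\<delta> (cstar_triple b u c)) \<le> max K 0 * norm b"
    if "b \<in> I" "u \<in> I" "c \<in> I" "norm u \<le> 1" "norm c \<le> 1" for b u c
  proof -
    have "norm (\<delta> (cstar_triple b u c)) \<le> K * norm b"
      using bspec[OF K, of "(u, c)"] that by simp
    also have "\<dots> \<le> max K 0 * norm b" by (intro mult_right_mono) auto
    finally show ?thesis .
  qed
  then show ?thesis by (intro exI[of _ "max K 0"]) simp
qed

lemma bounded_over_I: "bounded_over I \<delta>"
proof -
  obtain K where K: "K \<ge> 0" "\<And>b u c. b \<in> I \<Longrightarrow> u \<in> I \<Longrightarrow> c \<in> I \<Longrightarrow> norm u \<le> 1 \<Longrightarrow> norm c \<le> 1 \<Longrightarrow>
      norm (\<delta> (cstar_triple b u c)) \<le> K * norm b"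
    using triple_bounded_I by blast
  have sym: "norm (\<delta> a) \<le> 8 * K * norm a" if a: "a \<in> I" and s: "star a = \<sigma> *\<^sub>R a" for a \<sigma>
  proof (cases "a = 0")
    case False
    define a1 where "a1 = (1 / norm a) *\<^sub>R a"
    have a1: "a1 \<in> I" "star a1 = \<sigma> *\<^sub>R a1" "norm a1 = 1"
      using a s False by (simp_all add: a1_def ideal.ideal_scaleR star_scaleR mult.commute)
    obtain b u where bu: "b \<in> I" "u \<in> I" "star b = b" "a1 = b * u * b" "norm b \<le> 2" "norm u \<le> 2"
      using ideal.ideal_factorization[OF a1] by blast
    \<comment> \<open>Halving brings the factors, of norm at most 2, into the unit ball. The star on
      \<open>u\<close> cancels the one in the triple product, so the triple is a quarter of
      \<open>a1\<close>.\<close>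
    let ?u = "(1/2) *\<^sub>R star u" and ?b = "(1/2) *\<^sub>R b"
    have "cstar_triple b ?u ?b = (1/4) *\<^sub>R a1"
      by (simp add: cstar_triple_scaleR cstar_triple_def star_star star_scaleR bu(4) scaleR_halves)
    then have "norm (\<delta> ((1/4) *\<^sub>R a1)) \<le> K * norm b"
      using K(2)[of b ?u ?b] bu by (simp add: ideal.ideal_scaleR I_star norm_star)
    then have "norm (\<delta> a1) \<le> 4 * (K * norm b)" using a1 by (simp add: \<delta>_scale I_A)
    also have "\<dots> \<le> 8 * K" using mult_left_mono[OF bu(5) K(1)] by simp
    finally have "norm (\<delta> a1) \<le> 8 * K" .
    then have "norm (\<delta> a) / norm a \<le> 8 * K" using a by (simp add: a1_def \<delta>_scale I_A)
    then show ?thesis using False by (simp add: divide_le_eq)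
  qed simp
  have "norm (\<delta> a) \<le> 16 * K * norm a" if a: "a \<in> I" for a
  proof -
    let ?p = "(1/2) *\<^sub>R (a + star a)" and ?m = "(1/2) *\<^sub>R (a - star a)"
    have I: "?p \<in> I" "?m \<in> I" using a by (simp_all add: ideal.ideal_scaleR ideal.ideal_add ideal.ideal_diff I_star)
    have "norm ?p \<le> norm a" "norm ?m \<le> norm a"
      using norm_triangle_ineq[of a "star a"] norm_triangle_ineq4[of a "star a"] by (simp_all add: norm_star)
    moreover have "norm (\<delta> ?p) \<le> 8 * K * norm ?p"
      by (rule sym[OF I(1), of 1]) (simp add: star_scaleR star_add star_star add.commute)
    moreover have "norm (\<delta> ?m) \<le> 8 * K * norm ?m"
      by (rule sym[OF I(2), of "-1"]) (simp add: star_scaleR star_diff star_star scaleR_minus_right[symmetric] del: scaleR_minus_right)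
    ultimately have "norm (\<delta> ?p) + norm (\<delta> ?m) \<le> 8 * K * norm a + 8 * K * norm a"
      using K(1) by (intro add_mono) (meson mult_left_mono order.trans mult_nonneg_nonneg zero_le_numeral)+
    moreover have "a = ?p + ?m" by (simp add: scaleR_add_right[symmetric] del: scaleR_add_right)
    then have "\<delta> a = \<delta> ?p + \<delta> ?m" using \<delta>_add[OF I_A[OF I(1)] I_A[OF I(2)]] by simp
    then have "norm (\<delta> a) \<le> norm (\<delta> ?p) + norm (\<delta> ?m)" by (simp add: norm_triangle_ineq)
    ultimately show ?thesis by simp
  qed
  then show ?thesis by (rule bounded_overI)
qed

section \<open>Finiteness of the spectrum modulo \<open>I\<close>\<close>

definition spectrum_mod :: "'b \<Rightarrow> real set" where
  "spectrum_mod h = {\<nu>. \<bar>\<nu>\<bar> \<le> norm h + 1 \<and> (\<forall>f. c0fun f \<longrightarrow> fcalc h f \<in> I \<longrightarrow> f \<nu> = 0)}"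

lemma finite_spectrum_mod:
  assumes h: "h \<in> A" "star h = h"
  shows "finite (spectrum_mod h)"
proof (rule ccontr)
  let ?K = "spectrum_mod h"
  assume inf: "infinite ?K"
  have "bounded ?K" by (rule boundedI[where B = "norm h + 1"]) (simp add: spectrum_mod_def)
  then obtain l where l: "l islimpt ?K" using inf bounded_infinite_imp_islimpt[of ?K ?K] by blast
  \<comment> \<open>The radius keeps the bumps away from 0, as the functional calculus requires. If
    \<open>l = 0\<close>, the shells around \<open>l\<close> avoid 0 by themselves.\<close>
  define R where "R = (if l = 0 then 1 else \<bar>l\<bar> / 2)"
  have R: "R > 0" by (simp add: R_def)
  have near: "\<exists>x\<in>?K. x \<noteq> l \<and> \<bar>x - l\<bar> < e" if "e > 0" for e
    using l that unfolding islimpt_approachable dist_real_def by blast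
  have "\<exists>x. \<forall>n. (x n \<in> ?K \<and> x n \<noteq> l \<and> \<bar>x n - l\<bar> < R) \<and> \<bar>x (Suc n) - l\<bar> < \<bar>x n - l\<bar> / 3"
  proof (rule dependent_nat_choice)
    show "\<exists>x. x \<in> ?K \<and> x \<noteq> l \<and> \<bar>x - l\<bar> < R" using near[OF R] by blast
    fix x n assume x: "x \<in> ?K \<and> x \<noteq> l \<and> \<bar>x - l\<bar> < R"
    then obtain y where y: "y \<in> ?K" "y \<noteq> l" "\<bar>y - l\<bar> < \<bar>x - l\<bar> / 3"
      using near[of "\<bar>x - l\<bar> / 3"] by auto
    moreover have "\<bar>x - l\<bar> / 3 \<le> \<bar>x - l\<bar>" by simp
    then have "\<bar>y - l\<bar> < R" using y(3) x by (meson less_le_trans less_trans)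
    ultimately show "\<exists>y. (y \<in> ?K \<and> y \<noteq> l \<and> \<bar>y - l\<bar> < R) \<and> \<bar>y - l\<bar> < \<bar>x - l\<bar> / 3" by blast
  qed
  then obtain x where x: "\<And>n. x n \<in> ?K" "\<And>n. x n \<noteq> l" "\<And>n. \<bar>x n - l\<bar> < R"
    and dec: "\<And>n. \<bar>x (Suc n) - l\<bar> < \<bar>x n - l\<bar> / 3" by blast
  define r where "r n = \<bar>x n - l\<bar>" for n
  have r: "r n > 0" for n using x(2) by (simp add: r_def)
  have r_less: "r n < r m / 3" if "m < n" for m n
    using that
  proof (induction n)
    case (Suc n)
    show ?case
    proof (cases "m = n")
      case True
      then show ?thesis using dec by (simp add: r_def)
    next
      case False
      then have "r n < r m / 3" using Suc by simp
      moreover have "r (Suc n) < r n / 3" using dec by (simp add: r_def)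
      ultimately show ?thesis using r[of n] by linarith
    qed
  qed simp
  \<comment> \<open>\<open>w n\<close> is the relative distance to the shell of radius
    \<open>r n\<close> about \<open>l\<close>. The bump \<open>\<beta> n\<close> lives where
    \<open>w n < 1/4\<close>, and there its companion \<open>\<gamma> n\<close> equals 1. The
    regions \<open>w n < 1/2\<close> are disjoint because the radii drop by more than a factor 3:
    3/2 of the smaller radius is below 1/2 of the larger.\<close>
  define w where "w n t = \<bar>\<bar>t - l\<bar> / r n - 1\<bar>" for n t
  define \<beta> where "\<beta> n t = max 0 (1 - 4 * w n t)" for n t
  define \<gamma> where "\<gamma> n t = max 0 (min 1 (2 - 4 * w n t))" for n t
  have w0: "w n 0 \<ge> 1" for n
  proof (cases "l = 0")
    case False
    then have "r n < \<bar>l\<bar> / 2" using x(3)[of n] by (simp add: r_def R_def)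
    then have "\<bar>l\<bar> / r n \<ge> 2" using r[of n] by (simp add: le_divide_eq)
    then show ?thesis by (simp add: w_def)
  qed (simp add: w_def)
  have cont_w: "continuous_on UNIV (w n)" for n
    unfolding w_def using r[of n] by (intro continuous_intros) auto
  have c0: "c0fun (\<beta> n)" "c0fun (\<gamma> n)" for n
    using w0[of n] unfolding c0fun_def \<beta>_def \<gamma>_def by (auto intro!: continuous_intros cont_w)
  have disjoint: "w m t \<ge> 1/2 \<or> w n t \<ge> 1/2" if "m < n" for m n t
  proof (rule ccontr)
    assume "\<not> ?thesis"
    then have "\<bar>t - l\<bar> / r m > 1/2" "\<bar>t - l\<bar> / r n < 3/2" unfolding w_def by linarith+
    then have "\<bar>t - l\<bar> > r m / 2" "\<bar>t - l\<bar> < 3/2 * r n"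
      using r[of m] r[of n] by (simp_all add: field_simps)
    then show False using r_less[OF that] by linarith
  qed
  have \<gamma>\<beta>: "\<gamma> n t * \<gamma> n t * \<beta> n t = \<beta> n t" for n t
  proof (cases "w n t < 1/4")
    case True
    then have "\<gamma> n t = 1" by (simp add: \<gamma>_def)
    then show ?thesis by simp
  qed (simp add: \<beta>_def)
  have ne: "w m t \<ge> 1/2 \<or> w n t \<ge> 1/2" if "m \<noteq> n" for m n t
    using that disjoint[of m n t] disjoint[of n m t] by (metis linorder_neqE_nat)
  have \<gamma>0: "\<gamma> m t * \<beta> n t = 0" "\<gamma> m t * \<gamma> n t = 0" if "m \<noteq> n" for m n t
    using ne[OF that, of t] by (auto simp: \<beta>_def \<gamma>_def)
  let ?y = "\<lambda>n. fcalc h (\<beta> n)" and ?g = "\<lambda>n. fcalc h (\<gamma> n)"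
  have A: "?y n \<in> A" "?g n \<in> A" for n by (rule ideal.fcalc_A[OF h c0(1)] ideal.fcalc_A[OF h c0(2)])+
  have sa: "star (?y n) = ?y n" "star (?g n) = ?g n" for n by (rule fcalc_star[OF h(2) c0(1)] fcalc_star[OF h(2) c0(2)])+
  note mult = fcalc_mult[OF h(2), symmetric]
  have cc: "c0fun (\<lambda>t. \<gamma> n t * \<gamma> n t)" for n using c0(2)[of n] by (auto simp: c0fun_def intro!: continuous_intros)
  have "\<exists>n. null (\<lambda>t. cstar_triple (?y n) (?y n) t) \<and> (\<forall>b\<in>A. null (\<lambda>t. cstar_triple (?y n) t b))"
  proof (rule orthogonal_null[of ?y ?g, OF A sa])
    show "?g n * ?g n * ?y n = ?y n" for n
      by (simp add: mult[OF c0(2) c0(2)] mult[OF cc c0(1)] \<gamma>\<beta>)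
    show "?g m * ?y n = 0" "?g m * ?g n = 0" if "m \<noteq> n" for m n
      by (simp_all add: mult c0 \<gamma>0[OF that] fcalc_zero[OF h(2)])
  qed
  then obtain n where n: "null (\<lambda>t. cstar_triple (?y n) (?y n) t)" "\<forall>b\<in>A. null (\<lambda>t. cstar_triple (?y n) t b)" by blast
  \<comment> \<open>The cube leads into \<open>J\<close> and its seventh power into
    \<open>I\<close>. So the 21st power of \<open>\<beta> n\<close> must vanish at
    \<open>x n\<close>, where it equals 1.\<close>
  let ?v = "?y n * ?y n * ?y n" and ?\<beta>3 = "\<lambda>t. \<beta> n t * \<beta> n t * \<beta> n t"
  have "?v \<in> J" by (rule J_cube[OF A(1) sa(1) n(1)]) (use n in blast)
  then have "?v * ?v * ?v * ?v * ?v * ?v * ?v \<in> I" by (rule I_seventh_power) (simp add: star_mult sa mult.assoc)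
  moreover have "?v * ?v * ?v * ?v * ?v * ?v * ?v
      = fcalc h (\<lambda>t. ?\<beta>3 t * ?\<beta>3 t * ?\<beta>3 t * ?\<beta>3 t * ?\<beta>3 t * ?\<beta>3 t * ?\<beta>3 t)"
    using c0(1)[of n] by (subst mult, (auto simp: c0fun_def intro!: continuous_intros)[2])+ simp
  moreover have "c0fun (\<lambda>t. ?\<beta>3 t * ?\<beta>3 t * ?\<beta>3 t * ?\<beta>3 t * ?\<beta>3 t * ?\<beta>3 t * ?\<beta>3 t)"
    using c0(1)[of n] by (auto simp: c0fun_def intro!: continuous_intros)
  moreover have "\<beta> n (x n) = 1" using r[of n] by (simp add: \<beta>_def w_def r_def)
  ultimately show False using x(1)[of n] unfolding spectrum_mod_def by fastforce
qed

text \<open>A hull-kernel argument. On the compact set where |f| is not small, compactness gives a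
  finite sum of squares F that is positive there with F(h) in \<open>I\<close>. Then f is uniformly
  close to a multiple of F, and \<open>I\<close> is closed.\<close>

lemma fcalc_in_I:
  assumes h: "h \<in> A" "star h = h" and f: "c0fun f" and van: "\<And>\<nu>. \<nu> \<in> spectrum_mod h \<Longrightarrow> f \<nu> = 0"
  shows "fcalc h f \<in> I"
proof -
  let ?T = "{- (norm h + 1)..norm h + 1}"
  have "\<exists>x\<in>I. dist x (fcalc h f) < e" if e: "e > 0" for e
  proof -
    define C where "C = {t\<in>?T. \<bar>f t\<bar> \<ge> e / 2}"
    have cf: "continuous_on UNIV f" using f by (simp add: c0fun_def)
    have "closed {t. e / 2 \<le> \<bar>f t\<bar>}"
      by (intro closed_Collect_le continuous_intros cf)
    moreover have "C = ?T \<inter> {t. e / 2 \<le> \<bar>f t\<bar>}" by (auto simp: C_def)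
    ultimately have comp: "compact C" by (simp add: compact_Int_closed)
    have "\<exists>\<phi>. c0fun \<phi> \<and> fcalc h \<phi> \<in> I \<and> \<phi> t \<noteq> 0" if "t \<in> C" for t
    proof -
      have "t \<notin> spectrum_mod h" using van that e by (force simp: C_def)
      moreover have "\<bar>t\<bar> \<le> norm h + 1" using that by (auto simp: C_def abs_le_iff)
      ultimately show ?thesis by (auto simp: spectrum_mod_def)
    qed
    then obtain \<phi> where \<phi>: "\<And>t. t \<in> C \<Longrightarrow> c0fun (\<phi> t)" "\<And>t. t \<in> C \<Longrightarrow> fcalc h (\<phi> t) \<in> I"
      "\<And>t. t \<in> C \<Longrightarrow> \<phi> t t \<noteq> 0" by metis
    have op: "open {s. \<phi> t s \<noteq> 0}" if "t \<in> C" for t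
      using \<phi>(1)[OF that] by (intro open_Collect_neq continuous_intros) (simp add: c0fun_def)
    have cover: "C \<subseteq> (\<Union>t\<in>C. {s. \<phi> t s \<noteq> 0})" using \<phi>(3) by blast
    obtain D where D: "D \<subseteq> C" "finite D" "C \<subseteq> (\<Union>t\<in>D. {s. \<phi> t s \<noteq> 0})"
      by (rule compactE_image[OF comp op cover])
    define F where "F s = (\<Sum>t\<in>D. \<phi> t s * \<phi> t s)" for s
    have sq: "c0fun (\<lambda>s. \<phi> t s * \<phi> t s)" if "t \<in> D" for t
      using \<phi>(1)[of t] D(1) that by (auto simp: c0fun_def intro!: continuous_intros)
    have c0F: "c0fun F" unfolding F_def using sq by (rule c0fun_sum)
    have "fcalc h F = (\<Sum>t\<in>D. fcalc h (\<lambda>s. \<phi> t s * \<phi> t s))"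
      unfolding F_def by (rule fcalc_sum[OF h(2) sq])
    also have "\<dots> \<in> I"
    proof (rule ideal.ideal_sum)
      fix t assume "t \<in> D"
      then have t: "t \<in> C" using D by blast
      show "fcalc h (\<lambda>s. \<phi> t s * \<phi> t s) \<in> I"
        unfolding fcalc_mult[OF h(2) \<phi>(1)[OF t] \<phi>(1)[OF t]]
        by (rule ideal.ideal_left[OF \<phi>(2)[OF t] I_A[OF \<phi>(2)[OF t]]])
    qed
    finally have FI: "fcalc h F \<in> I" .
    have F_nonneg: "F s \<ge> 0" for s unfolding F_def by (intro sum_nonneg) simp
    have F_pos: "F s > 0" if "s \<in> C" for s
    proof -
      obtain t where t: "t \<in> D" "\<phi> t s \<noteq> 0" using D(3) \<open>s \<in> C\<close> by blast
      have "0 < \<phi> t s * \<phi> t s" using t(2) by (metis not_real_square_gt_zero)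
      also have "\<dots> \<le> F s" unfolding F_def using t(1) D(2) by (intro member_le_sum) auto
      finally show ?thesis .
    qed
    have "\<exists>c>0. \<forall>s\<in>C. F s \<ge> c"
    proof (cases "C = {}")
      case False
      have "continuous_on C F" using c0F by (auto simp: c0fun_def intro: continuous_on_subset)
      then obtain s0 where "s0 \<in> C" "\<forall>s\<in>C. F s0 \<le> F s" using continuous_attains_inf[OF comp False] by blast
      then show ?thesis using F_pos by blast
    qed (auto intro: exI[of _ 1])
    then obtain c where c: "c > 0" "\<And>s. s \<in> C \<Longrightarrow> F s \<ge> c" by blast
    \<comment> \<open>The cutoff \<open>c\<close> avoids dividing by zeros of \<open>F\<close>. On
      \<open>C\<close> the product \<open>F q\<close> is exactly \<open>f\<close>; elsewhere the
      error is at most |f|, which is below \<open>e / 2\<close>.\<close>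
    define q where "q s = f s / max (F s) c" for s
    have c0q: "c0fun q"
    proof -
      have "max (F s) c \<noteq> 0" for s using c(1) max.cobounded2[of c "F s"] by linarith
      then show ?thesis
        using f c0F unfolding c0fun_def q_def by (auto intro!: continuous_intros)
    qed
    have "fcalc h (\<lambda>s. F s * q s) \<in> I"
      unfolding fcalc_mult[OF h(2) c0F c0q] by (rule ideal.ideal_right[OF FI ideal.fcalc_A[OF h c0q]])
    moreover have "norm (fcalc h (\<lambda>s. F s * q s - f s)) \<le> e / 2"
    proof (rule fcalc_norm_le[OF h(2)])
      show "c0fun (\<lambda>s. F s * q s - f s)" using c0F c0q f by (auto simp: c0fun_def intro!: continuous_intros)
      fix s assume "\<bar>s\<bar> \<le> norm h + 1"
      then have s: "s \<in> ?T" by (auto simp: abs_le_iff)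
      have pos: "max (F s) c > 0" using c(1) by simp
      show "\<bar>F s * q s - f s\<bar> \<le> e / 2"
      proof (cases "s \<in> C")
        case True
        then have "max (F s) c = F s" using c(2)[OF True] by (simp add: max_def)
        then show ?thesis using F_pos[OF True] e by (simp add: q_def)
      next
        case False
        have "F s * q s - f s = f s * (F s / max (F s) c - 1)" by (simp add: q_def algebra_simps)
        moreover have "\<bar>F s / max (F s) c - 1\<bar> \<le> 1"
          using F_nonneg[of s] pos by (simp add: abs_le_iff divide_le_eq_1_pos)
        ultimately have "\<bar>F s * q s - f s\<bar> \<le> \<bar>f s\<bar>" by (simp add: abs_mult mult_left_le)
        then show ?thesis using False s by (simp add: C_def)
      qed
    qed
    moreover have "fcalc h (\<lambda>s. F s * q s - f s) = fcalc h (\<lambda>s. F s * q s) - fcalc h f"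
      using c0F c0q f by (intro fcalc_diff h) (auto simp: c0fun_def intro!: continuous_intros)
    ultimately show ?thesis using e by (intro bexI[of _ "fcalc h (\<lambda>s. F s * q s)"]) (auto simp: dist_norm)
  qed
  then have "fcalc h f \<in> closure I" by (simp add: closure_approachable)
  then show ?thesis using closed_I by (simp add: closure_closed)
qed

text \<open>Tent functions isolate the nonzero points of the finite set
  \<open>spectrum_mod h\<close>. The relations between the resulting elements hold modulo
  \<open>I\<close> because the corresponding functions agree on that set. Including 0 among the
  points to avoid makes the tents vanish at 0.\<close>

lemma spectral_decomposition:
  assumes h: "h \<in> A" "star h = h"
  shows "\<exists>L q. finite L \<and> 0 \<notin> L \<and> (\<forall>\<nu>\<in>L. q \<nu> \<in> A \<and> star (q \<nu>) = q \<nu> \<and> q \<nu> \<notin> I \<and> q \<nu> * q \<nu> - q \<nu> \<in> I \<and>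
    (\<forall>\<mu>\<in>L. \<mu> \<noteq> \<nu> \<longrightarrow> q \<nu> * q \<mu> \<in> I)) \<and> h - (\<Sum>\<nu>\<in>L. \<nu> *\<^sub>R q \<nu>) \<in> I"
proof -
  let ?K = "spectrum_mod h"
  have fin: "finite ?K" by (rule finite_spectrum_mod[OF h])
  have "\<exists>e>0. \<forall>x\<in>insert 0 ?K. x \<noteq> \<nu> \<longrightarrow> e \<le> dist \<nu> x" for \<nu>
    using finite_set_avoid[of "insert 0 ?K" \<nu>] fin by auto
  then obtain e where e: "\<And>\<nu>. e \<nu> > 0" "\<And>\<nu> x. x \<in> insert 0 ?K \<Longrightarrow> x \<noteq> \<nu> \<Longrightarrow> e \<nu> \<le> \<bar>\<nu> - x\<bar>"
    unfolding dist_real_def by metis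
  define f where "f \<nu> t = max 0 (1 - \<bar>\<nu> - t\<bar> / e \<nu>)" for \<nu> t
  have f1: "f \<nu> \<nu> = 1" for \<nu> by (simp add: f_def)
  have f0: "f \<nu> x = 0" if "x \<in> insert 0 ?K" "x \<noteq> \<nu>" for \<nu> x
    using e(2)[OF that] e(1)[of \<nu>] by (simp add: f_def)
  let ?L = "?K - {0}"
  have c0: "c0fun (f \<nu>)" if "\<nu> \<in> ?L" for \<nu>
    using f0[of 0 \<nu>] that e(1)[of \<nu>] unfolding c0fun_def
    by (auto simp: f_def[abs_def] intro!: continuous_intros)
  have c0': "c0fun (\<lambda>t. f \<nu> t * f \<mu> t)" if "\<nu> \<in> ?L" "\<mu> \<in> ?L" for \<nu> \<mu>
    using c0[OF that(1)] c0[OF that(2)] by (auto simp: c0fun_def intro!: continuous_intros)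
  let ?q = "\<lambda>\<nu>. fcalc h (f \<nu>)"
  have "?q \<nu> \<in> A \<and> star (?q \<nu>) = ?q \<nu> \<and> ?q \<nu> \<notin> I \<and> ?q \<nu> * ?q \<nu> - ?q \<nu> \<in> I \<and>
    (\<forall>\<mu>\<in>?L. \<mu> \<noteq> \<nu> \<longrightarrow> ?q \<nu> * ?q \<mu> \<in> I)" if l: "\<nu> \<in> ?L" for \<nu>
  proof (intro conjI ballI impI)
    show "?q \<nu> \<in> A" by (rule ideal.fcalc_A[OF h c0[OF l]])
    show "star (?q \<nu>) = ?q \<nu>" by (rule fcalc_star[OF h(2) c0[OF l]])
    show "?q \<nu> \<notin> I"
      using l c0[OF l] f1[of \<nu>] unfolding spectrum_mod_def by force
    have "fcalc h (\<lambda>t. f \<nu> t * f \<nu> t - f \<nu> t) \<in> I"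
    proof (rule fcalc_in_I[OF h c0fun_diff[OF c0'[OF l l] c0[OF l]]])
      show "f \<nu> x * f \<nu> x - f \<nu> x = 0" if "x \<in> ?K" for x
        using f0[of x \<nu>] f1[of \<nu>] that by (cases "x = \<nu>") auto
    qed
    then show "?q \<nu> * ?q \<nu> - ?q \<nu> \<in> I"
      by (simp add: fcalc_diff[OF h(2) c0'[OF l l] c0[OF l]] fcalc_mult[OF h(2) c0[OF l] c0[OF l]])
    fix \<mu> assume m: "\<mu> \<in> ?L" "\<mu> \<noteq> \<nu>"
    have "fcalc h (\<lambda>t. f \<nu> t * f \<mu> t) \<in> I"
    proof (rule fcalc_in_I[OF h c0'[OF l m(1)]])
      show "f \<nu> x * f \<mu> x = 0" if "x \<in> ?K" for x
        using f0[of x \<nu>] f0[of x \<mu>] m(2) that by (cases "x = \<nu>") auto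
    qed
    then show "?q \<nu> * ?q \<mu> \<in> I" by (simp add: fcalc_mult[OF h(2) c0[OF l] c0[OF m(1)]])
  qed
  moreover have "h - (\<Sum>\<nu>\<in>?L. \<nu> *\<^sub>R ?q \<nu>) \<in> I"
  proof -
    have cs: "c0fun (\<lambda>t. \<nu> * f \<nu> t)" if "\<nu> \<in> ?L" for \<nu> using c0[OF that] by (rule c0fun_const_mult)
    have csum: "c0fun (\<lambda>t. \<Sum>\<nu>\<in>?L. \<nu> * f \<nu> t)" by (rule c0fun_sum[OF cs])
    have "fcalc h (\<lambda>t. t - (\<Sum>\<nu>\<in>?L. \<nu> * f \<nu> t)) \<in> I"
    proof (rule fcalc_in_I[OF h c0fun_diff[OF c0fun_id c0fun_sum[OF cs]]])
      fix x assume x: "x \<in> ?K"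
      have "(\<Sum>\<nu>\<in>?L. \<nu> * f \<nu> x) = (\<Sum>\<nu>\<in>?L. if \<nu> = x then x else 0)"
        using f0[of x] f1 x by (intro sum.cong) auto
      also have "\<dots> = x" using fin x by (simp add: sum.delta)
      finally show "x - (\<Sum>\<nu>\<in>?L. \<nu> * f \<nu> x) = 0" by simp
    qed
    moreover have "fcalc h (\<lambda>t. t - (\<Sum>\<nu>\<in>?L. \<nu> * f \<nu> t)) = h - (\<Sum>\<nu>\<in>?L. \<nu> *\<^sub>R ?q \<nu>)"
    proof -
      have "fcalc h (\<lambda>t. \<Sum>\<nu>\<in>?L. \<nu> * f \<nu> t) = (\<Sum>\<nu>\<in>?L. fcalc h (\<lambda>t. \<nu> * f \<nu> t))"
        by (rule fcalc_sum[OF h(2) cs])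
      also have "\<dots> = (\<Sum>\<nu>\<in>?L. \<nu> *\<^sub>R ?q \<nu>)"
        by (intro sum.cong refl fcalc_scale[OF h(2) c0])
      finally show ?thesis
        using fcalc_diff[OF h(2) c0fun_id csum] by (simp only: fcalc_id[OF h(2)])
    qed
    ultimately show ?thesis by simp
  qed
  ultimately show ?thesis using fin by (intro exI[of _ ?L] exI[of _ ?q]) simp
qed

end

section \<open>Finite dimension modulo a closed ideal\<close>

text \<open>From here on \<delta> and the module are gone: finite dimension modulo \<open>I\<close>
  follows from the finite spectral decompositions alone.\<close>

locale spectral_ideal = cstar_ideal A I for A :: "'b::cstar_algebra set" and I +
  assumes spectral: "h \<in> A \<Longrightarrow> star h = h \<Longrightarrow>
    \<exists>L q. finite L \<and> 0 \<notin> L \<and> (\<forall>\<nu>\<in>L. q \<nu> \<in> A \<and> star (q \<nu>) = q \<nu> \<and> q \<nu> \<notin> I \<and> q \<nu> * q \<nu> - q \<nu> \<in> I \<and>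
      (\<forall>\<mu>\<in>L. \<mu> \<noteq> \<nu> \<longrightarrow> q \<nu> * q \<mu> \<in> I)) \<and> h - (\<Sum>\<nu>\<in>L. \<nu> *\<^sub>R q \<nu>) \<in> I"
begin

definition eqv :: "'b \<Rightarrow> 'b \<Rightarrow> bool" (infix "\<simeq>" 50) where
  "x \<simeq> y \<longleftrightarrow> x - y \<in> I"

lemma eqv_refl [simp]: "x \<simeq> x"
  by (simp add: eqv_def)

lemma eqv_sym: "x \<simeq> y \<Longrightarrow> y \<simeq> x"
  using ideal_minus[of "x - y"] by (simp add: eqv_def)

lemma eqv_trans [trans]: "x \<simeq> y \<Longrightarrow> y \<simeq> z \<Longrightarrow> x \<simeq> z"
  using ideal_add[of "x - y" "y - z"] by (simp add: eqv_def)

lemma eqv_0: "x \<simeq> 0 \<longleftrightarrow> x \<in> I"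
  by (simp add: eqv_def)

lemma eqv_add: "x \<simeq> y \<Longrightarrow> x' \<simeq> y' \<Longrightarrow> x + x' \<simeq> y + y'"
  using ideal_add[of "x - y" "x' - y'"] by (simp add: eqv_def algebra_simps)

lemma eqv_diff: "x \<simeq> y \<Longrightarrow> x' \<simeq> y' \<Longrightarrow> x - x' \<simeq> y - y'"
  using ideal_diff[of "x - y" "x' - y'"] by (simp add: eqv_def algebra_simps)

lemma eqv_minus: "x \<simeq> y \<Longrightarrow> - x \<simeq> - y"
  using eqv_diff[of 0 0 x y] by simp

lemma eqv_scaleR: "x \<simeq> y \<Longrightarrow> r *\<^sub>R x \<simeq> r *\<^sub>R y"
  using ideal_scaleR[of "x - y" r] by (simp add: eqv_def scaleR_diff_right)

lemma eqv_sum: "(\<And>i. i \<in> S \<Longrightarrow> F i \<simeq> G i) \<Longrightarrow> sum F S \<simeq> sum G S"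
  using ideal_sum[of S "\<lambda>i. F i - G i"] by (simp add: eqv_def sum_subtractf)

lemma eqv_left: "x \<simeq> y \<Longrightarrow> a \<in> A \<Longrightarrow> a * x \<simeq> a * y"
  using ideal_left[of "x - y" a] by (simp add: eqv_def right_diff_distrib)

lemma eqv_right: "x \<simeq> y \<Longrightarrow> a \<in> A \<Longrightarrow> x * a \<simeq> y * a"
  using ideal_right[of "x - y" a] by (simp add: eqv_def left_diff_distrib)

lemma eqv_star: "x \<simeq> y \<Longrightarrow> star x \<simeq> star y"
  using ideal_star[of "x - y"] by (simp add: eqv_def star_diff)

lemma eqv_cancel: "r *\<^sub>R x \<simeq> 0 \<Longrightarrow> r \<noteq> 0 \<Longrightarrow> x \<simeq> 0"
  using eqv_scaleR[of "r *\<^sub>R x" 0 "1 / r"] by simp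

section \<open>Projections modulo \<open>I\<close>\<close>

text \<open>A nonzero projection of A/I, represented by an element that is self-adjoint exactly, not
  just modulo \<open>I\<close>, so that the spectral hypothesis applies to combinations of such
  elements.\<close>

definition proj :: "'b \<Rightarrow> bool" where
  "proj e \<longleftrightarrow> e \<in> A \<and> star e = e \<and> e * e \<simeq> e \<and> e \<notin> I"

lemma projD: "proj e \<Longrightarrow> e \<in> A" "proj e \<Longrightarrow> star e = e" "proj e \<Longrightarrow> e * e \<simeq> e" "proj e \<Longrightarrow> e \<notin> I"
  by (simp_all add: proj_def)

lemma eqv_star_mult: "star e = e \<Longrightarrow> star x = x \<Longrightarrow> e * x \<simeq> y \<Longrightarrow> x * e \<simeq> star y"
  using eqv_star[of "e * x" y] by (simp add: star_mult)

definition spectral_family :: "'b \<Rightarrow> real set \<Rightarrow> (real \<Rightarrow> 'b) \<Rightarrow> bool" where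
  "spectral_family h L q \<longleftrightarrow> finite L \<and> 0 \<notin> L \<and> (\<forall>\<nu>\<in>L. proj (q \<nu>) \<and> h * q \<nu> \<simeq> \<nu> *\<^sub>R q \<nu>) \<and>
    (\<forall>\<nu>\<in>L. \<forall>\<mu>\<in>L. \<mu> \<noteq> \<nu> \<longrightarrow> q \<nu> * q \<mu> \<simeq> 0) \<and> h \<simeq> (\<Sum>\<nu>\<in>L. \<nu> *\<^sub>R q \<nu>)"

lemma spectral_familyD:
  assumes "spectral_family h L q"
  shows "finite L" "0 \<notin> L" "\<And>\<nu>. \<nu> \<in> L \<Longrightarrow> proj (q \<nu>)" "\<And>\<nu>. \<nu> \<in> L \<Longrightarrow> h * q \<nu> \<simeq> \<nu> *\<^sub>R q \<nu>"
    "\<And>\<nu> \<mu>. \<nu> \<in> L \<Longrightarrow> \<mu> \<in> L \<Longrightarrow> \<mu> \<noteq> \<nu> \<Longrightarrow> q \<nu> * q \<mu> \<simeq> 0" "h \<simeq> (\<Sum>\<nu>\<in>L. \<nu> *\<^sub>R q \<nu>)"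
  using assms by (simp_all add: spectral_family_def)

lemma spectral_family_exists:
  assumes h: "h \<in> A" "star h = h"
  shows "\<exists>L q. spectral_family h L q"
proof -
  obtain L q where *: "finite L \<and> 0 \<notin> L \<and> (\<forall>\<nu>\<in>L. q \<nu> \<in> A \<and> star (q \<nu>) = q \<nu> \<and> q \<nu> \<notin> I \<and>
      q \<nu> * q \<nu> - q \<nu> \<in> I \<and> (\<forall>\<mu>\<in>L. \<mu> \<noteq> \<nu> \<longrightarrow> q \<nu> * q \<mu> \<in> I)) \<and> h - (\<Sum>\<nu>\<in>L. \<nu> *\<^sub>R q \<nu>) \<in> I"
    using spectral[OF h] by blast
  then have L: "finite L" "0 \<notin> L" and q: "\<And>\<nu>. \<nu> \<in> L \<Longrightarrow> proj (q \<nu>)"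
    "\<And>\<nu> \<mu>. \<nu> \<in> L \<Longrightarrow> \<mu> \<in> L \<Longrightarrow> \<mu> \<noteq> \<nu> \<Longrightarrow> q \<nu> * q \<mu> \<simeq> 0"
    and hq: "h \<simeq> (\<Sum>\<nu>\<in>L. \<nu> *\<^sub>R q \<nu>)"
    by (simp_all add: proj_def eqv_def)
  have "h * q \<nu> \<simeq> \<nu> *\<^sub>R q \<nu>" if n: "\<nu> \<in> L" for \<nu>
  proof -
    have "h * q \<nu> \<simeq> (\<Sum>\<mu>\<in>L. \<mu> *\<^sub>R q \<mu>) * q \<nu>" by (rule eqv_right[OF hq projD(1)[OF q(1)[OF n]]])
    also have "\<dots> = (\<Sum>\<mu>\<in>L. \<mu> *\<^sub>R (q \<mu> * q \<nu>))" by (simp add: sum_distrib_right)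
    also have "\<dots> \<simeq> (\<Sum>\<mu>\<in>L. if \<mu> = \<nu> then \<nu> *\<^sub>R q \<nu> else 0)"
    proof (rule eqv_sum)
      fix \<mu> assume m: "\<mu> \<in> L"
      show "\<mu> *\<^sub>R (q \<mu> * q \<nu>) \<simeq> (if \<mu> = \<nu> then \<nu> *\<^sub>R q \<nu> else 0)"
        using eqv_scaleR[OF projD(3)[OF q(1)[OF n]], of \<nu>] eqv_scaleR[OF q(2)[OF m n], of \<mu>] by auto
    qed
    also have "\<dots> = \<nu> *\<^sub>R q \<nu>" using L n by (simp add: sum.delta)
    finally show ?thesis .
  qed
  then have "spectral_family h L q" using L q hq by (simp add: spectral_family_def)
  then show ?thesis by blast
qed

text \<open>Since q is (1/\<nu>) h q modulo \<open>I\<close>, whatever \<open>e\<close> does to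
  \<open>h\<close> it does to \<open>q\<close>. Used with c = 1 for projections below
  \<open>e\<close> and with c = 0 for orthogonality.\<close>

lemma spectral_projection_absorb:
  assumes e: "e \<in> A" and h: "h \<in> A" and q: "q \<in> A" and hq: "h * q \<simeq> \<nu> *\<^sub>R q" "\<nu> \<noteq> 0" and eh: "e * h \<simeq> c *\<^sub>R h"
  shows "e * q \<simeq> c *\<^sub>R q"
proof -
  have "q \<simeq> (1 / \<nu>) *\<^sub>R (h * q)" using eqv_scaleR[OF eqv_sym[OF hq(1)], of "1 / \<nu>"] hq(2) by simp
  from eqv_left[OF this e] have "e * q \<simeq> (1 / \<nu>) *\<^sub>R (e * h * q)" by (simp add: mult.assoc)
  also have "\<dots> \<simeq> (1 / \<nu>) *\<^sub>R (c *\<^sub>R h * q)" by (intro eqv_scaleR eqv_right eh q)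
  also have "\<dots> = (c / \<nu>) *\<^sub>R (h * q)" by simp
  also have "\<dots> \<simeq> (c / \<nu>) *\<^sub>R (\<nu> *\<^sub>R q)" by (rule eqv_scaleR[OF hq(1)])
  also have "\<dots> = c *\<^sub>R q" using hq(2) by simp
  finally show ?thesis .
qed

definition minimal :: "'b \<Rightarrow> bool" where
  "minimal e \<longleftrightarrow> proj e \<and> (\<forall>f. proj f \<longrightarrow> e * f \<simeq> f \<longrightarrow> f \<simeq> e)"

text \<open>Every spectral projection of \<open>h\<close> lies below \<open>e\<close>, hence equals
  \<open>e\<close> modulo \<open>I\<close>. Two of them would be both equal and orthogonal, so there
  is at most one.\<close>

lemma minimal_scalar:
  assumes e: "minimal e" and h: "h \<in> A" "star h = h" "e * h \<simeq> h"
  shows "\<exists>c. h \<simeq> c *\<^sub>R e"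
proof -
  have pe: "proj e" using e by (simp add: minimal_def)
  obtain L q where "spectral_family h L q" using spectral_family_exists[OF h(1,2)] by blast
  note L = spectral_familyD(1,2)[OF this] and q = spectral_familyD(3,5)[OF this] and hq = spectral_familyD(6,4)[OF this]
  have qe: "q \<nu> \<simeq> e" if n: "\<nu> \<in> L" for \<nu>
  proof -
    have "\<nu> \<noteq> 0" using L n by auto
    have "e * h \<simeq> 1 *\<^sub>R h" using h(3) by (simp only: scaleR_one)
    from spectral_projection_absorb[OF projD(1)[OF pe] h(1) projD(1)[OF q(1)[OF n]] hq(2)[OF n] \<open>\<nu> \<noteq> 0\<close> this]
    have "e * q \<nu> \<simeq> q \<nu>" by simp
    then show ?thesis using e q(1)[OF n] by (simp add: minimal_def)
  qed
  have single: "\<mu> = \<nu>" if "\<mu> \<in> L" "\<nu> \<in> L" for \<mu> \<nu>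
  proof (rule ccontr)
    assume "\<mu> \<noteq> \<nu>"
    then have "0 \<simeq> q \<nu> * q \<mu>" using q(2)[of \<nu> \<mu>] that by (simp add: eqv_sym)
    also have "\<dots> \<simeq> e * q \<mu>" by (rule eqv_right[OF qe[OF that(2)] projD(1)[OF q(1)[OF that(1)]]])
    also have "\<dots> \<simeq> e * e" by (rule eqv_left[OF qe[OF that(1)] projD(1)[OF pe]])
    also have "\<dots> \<simeq> e" by (rule projD(3)[OF pe])
    finally show False using projD(4)[OF pe] eqv_sym eqv_0 by blast
  qed
  show ?thesis
  proof (cases "L = {}")
    case True
    then show ?thesis using hq(1) by (intro exI[of _ 0]) simp
  next
    case False
    then obtain \<nu> where n: "\<nu> \<in> L" by blast
    then have "L = {\<nu>}" using single by blast
    then have "h \<simeq> \<nu> *\<^sub>R q \<nu>" using hq(1) by simp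
    also have "\<dots> \<simeq> \<nu> *\<^sub>R e" by (rule eqv_scaleR[OF qe[OF n]])
    finally show ?thesis by blast
  qed
qed

text \<open>Each positive weight of h = \<Sum> w_n d_n is an eigenvalue modulo \<open>I\<close>,
  hence occurs in the finite set \<open>L\<close>. But the weights are at most 2^(-n), so they have
  no positive minimum.\<close>

lemma no_infinite_orthogonal:
  fixes d :: "nat \<Rightarrow> 'b"
  assumes d: "\<And>n. proj (d n)" and orth: "\<And>m n. m \<noteq> n \<Longrightarrow> d m * d n \<simeq> 0"
  shows False
proof -
  note dA = projD(1)[OF d]
  define w where "w n = (1/2) ^ n / (1 + norm (d n))" for n :: nat
  have pos: "1 + norm (d n) > 0" for n by (rule add_pos_nonneg) auto
  have w: "w n > 0" for n using pos by (simp add: w_def)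
  have w_le: "w n \<le> (1/2) ^ n" for n using pos[of n] by (simp add: w_def divide_le_eq mult_left_le)
  have "summable (\<lambda>n. w n *\<^sub>R d n)"
  proof (rule summable_comparison_test'[where N = 0])
    show "summable (\<lambda>k. (1/2::real) ^ k)" by (rule summable_geometric) simp
    show "norm (w n *\<^sub>R d n) \<le> (1/2) ^ n" for n
      using pos[of n] by (simp add: w_def divide_le_eq mult_left_mono)
  qed
  define h where "h = (\<Sum>n. w n *\<^sub>R d n)"
  define S where "S N = (\<Sum>n<N. w n *\<^sub>R d n)" for N
  have S: "S \<longlonglongrightarrow> h" unfolding S_def h_def by (rule summable_LIMSEQ) fact
  have hA: "h \<in> A"
    by (rule closed_sequentially[OF closed_A _ S]) (auto simp: S_def intro!: subspace_sum[OF subspace_A] scaleR_A dA)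
  have "star (S N) = S N" for N
    unfolding S_def by (induction N) (simp_all add: star_add star_scaleR projD(2)[OF d])
  moreover have "(\<lambda>N. star (S N)) \<longlonglongrightarrow> star h" by (rule bounded_linear.tendsto[OF bounded_linear_star S])
  ultimately have hs: "star h = h" using S LIMSEQ_unique by simp
  have hd: "h * d m \<simeq> w m *\<^sub>R d m" for m
  proof -
    have "(\<lambda>N. S N * d m - w m *\<^sub>R d m) \<longlonglongrightarrow> h * d m - w m *\<^sub>R d m" by (intro tendsto_intros S)
    then have "(\<lambda>N. S (N + Suc m) * d m - w m *\<^sub>R d m) \<longlonglongrightarrow> h * d m - w m *\<^sub>R d m" by (rule LIMSEQ_ignore_initial_segment)
    moreover have "S (N + Suc m) * d m - w m *\<^sub>R d m \<in> I" for N
    proof -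
      have "S (N + Suc m) * d m = (\<Sum>n<N + Suc m. w n *\<^sub>R (d n * d m))"
        unfolding S_def sum_distrib_right by (simp only: mult_scaleR_left)
      also have "\<dots> \<simeq> (\<Sum>n<N + Suc m. if n = m then w m *\<^sub>R d m else 0)"
      proof (rule eqv_sum)
        fix n
        show "w n *\<^sub>R (d n * d m) \<simeq> (if n = m then w m *\<^sub>R d m else 0)"
          using eqv_scaleR[OF projD(3)[OF d[of m]], of "w m"] eqv_scaleR[OF orth[of n m], of "w n"] by auto
      qed
      also have "\<dots> = w m *\<^sub>R d m" by (simp add: sum.delta)
      finally show ?thesis by (simp add: eqv_def)
    qed
    ultimately show ?thesis unfolding eqv_def by (rule ideal_limit[rotated])
  qed
  obtain L q where "spectral_family h L q" using spectral_family_exists[OF hA hs] by blast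
  note L = spectral_familyD(1,2)[OF this] and q = spectral_familyD(3)[OF this] and hq = spectral_familyD(6,4)[OF this]
  have "w m \<in> L" for m
  proof (rule ccontr)
    assume notin: "w m \<notin> L"
    have qd: "q \<nu> * d m \<simeq> 0" if n: "\<nu> \<in> L" for \<nu>
    proof -
      note qA = projD(1)[OF q[OF n]]
      \<comment> \<open>Eigenvectors for different eigenvalues are orthogonal: evaluating
        \<open>q \<nu> * h * d m\<close> from both sides forces \<open>q \<nu> * d m\<close> into
        \<open>I\<close>.\<close>
      have "q \<nu> * h \<simeq> \<nu> *\<^sub>R q \<nu>"
        using eqv_star[OF hq(2)[OF n]] by (simp add: star_mult star_scaleR hs projD(2)[OF q[OF n]])
      from eqv_right[OF this dA[of m]] have 1: "q \<nu> * h * d m \<simeq> \<nu> *\<^sub>R (q \<nu> * d m)" by simp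
      have 2: "q \<nu> * h * d m \<simeq> w m *\<^sub>R (q \<nu> * d m)"
        using eqv_left[OF hd[of m] qA] by (simp add: mult.assoc)
      have "(\<nu> - w m) *\<^sub>R (q \<nu> * d m) \<simeq> 0"
        using eqv_diff[OF eqv_sym[OF 1] eqv_sym[OF 2]] by (simp add: scaleR_diff_left)
      then show ?thesis by (rule eqv_cancel) (use notin n in auto)
    qed
    have "w m *\<^sub>R d m \<simeq> h * d m" by (rule eqv_sym[OF hd])
    also have "\<dots> \<simeq> (\<Sum>\<nu>\<in>L. \<nu> *\<^sub>R q \<nu>) * d m" by (rule eqv_right[OF hq(1) dA])
    also have "\<dots> = (\<Sum>\<nu>\<in>L. \<nu> *\<^sub>R (q \<nu> * d m))" by (simp add: sum_distrib_right)
    also have "\<dots> \<simeq> (\<Sum>\<nu>\<in>L. 0)"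
    proof (rule eqv_sum)
      show "\<nu> *\<^sub>R (q \<nu> * d m) \<simeq> 0" if "\<nu> \<in> L" for \<nu> using eqv_scaleR[OF qd[OF that], of \<nu>] by simp
    qed
    finally have "d m \<simeq> 0" using eqv_cancel[of "w m" "d m"] w[of m] by simp
    then show False using projD(4)[OF d[of m]] by (simp add: eqv_0)
  qed
  then have fin: "finite (range w)" using L(1) by (meson finite_subset image_subsetI)
  define c where "c = Min (range w)"
  have c: "c > 0" "\<And>n. c \<le> w n" unfolding c_def using fin w by (auto simp: Min_gr_iff)
  obtain n where "(1/2::real) ^ n < c" using real_arch_pow_inv[OF c(1), of "1/2"] by auto
  then show False using c(2)[of n] w_le[of n] by linarith
qed

text \<open>Otherwise there is a strictly decreasing sequence of projections, and its successive
  differences are infinitely many orthogonal projections.\<close>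

lemma minimal_below:
  assumes e: "proj e"
  shows "\<exists>f. minimal f \<and> e * f \<simeq> f"
proof (rule ccontr)
  assume neg: "\<not> ?thesis"
  have "\<exists>d. \<forall>n. (proj (d n) \<and> e * d n \<simeq> d n) \<and> (d n * d (Suc n) \<simeq> d (Suc n) \<and> \<not> d (Suc n) \<simeq> d n)"
  proof (rule dependent_nat_choice)
    show "\<exists>x. proj x \<and> e * x \<simeq> x" using e projD(3) by blast
    fix x n assume x: "proj x \<and> e * x \<simeq> x"
    then obtain f where f: "proj f" "x * f \<simeq> f" "\<not> f \<simeq> x" using neg unfolding minimal_def by blast
    have "e * f \<simeq> e * (x * f)" by (rule eqv_left[OF eqv_sym[OF f(2)] projD(1)[OF e]])
    also have "\<dots> = e * x * f" by (simp add: mult.assoc)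
    also have "\<dots> \<simeq> x * f" using x f by (intro eqv_right) (auto simp: projD)
    also have "\<dots> \<simeq> f" by (rule f(2))
    finally show "\<exists>y. (proj y \<and> e * y \<simeq> y) \<and> (x * y \<simeq> y \<and> \<not> y \<simeq> x)" using f by blast
  qed
  then obtain d where d: "\<And>n. proj (d n)" and dd: "\<And>n. d n * d (Suc n) \<simeq> d (Suc n)"
    and ne: "\<And>n. \<not> d (Suc n) \<simeq> d n" by blast
  note dA = projD(1)[OF d] and ds = projD(2)[OF d]
  have le: "d m * d n \<simeq> d n" if "m \<le> n" for m n
    using that
  proof (induction n rule: dec_induct)
    case base
    then show ?case by (rule projD(3)[OF d])
  next
    case (step n)
    have "d m * d (Suc n) \<simeq> d m * (d n * d (Suc n))" by (rule eqv_left[OF eqv_sym[OF dd] dA])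
    also have "\<dots> = d m * d n * d (Suc n)" by (simp add: mult.assoc)
    also have "\<dots> \<simeq> d n * d (Suc n)" by (rule eqv_right[OF step.IH dA])
    also have "\<dots> \<simeq> d (Suc n)" by (rule dd)
    finally show ?case .
  qed
  have ge: "d n * d m \<simeq> d n" if "m \<le> n" for m n
    using eqv_star_mult[OF ds ds le[OF that]] by (simp add: ds)
  define p where "p n = d n - d (Suc n)" for n
  have "proj (p n)" for n
  proof -
    have "p n * p n = (d n * d n - d n * d (Suc n)) - (d (Suc n) * d n - d (Suc n) * d (Suc n))"
      by (simp add: p_def algebra_simps)
    also have "\<dots> \<simeq> (d n - d (Suc n)) - (d (Suc n) - d (Suc n))"
      by (intro eqv_diff le ge) auto
    finally have "p n * p n \<simeq> p n" by (simp add: p_def)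
    moreover have "p n \<notin> I" using ne[of n] eqv_sym unfolding p_def eqv_def[symmetric] by blast
    ultimately show ?thesis by (simp add: proj_def p_def dA ds star_diff)
  qed
  moreover have orth: "p m * p n \<simeq> 0" if "m < n" for m n
  proof -
    have "p m * p n = (d m * d n - d m * d (Suc n)) - (d (Suc m) * d n - d (Suc m) * d (Suc n))"
      by (simp add: p_def algebra_simps)
    also have "\<dots> \<simeq> (d n - d (Suc n)) - (d n - d (Suc n))"
      using that by (intro eqv_diff le) auto
    finally show ?thesis by simp
  qed
  have ps: "star (p n) = p n" for n by (simp add: p_def star_diff ds)
  have "p m * p n \<simeq> 0" if "m \<noteq> n" for m n
    using orth[of m n] eqv_star_mult[OF ps ps orth[of n m]] that by (cases "m < n") auto
  ultimately show False by (rule no_infinite_orthogonal)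
qed

text \<open>Without such a family, a finite orthogonal family of minimal projections could always be
  enlarged, and the enlargement could be iterated to an infinite sequence.\<close>

lemma maximal_orthogonal_family:
  "\<exists>F. finite F \<and> (\<forall>e\<in>F. minimal e) \<and> (\<forall>e\<in>F. \<forall>f\<in>F. e \<noteq> f \<longrightarrow> e * f \<simeq> 0) \<and>
    (\<forall>f. minimal f \<longrightarrow> (\<exists>e\<in>F. \<not> e * f \<simeq> 0))"
proof (rule ccontr)
  assume neg: "\<not> ?thesis"
  have ext: "\<exists>f. minimal f \<and> (\<forall>e\<in>F. e * f \<simeq> 0)"
    if F: "finite F" "\<forall>e\<in>F. minimal e" "\<forall>e\<in>F. \<forall>f\<in>F. e \<noteq> f \<longrightarrow> e * f \<simeq> 0" for F
  proof (rule ccontr)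
    assume "\<not> ?thesis"
    then have max: "\<forall>f. minimal f \<longrightarrow> (\<exists>e\<in>F. \<not> e * f \<simeq> 0)" by blast
    show False by (rule notE[OF neg exI[of _ F]]) (rule conjI[OF F(1) conjI[OF F(2) conjI[OF F(3) max]]])
  qed
  have flip: "f * e \<simeq> 0" if "minimal e" "minimal f" "e * f \<simeq> 0" for e f
    using eqv_star_mult[of e f 0] that by (simp add: minimal_def projD)
  have "\<exists>d :: nat \<Rightarrow> 'b. \<forall>n. minimal (d n) \<and> (\<forall>m<n. d m * d n \<simeq> 0)"
  proof (rule dependent_wellorder_choice[where P = "\<lambda>d n r. minimal r \<and> (\<forall>m<n. d m * r \<simeq> 0)"])
    show "\<exists>r. minimal r \<and> (\<forall>m<n. d m * r \<simeq> 0)"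
      if d: "\<And>y. y < n \<Longrightarrow> minimal (d y) \<and> (\<forall>m<y. d m * d y \<simeq> 0)" for n :: nat and d
    proof -
      have "d i * d j \<simeq> 0" if "i < n" "j < n" "d i \<noteq> d j" for i j
      proof (cases "i < j")
        case False
        then have "j < i" using that(3) by (metis linorder_neqE_nat)
        then show ?thesis using d[OF that(1)] d[OF that(2)] flip by blast
      qed (use d[OF that(2)] in blast)
      then show ?thesis using ext[of "d ` {..<n}"] d by auto
    qed
  qed auto
  then obtain d :: "nat \<Rightarrow> 'b" where d: "\<And>n. minimal (d n)" "\<And>m n. m < n \<Longrightarrow> d m * d n \<simeq> 0" by blast
  have "d m * d n \<simeq> 0" if "m \<noteq> n" for m n
    using that d flip by (metis linorder_neqE_nat)
  then show False using no_infinite_orthogonal[of d] d(1) by (simp add: minimal_def)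
qed

text \<open>The sum of a maximal family is a unit modulo \<open>I\<close>. If x = a - \<Sum>F a were
  not in \<open>I\<close>, a spectral projection of \<open>x * star x\<close> would have a minimal
  projection below it, orthogonal to all of \<open>F\<close>.\<close>

lemma eqv_family_mult:
  assumes F: "finite F" "\<forall>e\<in>F. minimal e" "\<forall>e\<in>F. \<forall>f\<in>F. e \<noteq> f \<longrightarrow> e * f \<simeq> 0"
    and max: "\<forall>f. minimal f \<longrightarrow> (\<exists>e\<in>F. \<not> e * f \<simeq> 0)" and a: "a \<in> A"
  shows "a \<simeq> \<Sum>F * a"
proof -
  have pF: "proj e" if "e \<in> F" for e using F(2) that by (simp add: minimal_def)
  have EA: "\<Sum>F \<in> A" by (intro subspace_sum[OF subspace_A] projD(1) pF)
  let ?x = "a - \<Sum>F * a"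
  have xA: "?x \<in> A" using a EA by simp
  have ex: "e * ?x \<simeq> 0" if e: "e \<in> F" for e
  proof -
    have "e * \<Sum>F = (\<Sum>f\<in>F. e * f)" by (simp add: sum_distrib_left)
    also have "\<dots> \<simeq> (\<Sum>f\<in>F. if f = e then e else 0)"
    proof (rule eqv_sum)
      show "e * f \<simeq> (if f = e then e else 0)" if "f \<in> F" for f
        using F(3) e that projD(3)[OF pF[OF e]] by auto
    qed
    also have "\<dots> = e" using F(1) e by (simp add: sum.delta)
    finally have "e * \<Sum>F * a \<simeq> e * a" using a by (rule eqv_right)
    from eqv_diff[OF eqv_refl[of "e * a"] this] show ?thesis by (simp add: right_diff_distrib mult.assoc)
  qed
  let ?u = "?x * star ?x"
  have u: "?u \<in> A" "star ?u = ?u" using xA by (simp_all add: star_mult star_star)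
  have "?u \<in> I"
  proof (rule ccontr)
    assume notin: "?u \<notin> I"
    obtain L q where "spectral_family ?u L q" using spectral_family_exists[OF u] by blast
    note L = spectral_familyD(2)[OF this] and q = spectral_familyD(3)[OF this] and uq = spectral_familyD(6,4)[OF this]
    have "L \<noteq> {}" using uq(1) notin by (auto simp: eqv_0)
    then obtain \<nu> where n: "\<nu> \<in> L" by blast
    then have n0: "\<nu> \<noteq> 0" using L by auto
    obtain f where f: "minimal f" "q \<nu> * f \<simeq> f" using minimal_below[OF q[OF n]] by blast
    have fA: "f \<in> A" using f(1) by (simp add: minimal_def projD)
    have "e * f \<simeq> 0" if e: "e \<in> F" for e
    proof -
      note eA = projD(1)[OF pF[OF e]]
      have "e * ?u \<simeq> 0 *\<^sub>R ?u" using eqv_right[OF ex[OF e] star_A[OF xA]] by (simp add: mult.assoc)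
      from spectral_projection_absorb[OF eA u(1) projD(1)[OF q[OF n]] uq(2)[OF n] n0 this]
      have "e * q \<nu> \<simeq> 0" by simp
      from eqv_right[OF this fA] have "e * (q \<nu> * f) \<simeq> 0" by (simp add: mult.assoc)
      moreover have "e * (q \<nu> * f) \<simeq> e * f" by (rule eqv_left[OF f(2) eA])
      ultimately show ?thesis using eqv_sym eqv_trans by blast
    qed
    then show False using max f(1) by blast
  qed
  then have "star ?x \<in> I" using ideal_star_mult_self[OF star_A[OF xA]] by (simp only: star_star)
  then have "?x \<in> I" using ideal_star[of "star ?x"] by (simp only: star_star)
  then show ?thesis by (simp add: eqv_def)
qed

section \<open>Corners of minimal projections\<close>

definition corner :: "'b \<Rightarrow> 'b \<Rightarrow> 'b set" where
  "corner e f = {x\<in>A. e * x \<simeq> x \<and> x * f \<simeq> x}"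

definition finite_mod :: "'b set \<Rightarrow> bool" where
  "finite_mod V \<longleftrightarrow> (\<exists>B. finite B \<and> B \<subseteq> A \<and> (\<forall>x\<in>V. \<exists>y\<in>span B. x \<simeq> y))"

lemma square_scalar:
  assumes e: "minimal e" and k: "k \<in> A" "star k = - k" "e * k \<simeq> k" "k \<notin> I"
  shows "\<exists>p. p \<noteq> 0 \<and> k * k \<simeq> p *\<^sub>R e"
proof -
  have "e * (k * k) \<simeq> k * k" using eqv_right[OF k(3) k(1)] by (simp add: mult.assoc)
  then obtain p where p: "k * k \<simeq> p *\<^sub>R e"
    using minimal_scalar[OF e, of "k * k"] k by (auto simp: star_mult)
  have "p \<noteq> 0"
  proof
    assume "p = 0"
    then have "k * k \<in> I" using p by (simp add: eqv_0)
    then have "star k * k \<in> I" using k(2) ideal_minus by simp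
    then show False using ideal_star_mult_self[OF k(1)] k(4) by blast
  qed
  then show ?thesis using p by blast
qed

text \<open>
  Modulo \<open>I\<close> the corner of a minimal projection is a division algebra whose self-adjoint part is
  one-dimensional; anticommuting skew elements \<open>k, l\<close> generate the skew part, as for the quaternions.
\<close>

lemma finite_mod_corner:
  assumes e: "minimal e"
  shows "finite_mod (corner e e)"
proof -
  have pe: "proj e" using e by (simp add: minimal_def)
  note eA = projD(1)[OF pe] and es = projD(2)[OF pe]
  define V where "V = {k\<in>A. star k = - k \<and> e * k \<simeq> k}"
  have VA: "k \<in> A" if "k \<in> V" for k using that by (simp add: V_def)
  have Ve: "e * k \<simeq> k" if "k \<in> V" for k using that by (simp add: V_def)
  have Vs: "star k = - k" if "k \<in> V" for k using that by (simp add: V_def)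
  have Ve': "k * e \<simeq> k" if "k \<in> V" for k
    using eqv_minus[OF eqv_star[OF Ve[OF that]]] by (simp add: star_mult Vs[OF that] es)
  have V_comb: "k - r *\<^sub>R l \<in> V" if "k \<in> V" "l \<in> V" for k l r
    using that eqv_diff[OF Ve[OF that(1)] eqv_scaleR[OF Ve[OF that(2)], of r]]
    by (simp add: V_def star_diff star_scaleR right_diff_distrib)
  have anti: "\<exists>c. k * l + l * k \<simeq> c *\<^sub>R e" if k: "k \<in> V" and l: "l \<in> V" for k l
  proof (rule minimal_scalar[OF e])
    show "k * l + l * k \<in> A" using k l VA by simp
    show "star (k * l + l * k) = k * l + l * k" by (simp add: star_add star_mult Vs k l)
    show "e * (k * l + l * k) \<simeq> k * l + l * k"
      using eqv_add[OF eqv_right[OF Ve[OF k] VA[OF l]] eqv_right[OF Ve[OF l] VA[OF k]]]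
      by (simp add: distrib_left mult.assoc)
  qed
  have split: "\<exists>r. k * (l - r *\<^sub>R k) + (l - r *\<^sub>R k) * k \<simeq> 0"
    if k: "k \<in> V" "k \<notin> I" and l: "l \<in> V" for k l
  proof -
    obtain p where p: "p \<noteq> 0" "k * k \<simeq> p *\<^sub>R e"
      using square_scalar[OF e VA Vs Ve] k by blast
    obtain c where c: "k * l + l * k \<simeq> c *\<^sub>R e" using anti[OF k(1) l] by blast
    \<comment> \<open>A Gram-Schmidt step for the anticommutator, which takes values in multiples of
      \<open>e\<close> on the skew part; k pairs with itself to 2 p e.\<close>
    let ?r = "c / (2 * p)"
    have "k * (l - ?r *\<^sub>R k) + (l - ?r *\<^sub>R k) * k = (k * l + l * k) - (2 * ?r) *\<^sub>R (k * k)"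
    proof -
      have "(2 * ?r) *\<^sub>R (k * k) = ?r *\<^sub>R (k * k) + ?r *\<^sub>R (k * k)" by (simp add: scaleR_add_left[symmetric])
      then show ?thesis by (simp add: algebra_simps)
    qed
    also have "\<dots> \<simeq> c *\<^sub>R e - (2 * ?r) *\<^sub>R (p *\<^sub>R e)" by (intro eqv_diff eqv_scaleR c p)
    also have "\<dots> = 0" using p(1) by simp
    finally show ?thesis by blast
  qed
  have "finite_mod V"
  \<comment> \<open>The three cases correspond to the reals (no skew element outside
    \<open>I\<close>), the complex numbers (one up to scalars) and the quaternions.\<close>
  proof (cases "V \<subseteq> I")
    case True
    then show ?thesis unfolding finite_mod_def by (intro exI[of _ "{}"]) (auto simp: eqv_0)
  next
    case False
    then obtain k where k: "k \<in> V" "k \<notin> I" by blast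
    define V1 where "V1 = {l\<in>V. k * l + l * k \<simeq> 0}"
    show ?thesis
    proof (cases "V1 \<subseteq> I")
      case True
      have "\<exists>y\<in>span {k}. l \<simeq> y" if l: "l \<in> V" for l
      proof -
        obtain r where "k * (l - r *\<^sub>R k) + (l - r *\<^sub>R k) * k \<simeq> 0" using split[OF k l] by blast
        then have "l - r *\<^sub>R k \<in> I" using True V_comb[OF l k(1)] by (auto simp: V1_def)
        then show ?thesis by (intro bexI[of _ "r *\<^sub>R k"]) (auto simp: eqv_def span_base span_scale)
      qed
      then show ?thesis unfolding finite_mod_def using VA[OF k(1)] by (intro exI[of _ "{k}"]) auto
    next
      case False
      then obtain l where l: "l \<in> V" "k * l + l * k \<simeq> 0" "l \<notin> I" by (auto simp: V1_def)
      note kA = VA[OF k(1)] and lA = VA[OF l(1)]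
      obtain p where p: "p \<noteq> 0" "k * k \<simeq> p *\<^sub>R e" using square_scalar[OF e VA Vs Ve] k by blast
      obtain r where r: "r \<noteq> 0" "l * l \<simeq> r *\<^sub>R e" using square_scalar[OF e VA Vs Ve] l by blast
      have quaternion: "\<exists>c. m \<simeq> c *\<^sub>R (l * k)" if m: "m \<in> V" and km: "k * m + m * k \<simeq> 0" and lm: "l * m + m * l \<simeq> 0" for m
      proof -
        note mA = VA[OF m]
        have km': "k * m \<simeq> - (m * k)" and lm': "l * m \<simeq> - (m * l)" and lk': "l * k \<simeq> - (k * l)"
          using km lm l(2) by (simp_all add: eqv_def algebra_simps)
        \<comment> \<open>Reversing three anticommuting skew factors costs three swaps and three
          signs from the star, so the product is self-adjoint modulo \<open>I\<close> and therefore
          a multiple of \<open>e\<close>. Multiplying it by \<open>l * k\<close> gives back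
          \<open>m\<close> up to the factor \<open>r * p\<close>.\<close>
        let ?x = "m * k * l"
        have xA: "?x \<in> A" using mA kA lA by simp
        have "star ?x = - (l * (k * m))" by (simp add: star_mult Vs k(1) l(1) m mult.assoc)
        also have "\<dots> \<simeq> - (l * - (m * k))" by (intro eqv_minus eqv_left km' lA)
        also have "\<dots> = l * m * k" by (simp add: mult.assoc)
        also have "\<dots> \<simeq> - (m * l) * k" by (rule eqv_right[OF lm' kA])
        also have "\<dots> = - (m * (l * k))" by (simp add: mult.assoc)
        also have "\<dots> \<simeq> - (m * - (k * l))" by (intro eqv_minus eqv_left lk' mA)
        also have "\<dots> = ?x" by (simp add: mult.assoc)
        finally have xs: "star ?x \<simeq> ?x" .
        \<comment> \<open>An exactly self-adjoint representative, as \<open>minimal_scalar\<close>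
          requires.\<close>
        let ?h = "(1/2) *\<^sub>R (?x + star ?x)"
        have hx: "?h \<simeq> ?x"
          using eqv_scaleR[OF eqv_add[OF eqv_refl[of ?x] xs], of "1/2"] by (simp add: scaleR_2[symmetric])
        have ex: "e * ?x \<simeq> ?x" using eqv_right[OF Ve[OF m], of "k * l"] kA lA by (simp add: mult.assoc)
        have "e * ?h \<simeq> e * ?x" by (rule eqv_left[OF hx eA])
        also have "\<dots> \<simeq> ?x" by (rule ex)
        also have "\<dots> \<simeq> ?h" by (rule eqv_sym[OF hx])
        finally obtain s where s: "?h \<simeq> s *\<^sub>R e"
          using minimal_scalar[OF e, of ?h] xA by (auto simp: star_scaleR star_add star_star add.commute)
        have "(r * p) *\<^sub>R m \<simeq> (r * p) *\<^sub>R (m * e)" by (rule eqv_scaleR[OF eqv_sym[OF Ve'[OF m]]])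
        also have "\<dots> = r *\<^sub>R (m * (p *\<^sub>R e))" by simp
        also have "\<dots> \<simeq> r *\<^sub>R (m * (k * k))" by (intro eqv_scaleR eqv_left eqv_sym[OF p(2)] mA)
        also have "\<dots> \<simeq> r *\<^sub>R (m * (k * (e * k)))"
          by (intro eqv_scaleR eqv_left eqv_sym[OF Ve[OF k(1)]] mA kA)
        also have "\<dots> = m * k * (r *\<^sub>R e) * k" by (simp add: mult.assoc)
        also have "\<dots> \<simeq> m * k * (l * l) * k"
          by (intro eqv_right eqv_left eqv_sym[OF r(2)]) (use mA kA in auto)
        also have "\<dots> = ?x * (l * k)" by (simp add: mult.assoc)
        also have "\<dots> \<simeq> s *\<^sub>R e * (l * k)"
          by (rule eqv_right[OF eqv_trans[OF eqv_sym[OF hx] s]]) (use lA kA in auto)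
        also have "\<dots> = s *\<^sub>R (e * l * k)" by (simp add: mult.assoc)
        also have "\<dots> \<simeq> s *\<^sub>R (l * k)" by (intro eqv_scaleR eqv_right Ve l kA)
        finally have "(1 / (r * p)) *\<^sub>R ((r * p) *\<^sub>R m) \<simeq> (1 / (r * p)) *\<^sub>R (s *\<^sub>R (l * k))" by (rule eqv_scaleR)
        then have "m \<simeq> (s / (r * p)) *\<^sub>R (l * k)" using r(1) p(1) by simp
        then show ?thesis by blast
      qed
      have "\<exists>y\<in>span {k, l, l * k}. m \<simeq> y" if m: "m \<in> V" for m
      proof -
        obtain a where a: "k * (m - a *\<^sub>R k) + (m - a *\<^sub>R k) * k \<simeq> 0" using split[OF k m] by blast
        let ?m1 = "m - a *\<^sub>R k"
        have m1: "?m1 \<in> V" by (rule V_comb[OF m k(1)])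
        obtain b where b: "l * (?m1 - b *\<^sub>R l) + (?m1 - b *\<^sub>R l) * l \<simeq> 0" using split[OF l(1,3) m1] by blast
        let ?m2 = "?m1 - b *\<^sub>R l"
        have "k * ?m2 + ?m2 * k = (k * ?m1 + ?m1 * k) - b *\<^sub>R (k * l + l * k)"
          by (simp add: algebra_simps)
        also have "\<dots> \<simeq> 0 - b *\<^sub>R 0" by (intro eqv_diff eqv_scaleR a l)
        finally have "k * ?m2 + ?m2 * k \<simeq> 0" by simp
        then obtain c where c: "?m2 \<simeq> c *\<^sub>R (l * k)" using quaternion[OF V_comb[OF m1 l(1)] _ b] by blast
        have "m \<simeq> a *\<^sub>R k + b *\<^sub>R l + c *\<^sub>R (l * k)" using c by (simp add: eqv_def algebra_simps)
        moreover have "a *\<^sub>R k + b *\<^sub>R l + c *\<^sub>R (l * k) \<in> span {k, l, l * k}"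
          by (intro span_add span_scale span_base) auto
        ultimately show ?thesis by blast
      qed
      then show ?thesis unfolding finite_mod_def using kA lA by (intro exI[of _ "{k, l, l * k}"]) auto
    qed
  qed
  then obtain B where B: "finite B" "B \<subseteq> A" "\<And>k. k \<in> V \<Longrightarrow> \<exists>y\<in>span B. k \<simeq> y" unfolding finite_mod_def by blast
  have "\<exists>y\<in>span (insert e B). x \<simeq> y" if x: "x \<in> corner e e" for x
  proof -
    have xA: "x \<in> A" and ex: "e * x \<simeq> x" and xe: "x * e \<simeq> x" using x by (auto simp: corner_def)
    have es': "e * star x \<simeq> star x" using eqv_star[OF xe] by (simp add: star_mult es)
    let ?h = "(1/2) *\<^sub>R (x + star x)" and ?k = "(1/2) *\<^sub>R (x - star x)"
    have "e * ?h \<simeq> ?h" using eqv_scaleR[OF eqv_add[OF ex es'], of "1/2"] by (simp add: distrib_left)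
    then obtain c where c: "?h \<simeq> c *\<^sub>R e"
      using minimal_scalar[OF e, of ?h] xA by (auto simp: star_scaleR star_add star_star add.commute)
    have "e * ?k \<simeq> ?k" using eqv_scaleR[OF eqv_diff[OF ex es'], of "1/2"] by (simp add: right_diff_distrib)
    then have "?k \<in> V"
      using xA by (simp add: V_def star_scaleR star_diff star_star scaleR_minus_right[symmetric] del: scaleR_minus_right)
    then obtain y where y: "y \<in> span B" "?k \<simeq> y" using B(3) by blast
    have "x = ?h + ?k" by (simp add: scaleR_add_right scaleR_diff_right scaleR_halves)
    then have "x \<simeq> c *\<^sub>R e + y" using eqv_add[OF c y(2)] by simp
    moreover have "c *\<^sub>R e + y \<in> span (insert e B)"
      using y(1) span_mono[of B "insert e B"] by (intro span_add span_scale) (auto intro: span_base)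
    ultimately show ?thesis by blast
  qed
  then show ?thesis unfolding finite_mod_def using B eA by (intro exI[of _ "insert e B"]) auto
qed

text \<open>A single \<open>b\<close> outside \<open>I\<close> in the corner reduces the claim to
  the corner of \<open>f\<close>: since b b* is a nonzero multiple of \<open>e\<close>, every x is a
  multiple of b (b* x) modulo \<open>I\<close>, and b* x lies in the corner of
  \<open>f\<close>.\<close>

lemma finite_mod_corners:
  assumes e: "minimal e" and f: "minimal f"
  shows "finite_mod (corner e f)"
proof (cases "corner e f \<subseteq> I")
  case True
  then show ?thesis unfolding finite_mod_def by (intro exI[of _ "{}"]) (auto simp: eqv_0)
next
  case False
  then obtain b where b: "b \<in> A" "e * b \<simeq> b" "b * f \<simeq> b" "b \<notin> I" by (auto simp: corner_def)
  have fs: "star f = f" and es: "star e = e" and fA: "f \<in> A" using e f by (auto simp: minimal_def projD)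
  have "e * (b * star b) \<simeq> b * star b" using eqv_right[OF b(2) star_A[OF b(1)]] by (simp add: mult.assoc)
  then obtain c where c: "b * star b \<simeq> c *\<^sub>R e"
    using minimal_scalar[OF e, of "b * star b"] b(1) by (auto simp: star_mult star_star)
  have "c \<noteq> 0"
  proof
    assume "c = 0"
    then have "star (star b) * star b \<in> I" using c by (simp add: eqv_0 star_star)
    then have "star b \<in> I" using ideal_star_mult_self[OF star_A[OF b(1)]] by blast
    then show False using ideal_star[of "star b"] b(4) by (simp add: star_star)
  qed
  obtain B where B: "finite B" "B \<subseteq> A" "\<And>x. x \<in> corner f f \<Longrightarrow> \<exists>y\<in>span B. x \<simeq> y"
    using finite_mod_corner[OF f] unfolding finite_mod_def by blast
  have "\<exists>y\<in>span ((*) b ` B). x \<simeq> y" if x: "x \<in> corner e f" for x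
  proof -
    have xA: "x \<in> A" and ex: "e * x \<simeq> x" and xf: "x * f \<simeq> x" using x by (auto simp: corner_def)
    have "f * star b \<simeq> star b" using eqv_star[OF b(3)] by (simp add: star_mult fs)
    then have "star b * x \<in> corner f f"
      using eqv_right[of "f * star b" "star b" x] eqv_left[OF xf star_A[OF b(1)]] xA b(1)
      by (simp add: corner_def mult.assoc)
    then obtain y where y: "y \<in> span B" "star b * x \<simeq> y" using B(3) by blast
    have "x \<simeq> (1 / c) *\<^sub>R (c *\<^sub>R (e * x))" using eqv_sym[OF ex] \<open>c \<noteq> 0\<close> by simp
    also have "\<dots> \<simeq> (1 / c) *\<^sub>R (b * star b * x)"
      using eqv_scaleR[OF eqv_right[OF eqv_sym[OF c] xA], of "1 / c"] by simp
    also have "\<dots> = (1 / c) *\<^sub>R (b * (star b * x))" by (simp add: mult.assoc)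
    also have "\<dots> \<simeq> (1 / c) *\<^sub>R (b * y)" by (intro eqv_scaleR eqv_left y b)
    also have "\<dots> = b * ((1 / c) *\<^sub>R y)" by simp
    finally have "x \<simeq> b * ((1 / c) *\<^sub>R y)" .
    moreover have "b * ((1 / c) *\<^sub>R y) \<in> (*) b ` span B"
      using y(1) by (intro imageI span_scale)
    then have "b * ((1 / c) *\<^sub>R y) \<in> span ((*) b ` B)"
      using linear_span_image[OF bounded_linear.linear[OF bounded_linear_mult_right[of b]], of B] by simp
    ultimately show ?thesis by blast
  qed
  then show ?thesis unfolding finite_mod_def using B b(1) by (intro exI[of _ "(*) b ` B"]) auto
qed

lemma finite_mod_algebra: "finite_mod A"
proof -
  obtain F where F: "finite F" "\<forall>e\<in>F. minimal e" "\<forall>e\<in>F. \<forall>f\<in>F. e \<noteq> f \<longrightarrow> e * f \<simeq> 0"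
    "\<forall>f. minimal f \<longrightarrow> (\<exists>e\<in>F. \<not> e * f \<simeq> 0)"
    using maximal_orthogonal_family by blast
  have p: "proj e" if "e \<in> F" for e using F(2) that by (simp add: minimal_def)
  have "\<forall>z\<in>F \<times> F. \<exists>B. finite B \<and> B \<subseteq> A \<and> (\<forall>x\<in>corner (fst z) (snd z). \<exists>y\<in>span B. x \<simeq> y)"
    using finite_mod_corners F(2) unfolding finite_mod_def by auto
  then obtain B where B: "\<And>z. z \<in> F \<times> F \<Longrightarrow> finite (B z) \<and> B z \<subseteq> A \<and>
      (\<forall>x\<in>corner (fst z) (snd z). \<exists>y\<in>span (B z). x \<simeq> y)"
    by (metis bchoice)
  let ?B = "\<Union>z\<in>F \<times> F. B z"
  have "\<exists>y\<in>span ?B. a \<simeq> y" if a: "a \<in> A" for a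
  proof -
    have SF: "\<Sum>F \<in> A" by (intro subspace_sum[OF subspace_A] projD(1) p)
    have Ss: "star (\<Sum>F) = \<Sum>F"
    proof -
      have "star (\<Sum>F) = (\<Sum>e\<in>F. star e)"
        by (simp add: linear_sum[OF bounded_linear.linear[OF bounded_linear_star]])
      also have "\<dots> = \<Sum>F" by (intro sum.cong) (auto simp: projD p)
      finally show ?thesis .
    qed
    \<comment> \<open>The Peirce decomposition: using the unit modulo \<open>I\<close> on both sides
      splits \<open>a\<close> into finitely many corner components.\<close>
    have "a \<simeq> \<Sum>F * a" by (rule eqv_family_mult[OF F a])
    also have "\<dots> \<simeq> \<Sum>F * (a * \<Sum>F)"
      using eqv_star[OF eqv_family_mult[OF F star_A[OF a]]]
      by (intro eqv_left SF) (simp add: star_mult star_star Ss)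
    also have "\<dots> = (\<Sum>e\<in>F. \<Sum>f\<in>F. e * (a * f))"
      by (simp add: sum_distrib_left sum_distrib_right) (rule sum.swap)
    also have "\<dots> = (\<Sum>z\<in>F \<times> F. fst z * (a * snd z))"
      by (simp add: sum.cartesian_product split_beta)
    finally have 1: "a \<simeq> (\<Sum>z\<in>F \<times> F. fst z * (a * snd z))" .
    have "\<exists>y\<in>span ?B. fst z * (a * snd z) \<simeq> y" if z: "z \<in> F \<times> F" for z
    proof -
      have pz: "proj (fst z)" "proj (snd z)" using z p by auto
      have "fst z * (a * snd z) \<in> corner (fst z) (snd z)"
        using eqv_right[OF projD(3)[OF pz(1)], of "a * snd z"] eqv_left[OF projD(3)[OF pz(2)], of "fst z * a"]
          projD(1)[OF pz(1)] projD(1)[OF pz(2)] a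
        by (simp add: corner_def mult.assoc)
      then obtain y where "y \<in> span (B z)" "fst z * (a * snd z) \<simeq> y" using B[OF z] by blast
      moreover have "span (B z) \<subseteq> span ?B" using z by (intro span_mono) auto
      ultimately show ?thesis by blast
    qed
    then obtain y where y: "\<And>z. z \<in> F \<times> F \<Longrightarrow> y z \<in> span ?B" "\<And>z. z \<in> F \<times> F \<Longrightarrow> fst z * (a * snd z) \<simeq> y z"
      by metis
    have "a \<simeq> (\<Sum>z\<in>F \<times> F. y z)" by (rule eqv_trans[OF 1 eqv_sum[OF y(2)]])
    moreover have "(\<Sum>z\<in>F \<times> F. y z) \<in> span ?B" by (intro span_sum y(1))
    ultimately show ?thesis by blast
  qed
  then show ?thesis
    unfolding finite_mod_def using B F(1) by (intro exI[of _ ?B]) auto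
qed

end

section \<open>Continuity of generalised triple derivations\<close>

sublocale triple_map \<subseteq> ideal: spectral_ideal A I
  by unfold_locales (rule spectral_decomposition)

lemma (in triple_map) bounded_over_A: "bounded_over A \<delta>"
proof -
  obtain B where B: "finite B" "B \<subseteq> A" "\<And>x. x \<in> A \<Longrightarrow> \<exists>y\<in>span B. x - y \<in> I"
    using ideal.finite_mod_algebra unfolding ideal.finite_mod_def ideal.eqv_def by blast
  have "I \<subseteq> A" using I_A by blast
  from bounded_over_finite_codim[OF closed_I subspace_I subspace_A this B(2,1) linear_\<delta> bounded_over_I B(3)]
  show ?thesis .
qed

text \<open>With two arguments fixed, the terms involving \<delta> at those arguments are continuous
  in the third. So the joint defect and these terms together bound the difference that remains,
  although \<delta> itself may be discontinuous.\<close>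

lemma real_cstar_module_triple_map:
  fixes A :: "'b::cstar_algebra set" and q\<^sub>1 :: "'y::banach \<Rightarrow> 'b \<Rightarrow> 'b \<Rightarrow> 'y"
  assumes A: "real_cstar_algebra A"
    and module: "real_jordan_banach_triple_module A cstar_triple q\<^sub>1 q\<^sub>2 q\<^sub>3"
    and derivation: "real_generalised_triple_derivation A cstar_triple q\<^sub>1 q\<^sub>2 q\<^sub>3 \<delta>"
  shows "triple_map A \<delta> q\<^sub>2 q\<^sub>3"
proof -
  interpret real_jordan_banach_triple_module A cstar_triple q\<^sub>1 q\<^sub>2 q\<^sub>3 by (rule module)
  interpret real_cstar A by unfold_locales (rule A)
  let ?\<phi> = "derivation_defect cstar_triple q\<^sub>1 q\<^sub>2 q\<^sub>3 \<delta>"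
  have lin: "real_linear_on A \<delta>" and cont: "continuous_on (A \<times> A \<times> A) ?\<phi>"
    using derivation by (simp_all add: real_generalised_triple_derivation_def)
  have c1: "continuous_on S (\<lambda>t. q\<^sub>1 (x t) (a t) (b t))"
    if "continuous_on S x" "continuous_on S a" "continuous_on S b" "a ` S \<subseteq> A" "b ` S \<subseteq> A"
    for x a b and S :: "'c::topological_space set"
    using continuous_on_compose2[OF p1_continuous continuous_on_Pair[OF that(1) continuous_on_Pair[OF that(2,3)]]] that(4,5)
    by (simp add: image_subset_iff)
  have c2: "continuous_on S (\<lambda>t. q\<^sub>2 (a t) (x t) (b t))"
    if "continuous_on S x" "continuous_on S a" "continuous_on S b" "a ` S \<subseteq> A" "b ` S \<subseteq> A"
    for x a b and S :: "'c::topological_space set"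
    using continuous_on_compose2[OF p2_continuous continuous_on_Pair[OF that(2) continuous_on_Pair[OF that(1,3)]]] that(4,5)
    by (simp add: image_subset_iff)
  have c3: "continuous_on S (\<lambda>t. q\<^sub>3 (a t) (b t) (x t))"
    if "continuous_on S x" "continuous_on S a" "continuous_on S b" "a ` S \<subseteq> A" "b ` S \<subseteq> A"
    for x a b and S :: "'c::topological_space set"
    using continuous_on_compose2[OF p3_continuous continuous_on_Pair[OF that(2) continuous_on_Pair[OF that(3,1)]]] that(4,5)
    by (simp add: image_subset_iff)
  have c\<phi>: "continuous_on S (\<lambda>t. ?\<phi> (a t, b t, c t))"
    if "continuous_on S a" "continuous_on S b" "continuous_on S c" "a ` S \<subseteq> A" "b ` S \<subseteq> A" "c ` S \<subseteq> A"
    for a b c and S :: "'c::topological_space set"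
    using continuous_on_compose2[OF cont continuous_on_Pair[OF that(1) continuous_on_Pair[OF that(2,3)]]] that(4-6)
    by (simp add: image_subset_iff)
  show ?thesis
  proof (intro triple_map.intro triple_map_axioms.intro)
    show "real_cstar A" by (rule real_cstar_axioms)
    show "real_linear_on A \<delta>" by (rule lin)
    fix a b assume a: "a \<in> A" and b: "b \<in> A"
    show outer: "bounded_linear (q\<^sub>3 a b)"
      by (rule real_linear_on_bounded_linear[OF p3_linear3[OF a b] c3]) (use a b in auto)
    show inner: "bounded_linear (\<lambda>x. q\<^sub>2 a x b)"
      by (rule real_linear_on_bounded_linear[OF p2_linear2[OF a b] c2]) (use a b in auto)
    show "bounded_over A (\<lambda>t. \<delta> (cstar_triple a b t) - q\<^sub>3 a b (\<delta> t))"
    proof (rule real_linear_on_continuous_bounded[OF _ subspace_A])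
      show "real_linear_on A (\<lambda>t. \<delta> (cstar_triple a b t) - q\<^sub>3 a b (\<delta> t))"
        using lin a b bounded_linear.linear[OF outer] unfolding real_linear_on_def
        by (simp add: cstar_triple_add cstar_triple_scaleR linear_add linear_cmul scaleR_diff_right)
      have "\<delta> (cstar_triple a b t) - q\<^sub>3 a b (\<delta> t) = ?\<phi> (a, b, t) + q\<^sub>1 (\<delta> a) b t + q\<^sub>2 a (\<delta> b) t" for t
        by (simp add: derivation_defect_def)
      then show "continuous_on A (\<lambda>t. \<delta> (cstar_triple a b t) - q\<^sub>3 a b (\<delta> t))"
        using a b by (auto intro!: continuous_on_add c1 c2 c\<phi> continuous_on_const continuous_on_id)
    qed
    show "bounded_over A (\<lambda>t. \<delta> (cstar_triple a t b) - q\<^sub>2 a (\<delta> t) b)"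
    proof (rule real_linear_on_continuous_bounded[OF _ subspace_A])
      show "real_linear_on A (\<lambda>t. \<delta> (cstar_triple a t b) - q\<^sub>2 a (\<delta> t) b)"
        using lin a b linear_add[OF bounded_linear.linear[OF inner]] linear_cmul[OF bounded_linear.linear[OF inner]]
        unfolding real_linear_on_def
        by (simp add: cstar_triple_add cstar_triple_scaleR scaleR_diff_right)
      have "\<delta> (cstar_triple a t b) - q\<^sub>2 a (\<delta> t) b = ?\<phi> (a, t, b) + q\<^sub>1 (\<delta> a) t b + q\<^sub>3 a t (\<delta> b)" for t
        by (simp add: derivation_defect_def)
      then show "continuous_on A (\<lambda>t. \<delta> (cstar_triple a t b) - q\<^sub>2 a (\<delta> t) b)"
        using a b by (auto intro!: continuous_on_add c1 c3 c\<phi> continuous_on_const continuous_on_id)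
    qed
  next
    fix b x assume b: "b \<in> A"
    show "continuous_on A (\<lambda>a. q\<^sub>3 a b x)" "continuous_on A (\<lambda>a. q\<^sub>2 a x b)"
      by (rule c3 c2; use b in \<open>auto intro: continuous_on_const continuous_on_id\<close>)+
  next
    fix a x assume a: "a \<in> A"
    show "continuous_on A (\<lambda>b. q\<^sub>3 a b x)"
      by (rule c3; use a in \<open>auto intro: continuous_on_const continuous_on_id\<close>)
  qed
qed

lemma continuous_on_real_derivation:
  assumes "real_cstar_algebra A" "real_jordan_banach_triple_module A cstar_triple q\<^sub>1 q\<^sub>2 q\<^sub>3"
    "real_generalised_triple_derivation A cstar_triple q\<^sub>1 q\<^sub>2 q\<^sub>3 \<delta>"
  shows "continuous_on A \<delta>"
proof -
  interpret triple_map A \<delta> q\<^sub>2 q\<^sub>3 by (rule real_cstar_module_triple_map[OF assms])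
  show ?thesis by (rule real_linear_on_bounded_continuous[OF linear_\<delta> subspace_A bounded_over_A])
qed

lemma complex_linear_on_real: "complex_linear_on E f \<Longrightarrow> real_linear_on E f"
  by (simp add: complex_linear_on_def real_linear_on_def scaleR_scaleC)

lemma conj_linear_on_real: "conj_linear_on E f \<Longrightarrow> real_linear_on E f"
  by (simp add: conj_linear_on_def real_linear_on_def scaleR_scaleC)

lemma real_cstar_algebra_UNIV: "real_cstar_algebra UNIV"
  by (simp add: real_cstar_algebra_def)

lemma complex_module_real:
  fixes p\<^sub>1 :: "'x::complex_banach \<Rightarrow> 'a::cstar_algebra \<Rightarrow> 'a \<Rightarrow> 'x"
  assumes "complex_jordan_banach_triple_module UNIV cstar_triple p\<^sub>1 p\<^sub>2 p\<^sub>3"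
  shows "real_jordan_banach_triple_module UNIV cstar_triple p\<^sub>1 p\<^sub>2 p\<^sub>3"
proof -
  interpret complex_jordan_banach_triple_module UNIV cstar_triple p\<^sub>1 p\<^sub>2 p\<^sub>3 by (rule assms)
  interpret real: real_jordan_triple UNIV "cstar_triple :: 'a \<Rightarrow> 'a \<Rightarrow> 'a \<Rightarrow> 'a"
    by (rule real_cstar_real_jordan_triple[OF real_cstar_algebra_UNIV])
  show ?thesis
    by unfold_locales
      (auto intro: complex_linear_on_real conj_linear_on_real p1_linear1 p1_linear2 p1_linear3
        p2_linear1 p2_linear2 p2_linear3 p3_linear1 p3_linear2 p3_linear3)
qed

theorem theorem22:
  fixes p\<^sub>1 :: "'x::complex_banach \<Rightarrow> 'a::cstar_algebra \<Rightarrow> 'a \<Rightarrow> 'x"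
    and p\<^sub>2 :: "'a \<Rightarrow> 'x \<Rightarrow> 'a \<Rightarrow> 'x"
    and p\<^sub>3 :: "'a \<Rightarrow> 'a \<Rightarrow> 'x \<Rightarrow> 'x"
    and \<delta> :: "'a \<Rightarrow> 'x"
    and A :: "'b::cstar_algebra set"
    and q\<^sub>1 :: "'y::banach \<Rightarrow> 'b \<Rightarrow> 'b \<Rightarrow> 'y"
    and q\<^sub>2 :: "'b \<Rightarrow> 'y \<Rightarrow> 'b \<Rightarrow> 'y"
    and q\<^sub>3 :: "'b \<Rightarrow> 'b \<Rightarrow> 'y \<Rightarrow> 'y"
    and \<epsilon> :: "'b \<Rightarrow> 'y"
  shows "(complex_jordan_banach_triple_module UNIV cstar_triple p\<^sub>1 p\<^sub>2 p\<^sub>3 \<and>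
          complex_generalised_triple_derivation UNIV cstar_triple p\<^sub>1 p\<^sub>2 p\<^sub>3 \<delta> \<longrightarrow>
          continuous_on UNIV \<delta>) \<and>
         (real_cstar_algebra A \<and>
          real_jordan_banach_triple_module A cstar_triple q\<^sub>1 q\<^sub>2 q\<^sub>3 \<and>
          real_generalised_triple_derivation A cstar_triple q\<^sub>1 q\<^sub>2 q\<^sub>3 \<epsilon> \<longrightarrow>
          continuous_on A \<epsilon>)"
proof (intro conjI impI; elim conjE)
  assume "complex_jordan_banach_triple_module UNIV cstar_triple p\<^sub>1 p\<^sub>2 p\<^sub>3"
    and "complex_generalised_triple_derivation UNIV cstar_triple p\<^sub>1 p\<^sub>2 p\<^sub>3 \<delta>"
  then show "continuous_on UNIV \<delta>"
    by (intro continuous_on_real_derivation[OF real_cstar_algebra_UNIV complex_module_real])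
      (auto simp: complex_generalised_triple_derivation_def real_generalised_triple_derivation_def
        intro: conj_linear_on_real)
next
  assume "real_cstar_algebra A" "real_jordan_banach_triple_module A cstar_triple q\<^sub>1 q\<^sub>2 q\<^sub>3"
    "real_generalised_triple_derivation A cstar_triple q\<^sub>1 q\<^sub>2 q\<^sub>3 \<epsilon>"
  then show "continuous_on A \<epsilon>" by (rule continuous_on_real_derivation)
qed

end
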